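(* Let $n\ge 1$ be an integer and $q$ a prime power. Fix a choice of sign (upper or lower). Let $\Sigma^\pm$ be a nonempty family of hyperplanes of $\mathrm{PG}(2n+1,q)$ satisfying the following two properties: (P1) Every point of $\mathrm{PG}(2n+1,q)$ is contained in $q^n(q^n\mp 1)$ or $q^{2n}$ hyperplanes of $\Sigma^\pm$. (P2) Every subspace of $\mathrm{PG}(2n+1,q)$ of codimension $2$ which is contained in a hyperplane of $\Sigma^\pm$ is contained in at least $q-1$ hyperplanes of $\Sigma^\pm$. Then the following hold. (a) If $n\ge 2$ and $q>2$, then (for either sign) there is a non-singular quadric $\mathcal{Q}^\pm(2n+1,q)$ in $\mathrm{PG}(2n+1,q)$ such that $\Sigma^\pm$ is the set of all hyperplanes of $\mathrm{PG}(2n+1,q)$ meeting $\mathcal{Q}^\pm(2n+1,q)$ in a parabolic quadric $\mathcal{Q}(2n,q)$. (b) If $n=1$, then for all $q$ the collection $\Sigma^+$ (upper sign) is the set of planes of $\mathrm{PG}(3,q)$ meeting some hyperbolic quadric in an irreducible conic. (c) If $n=1$, then for all $q$ the collection $\Sigma^-$ (lower sign) is either the set of planes of $\mathrm{PG}(3,q)$ meeting some ovoid in an oval, or the set of planes of $\mathrm{PG}(3,q)$ meeting some fixed line in a unique point.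
   Context: $\mathrm{PG}(k,q)$ is the $k$-dimensional projective space over the finite field with $q$ elements. Sign convention: in every expression $\pm$ reads $+$ and $\mp$ reads $-$ in the hyperbolic case (upper sign), and $\pm$ reads $-$ and $\mp$ reads $+$ in the elliptic case (lower sign), consistently; so each statement with $\pm$ or $\mp$ is two statements. $\mathcal{Q}^+(2n+1,q)$ denotes a (non-singular) hyperbolic quadric and $\mathcal{Q}^-(2n+1,q)$ a (non-singular) elliptic quadric of $\mathrm{PG}(2n+1,q)$; $\mathcal{Q}(2n,q)$ denotes a parabolic quadric, i.e. a non-singular quadric of a $2n$-dimensional projective space (for $n=1$, an irreducible conic in a plane). An ovoid of $\mathrm{PG}(3,q)$ is a set of $q^2+1$ points, no three collinear, that every plane meets in either $1$ or $q+1$ points; planes meeting it in $q+1$ points meet it in an oval (a set of $q+1$ points in the plane, no three collinear). *)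

theory Defs
  imports "HOL-Analysis.Cartesian_Space"
begin

text \<open>
  \<open>PG(k,q)\<close> is modelled on the vector space \<open>'a ^ 'm\<close>, where \<open>'a\<close> is a finite field with \<open>q = CARD('a)\<close>
  and \<open>CARD('m) = k + 1\<close>. A subspace of projective dimension \<open>d\<close> is a linear subspace of
  dimension \<open>d + 1\<close>; incidence is inclusion.
\<close>

definition proj_subspace :: "nat \<Rightarrow> ('a::field ^ 'm) set \<Rightarrow> bool" where
  "proj_subspace d S \<longleftrightarrow> vec.subspace S \<and> vec.dim S = d + 1"

definition points_of :: "('a::field ^ 'm) set \<Rightarrow> ('a ^ 'm) set set" where
  "points_of S = {p. proj_subspace 0 p \<and> p \<subseteq> S}"

definition quadratic_form :: "('a::field ^ 'm \<Rightarrow> 'a) \<Rightarrow> bool" where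
  "quadratic_form Q \<longleftrightarrow>
     (\<exists>c :: 'm \<Rightarrow> 'm \<Rightarrow> 'a. \<forall>x. Q x = (\<Sum>i\<in>UNIV. \<Sum>j\<in>UNIV. c i j * x $ i * x $ j))"

definition polar_form :: "('a::field ^ 'm \<Rightarrow> 'a) \<Rightarrow> 'a ^ 'm \<Rightarrow> 'a ^ 'm \<Rightarrow> 'a" where
  "polar_form Q v w = Q (v + w) - Q v - Q w"

text \<open>
  Non-singular means that the quadric has no singular point. In characteristic 2 the polar form may
  have a nonzero radical (it always does on odd-dimensional spaces); only radical vectors on
  which \<open>Q\<close> vanishes are singular. Every quadratic form on a subspace \<open>S\<close> is the restriction of
  one on the whole space, so the forms below live on the whole space.
\<close>

definition nonsingular_on :: "('a::field ^ 'm) set \<Rightarrow> ('a ^ 'm \<Rightarrow> 'a) \<Rightarrow> bool" where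
  "nonsingular_on S Q \<longleftrightarrow>
     (\<forall>v\<in>S. Q v = 0 \<and> (\<forall>w\<in>S. polar_form Q v w = 0) \<longrightarrow> v = 0)"

definition nonsingular_quadric :: "('a::field ^ 'm) set \<Rightarrow> ('a ^ 'm) set set \<Rightarrow> bool" where
  "nonsingular_quadric S X \<longleftrightarrow>
     (\<exists>Q. quadratic_form Q \<and> nonsingular_on S Q \<and>
          X = {p \<in> points_of S. \<forall>v\<in>p. Q v = 0})"

definition parabolic_quadric :: "nat \<Rightarrow> ('a::field ^ 'm) set \<Rightarrow> ('a ^ 'm) set set \<Rightarrow> bool" where
  "parabolic_quadric n S X \<longleftrightarrow> proj_subspace (2 * n) S \<and> nonsingular_quadric S X"

definition has_proj_index :: "('a::field ^ 'm) set set \<Rightarrow> nat \<Rightarrow> bool" where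
  "has_proj_index X d \<longleftrightarrow>
     (\<exists>U. proj_subspace d U \<and> points_of U \<subseteq> X) \<and>
     (\<forall>e U. proj_subspace e U \<and> points_of U \<subseteq> X \<longrightarrow> e \<le> d)"

text \<open>
  The non-singular quadrics of \<open>PG(2n+1,q)\<close> are hyperbolic or elliptic according to whether their
  generators have projective dimension \<open>n\<close> or \<open>n - 1\<close> (the latter is used for \<open>n \<ge> 1\<close> only).
\<close>

definition hyperbolic_quadric :: "nat \<Rightarrow> ('a::field ^ 'm) set set \<Rightarrow> bool" where
  "hyperbolic_quadric n X \<longleftrightarrow> proj_subspace (2 * n + 1) (UNIV :: ('a ^ 'm) set) \<and>
     nonsingular_quadric UNIV X \<and> has_proj_index X n"

definition elliptic_quadric :: "nat \<Rightarrow> ('a::field ^ 'm) set set \<Rightarrow> bool" where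
  "elliptic_quadric n X \<longleftrightarrow> proj_subspace (2 * n + 1) (UNIV :: ('a ^ 'm) set) \<and>
     nonsingular_quadric UNIV X \<and> has_proj_index X (n - 1)"

datatype quadric_sign = Upper | Lower

fun signed_quadric :: "quadric_sign \<Rightarrow> nat \<Rightarrow> ('a::field ^ 'm) set set \<Rightarrow> bool" where
  "signed_quadric Upper n X = hyperbolic_quadric n X"
| "signed_quadric Lower n X = elliptic_quadric n X"

text \<open>The number \<open>q^n (q^n \<mp> 1)\<close>, the upper sign being the hyperbolic case.\<close>

fun signed_count :: "quadric_sign \<Rightarrow> nat \<Rightarrow> nat \<Rightarrow> nat" where
  "signed_count Upper q n = q ^ n * (q ^ n - 1)"
| "signed_count Lower q n = q ^ n * (q ^ n + 1)"

definition no_three_collinear :: "('a::field ^ 'm) set set \<Rightarrow> bool" where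
  "no_three_collinear X \<longleftrightarrow>
     \<not> (\<exists>L p1 p2 p3. proj_subspace 1 L \<and> {p1, p2, p3} \<subseteq> X \<inter> points_of L \<and>
          p1 \<noteq> p2 \<and> p1 \<noteq> p3 \<and> p2 \<noteq> p3)"

definition oval_in :: "('a::{field,finite} ^ 'm) set \<Rightarrow> ('a ^ 'm) set set \<Rightarrow> bool" where
  "oval_in P X \<longleftrightarrow> proj_subspace 2 P \<and> X \<subseteq> points_of P \<and>
     card X = CARD('a) + 1 \<and> no_three_collinear X"

definition ovoid :: "('a::{field,finite} ^ 'm) set set \<Rightarrow> bool" where
  "ovoid X \<longleftrightarrow> proj_subspace 3 (UNIV :: ('a ^ 'm) set) \<and> X \<subseteq> points_of UNIV \<and>
     card X = CARD('a) ^ 2 + 1 \<and> no_three_collinear X \<and>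
     (\<forall>P. proj_subspace 2 P \<longrightarrow> card (X \<inter> points_of P) \<in> {1, CARD('a) + 1})"

end

theory Submission
  imports Defs
begin

text \<open>
  The proof works in the dual space. A hyperplane is given by its normal vector, and \<open>N\<close> denotes the cone
  of all \<open>f\<close> with \<open>f = 0\<close> or \<open>f\<^sup>\<bottom> \<notin> \<Sigma>\<close>. Write \<open>Q = q^n\<close>, let \<open>e\<close> be the sign, and let \<open>B\<close> be
  \<open>Q\<^sup>2 + e(q - 1)Q\<close>. Property (P1) says that each hyperplane section of \<open>N\<close> has \<open>Q\<^sup>2\<close> or \<open>B\<close> vectors, as for
  a quadric; (P2) says that the lines of the dual space have 0, 1, 2 or \<open>q + 1\<close> points in \<open>N\<close>. It has to be
  shown that \<open>N\<close> is the zero set of a non-degenerate quadratic form. Its tangent hyperplanes then form the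
  required quadric of the original space.

  The number \<open>|N|\<close> satisfies a quadratic equation (\<open>size_quadratic\<close>), as the polynomial with the roots \<open>Q\<^sup>2\<close>
  and \<open>B\<close> vanishes at all section sizes. Its second root is impossible for arithmetic reasons, except in the
  elliptic case of 3-space, where it leads to the planes meeting a fixed line in a point. With the size of a
  quadric, the elliptic case of 3-space is settled by counting alone: the tangent planes of \<open>N\<close> form an ovoid.

  In the other cases, let \<open>tangent p\<close>, for a point \<open>p\<close> of \<open>N\<close>, be the union of all lines on \<open>p\<close> that are not
  secants. The same polynomial, summed over the hyperplanes on \<open>p\<close> only, shows that \<open>tangent p\<close> has the size of
  a hyperplane (\<open>size_tangent\<close>). It is one if all lines of the quotient space at \<open>p\<close> meet it. A plane on \<open>p\<close> all
  of whose lines on \<open>p\<close> are secants meets \<open>N\<close> either in a hyperoval or in a line and a point. Hyperovals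
  are excluded because too many points of \<open>N\<close> would be needed (\<open>no_hyperoval_plane\<close>). A line and a point
  are excluded by an averaging argument: the planes on a secant \<open>pr\<close> contain, on average, one non-secant on
  \<open>p\<close> and one on \<open>r\<close>, never fewer than two in total, and more than two if the section is a line and a point
  (\<open>one_tangent_on_secant_plane\<close>). This uses \<open>q > 2\<close>. For hyperbolic quadrics of 3-space, the tangent
  hyperplane is simply the plane of the two contained lines on \<open>p\<close>.

  Given the tangent hyperplanes, fix a secant \<open>pr\<close> and let \<open>W\<close> be the intersection of the two tangent hyperplanes.
  The points of \<open>N\<close> off \<open>tangent p\<close> are the \<open>r + w - F(w)p\<close> for a function \<open>F\<close> on \<open>W\<close>, and \<open>N\<close> is the
  zero set of \<open>xy + F(w)\<close> in the coordinates \<open>xp + yr + w\<close> once \<open>F\<close> is homogeneous of degree 2. The function \<open>F\<close>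
  is affine along the directions in \<open>N \<inter> W\<close>, with slopes that vanish exactly on hyperplanes. Since \<open>N \<inter> W\<close> spans
  \<open>W\<close>, this forces \<open>F\<close> to be a quadratic form (\<open>affine_along\<close>).

  The form is non-degenerate because of the size of \<open>N\<close>, and its polarity carries the quadric over to the original
  space. A count of zeros in the cosets of a maximal totally singular subspace determines the dimension of this
  subspace and thereby the type of the quadric (\<open>maximal_singular_size\<close>).
\<close>

section \<open>Orthogonality in a finite coordinate space\<close>

lemma field_card_ge_2: "CARD('a::{field,finite}) \<ge> 2"
proof -
  have "card {0::'a, 1} \<le> CARD('a)" by (rule card_mono) auto
  then show ?thesis by simp
qed

lemma card_nonzero_scalars: "card (UNIV - {0::'a::{field,finite}}) = CARD('a) - 1"
  by (simp add: card_Diff_subset)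

lemma card_span_independent:
  fixes B :: "('a::{field,finite} ^ 'm::finite) set"
  assumes "vec.independent B"
  shows "card (vec.span B) = CARD('a) ^ card B"
proof -
  have "finite B" by simp
  then show ?thesis using assms
  proof (induction B rule: finite_induct)
    case (insert b B)
    have indB: "vec.independent B" and b: "b \<notin> vec.span B"
      using insert.prems insert.hyps by (simp_all add: vec.independent_insert)
    let ?f = "\<lambda>(c::'a, x). c *s b + x"
    have inj: "inj_on ?f (UNIV \<times> vec.span B)"
    proof (rule inj_onI, clarsimp)
      fix c d :: 'a and x y
      assume x: "x \<in> vec.span B" and y: "y \<in> vec.span B" and eq: "c *s b + x = d *s b + y"
      have "(c - d) *s b = y - x" using eq by (simp add: algebra_simps vec.scale_left_diff_distrib)
      then have mem: "(c - d) *s b \<in> vec.span B" using x y by (simp add: vec.span_diff)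
      have "c = d"
      proof (rule ccontr)
        assume "c \<noteq> d"
        then have "b = inverse (c - d) *s ((c - d) *s b)" by simp
        then show False using b vec.span_scale[OF mem, of "inverse (c - d)"] by simp
      qed
      then show "c = d \<and> x = y" using eq by simp
    qed
    have img: "vec.span (insert b B) = ?f ` (UNIV \<times> vec.span B)"
    proof (rule set_eqI, rule iffI)
      fix z assume "z \<in> vec.span (insert b B)"
      then obtain k where "z - k *s b \<in> vec.span B" using vec.span_breakdown_eq by blast
      then show "z \<in> ?f ` (UNIV \<times> vec.span B)" by (intro image_eqI[of _ _ "(k, z - k *s b)"]) auto
    next
      fix z assume "z \<in> ?f ` (UNIV \<times> vec.span B)"
      then obtain c x where z: "z = c *s b + x" "x \<in> vec.span B" by auto
      then show "z \<in> vec.span (insert b B)"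
        using subsetD[OF vec.span_mono[OF subset_insertI[of B b]] z(2)]
        unfolding z(1) by (intro vec.span_add vec.span_scale) (auto intro: vec.span_base)
    qed
    have "card (vec.span (insert b B)) = CARD('a) * card (vec.span B)"
      using img card_image[OF inj] by (simp add: card_cartesian_product)
    then show ?case using insert indB by simp
  qed simp
qed

lemma card_subspace:
  fixes S :: "('a::{field,finite} ^ 'm::finite) set"
  assumes "vec.subspace S"
  shows "card S = CARD('a) ^ vec.dim S"
proof -
  obtain B where "B \<subseteq> S" "vec.independent B" "S \<subseteq> vec.span B" "card B = vec.dim S"
    using vec.basis_exists by metis
  moreover have "vec.span B \<subseteq> S" using \<open>B \<subseteq> S\<close> assms by (rule vec.span_minimal)
  ultimately have "S = vec.span B" by blast
  then show ?thesis using card_span_independent[OF \<open>vec.independent B\<close>] \<open>card B = vec.dim S\<close> by simp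
qed

lemma dim_eq_iff_card:
  fixes S :: "('a::{field,finite} ^ 'm::finite) set"
  assumes "vec.subspace S"
  shows "vec.dim S = d \<longleftrightarrow> card S = CARD('a) ^ d"
  using card_subspace[OF assms] field_card_ge_2[where 'a='a] power_inject_exp[of "CARD('a)"] by auto

lemma card_vectors: "card (UNIV :: ('a::{field,finite} ^ 'm::finite) set) = CARD('a) ^ CARD('m)"
  by (rule CARD_vec)

definition dot :: "'a::field ^ 'm::finite \<Rightarrow> 'a ^ 'm \<Rightarrow> 'a" where
  "dot x y = (\<Sum>i\<in>UNIV. x $ i * y $ i)"

lemma dot_commute: "dot x y = dot y x"
  by (simp add: dot_def mult.commute)

lemma dot_add_left [simp]: "dot (x + y) z = dot x z + dot y z"
  by (simp add: dot_def algebra_simps sum.distrib)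

lemma dot_add_right [simp]: "dot z (x + y) = dot z x + dot z y"
  by (simp add: dot_def algebra_simps sum.distrib)

lemma dot_scale_left [simp]: "dot (c *s x) z = c * dot x z"
  by (simp add: dot_def sum_distrib_left algebra_simps)

lemma dot_scale_right [simp]: "dot z (c *s x) = c * dot z x"
  by (simp add: dot_def sum_distrib_left algebra_simps)

lemma dot_zero [simp]: "dot 0 z = 0" "dot z 0 = 0"
  by (simp_all add: dot_def)

lemma dot_minus_left [simp]: "dot (- x) z = - dot x z"
  by (simp add: dot_def sum_negf)

lemma dot_minus_right [simp]: "dot z (- x) = - dot z x"
  by (simp add: dot_def sum_negf)

lemma dot_diff_left [simp]: "dot (x - y) z = dot x z - dot y z"
  by (simp add: dot_def algebra_simps sum_subtractf)

lemma dot_diff_right [simp]: "dot z (x - y) = dot z x - dot z y"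
  by (simp add: dot_def algebra_simps sum_subtractf)

lemma dot_axis: "dot z (axis i 1) = z $ i"
  by (simp add: dot_def axis_def if_distrib[of "\<lambda>t. _ * t"] cong: if_cong)

lemma dot_nondegenerate:
  assumes "\<And>x. dot z x = 0"
  shows "z = 0"
  using assms[of "axis _ 1"] by (simp add: dot_axis vec_eq_iff)

definition perp :: "('a::field ^ 'm::finite) set \<Rightarrow> ('a ^ 'm) set" where
  "perp S = {f. \<forall>x\<in>S. dot f x = 0}"

abbreviation hyperplane :: "'a::field ^ 'm::finite \<Rightarrow> ('a ^ 'm) set" where
  "hyperplane f \<equiv> perp {f}"

lemma in_hyperplane_iff: "x \<in> hyperplane f \<longleftrightarrow> dot f x = 0"
  by (simp add: perp_def dot_commute)

lemma hyperplane_eq: "hyperplane f = {x. dot f x = 0}"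
  by (auto simp: in_hyperplane_iff)

lemma subspace_perp: "vec.subspace (perp S)"
  by (auto simp: perp_def vec.subspace_def)

lemma perp_span: "perp (vec.span S) = perp S"
proof -
  have "dot f x = 0" if f: "\<forall>x\<in>S. dot f x = 0" and x: "x \<in> vec.span S" for f x
  proof -
    have "vec.span S \<subseteq> hyperplane f"
      by (rule vec.span_minimal[OF _ subspace_perp]) (use f in \<open>auto simp: in_hyperplane_iff\<close>)
    then show ?thesis using x by (auto simp: in_hyperplane_iff)
  qed
  then show ?thesis using vec.span_superset[of S] by (auto simp: perp_def)
qed

lemma perp_Un: "perp (S \<union> T) = perp S \<inter> perp T"
  by (auto simp: perp_def)

lemma perp_empty [simp]: "perp {} = UNIV"
  by (auto simp: perp_def)

lemma perp_subset_iff: "S \<subseteq> perp T \<longleftrightarrow> T \<subseteq> perp S"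
proof -
  have "B \<subseteq> perp A" if "A \<subseteq> perp B" for A B :: "('a ^ 'b) set"
  proof
    fix b assume b: "b \<in> B"
    have "dot b a = 0" if "a \<in> A" for a
      using that b \<open>A \<subseteq> perp B\<close> dot_commute[of a b] by (auto simp: perp_def)
    then show "b \<in> perp A" by (simp add: perp_def)
  qed
  then show ?thesis by blast
qed

lemma perp_UNIV: "perp UNIV = {0 :: 'a::field ^ 'm::finite}"
  by (auto simp: perp_def intro: dot_nondegenerate)

lemma card_subspace_Int_hyperplane:
  fixes S :: "('a::{field,finite} ^ 'm::finite) set"
  assumes S: "vec.subspace S" and f: "f \<notin> perp S"
  shows "CARD('a) * card (S \<inter> hyperplane f) = card S"
proof -
  obtain y where y: "y \<in> S" "dot f y \<noteq> 0" using f by (auto simp: perp_def)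
  define x where "x = inverse (dot f y) *s y"
  have x: "x \<in> S" "dot f x = 1" using y S by (auto simp: x_def vec.subspace_scale)
  let ?g = "\<lambda>(c::'a, z). c *s x + z"
  have "bij_betw ?g (UNIV \<times> (S \<inter> hyperplane f)) S"
  proof (rule bij_betw_byWitness[where f' = "\<lambda>z. (dot f z, z - dot f z *s x)"])
    show "?g ` (UNIV \<times> (S \<inter> hyperplane f)) \<subseteq> S"
      using S x by (auto intro!: vec.subspace_add vec.subspace_scale)
    show "(\<lambda>z. (dot f z, z - dot f z *s x)) ` S \<subseteq> UNIV \<times> (S \<inter> hyperplane f)"
      using S x by (auto simp: in_hyperplane_iff vec.subspace_diff vec.subspace_scale)
  qed (use x in \<open>auto simp: in_hyperplane_iff\<close>)
  then show ?thesis using bij_betw_same_card by (fastforce simp: card_cartesian_product)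
qed

lemma card_subspace_Int_hyperplane_cases:
  fixes S :: "('a::{field,finite} ^ 'm::finite) set"
  assumes S: "vec.subspace S"
  shows "CARD('a) * card (S \<inter> hyperplane f) = (if f \<in> perp S then CARD('a) * card S else card S)"
proof (cases "f \<in> perp S")
  case True
  then have "S \<inter> hyperplane f = S" by (auto simp: in_hyperplane_iff) (simp add: perp_def)
  then show ?thesis using True by simp
qed (use card_subspace_Int_hyperplane[OF S] in simp)

lemma hyperplane_swap_sum:
  fixes A B :: "('a::{field,finite} ^ 'm::finite) set"
  shows "(\<Sum>f\<in>A. card (B \<inter> hyperplane f)) = (\<Sum>x\<in>B. card (A \<inter> hyperplane x))"
proof -
  have "(\<Sum>f\<in>A. card (B \<inter> hyperplane f)) = (\<Sum>f\<in>A. \<Sum>x\<in>B. if dot f x = 0 then 1 else 0)"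
    by (intro sum.cong refl) (simp add: sum.If_cases hyperplane_eq)
  also have "\<dots> = (\<Sum>x\<in>B. \<Sum>f\<in>A. if dot f x = 0 then 1 else 0)" by (rule sum.swap)
  also have "\<dots> = (\<Sum>x\<in>B. card (A \<inter> hyperplane x))"
    by (intro sum.cong refl) (simp add: sum.If_cases hyperplane_eq dot_commute)
  finally show ?thesis .
qed

text \<open>
  A vector is orthogonal to all of \<open>P\<close> or to \<open>1/q\<close> of it. This count plays the part of the Fourier
  transform of the indicator function of \<open>N\<close>.
\<close>

lemma first_moment:
  fixes P N :: "('a::{field,finite} ^ 'm::finite) set"
  assumes P: "vec.subspace P"
  shows "CARD('a) * (\<Sum>f\<in>P. card (N \<inter> hyperplane f)) =
    card P * (card N + (CARD('a) - 1) * card (N \<inter> perp P))"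
proof -
  let ?q = "CARD('a)"
  have "?q * (\<Sum>f\<in>P. card (N \<inter> hyperplane f)) = (\<Sum>x\<in>N. ?q * card (P \<inter> hyperplane x))"
    by (simp add: hyperplane_swap_sum[of N P] sum_distrib_left)
  also have "\<dots> = (\<Sum>x\<in>N. card P + (if x \<in> perp P then (?q - 1) * card P else 0))"
    using field_card_ge_2[where 'a='a]
    by (intro sum.cong refl) (auto simp: card_subspace_Int_hyperplane_cases[OF P] algebra_simps)
  also have "\<dots> = card P * card N + (?q - 1) * card P * card (N \<inter> perp P)"
    by (simp add: sum.distrib sum.If_cases)
  finally show ?thesis by (simp add: algebra_simps)
qed

lemma card_perp:
  fixes S :: "('a::{field,finite} ^ 'm::finite) set"
  assumes S: "vec.subspace S"
  shows "card S * card (perp S) = CARD('a) ^ CARD('m)"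
proof -
  let ?q = "CARD('a)" and ?V = "CARD('a) ^ CARD('m)"
  have "?q * (\<Sum>f\<in>S. card (UNIV \<inter> hyperplane f)) = card S * (?V + (?q - 1) * card (perp S))"
    using first_moment[OF S, of UNIV] by (simp add: card_vectors)
  moreover have "?q * (\<Sum>f\<in>S. card (UNIV \<inter> hyperplane f)) = ?V * (card S + (?q - 1))"
  proof -
    have "S \<inter> {0} = {0}" using S vec.subspace_0 by auto
    then show ?thesis
      using first_moment[OF vec.subspace_UNIV, of S] hyperplane_swap_sum[of UNIV S]
      by (simp add: card_vectors perp_UNIV)
  qed
  ultimately have "(?q - 1) * (card S * card (perp S)) = (?q - 1) * ?V"
    by (simp add: algebra_simps)
  then show ?thesis using field_card_ge_2[where 'a='a] by simp
qed

lemma perp_perp: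
  fixes S :: "('a::{field,finite} ^ 'm::finite) set"
  assumes S: "vec.subspace S"
  shows "perp (perp S) = S"
proof -
  have "card S * card (perp S) = card (perp (perp S)) * card (perp S)"
    using card_perp[OF S] card_perp[OF subspace_perp[of S]] by (simp add: mult.commute)
  moreover have "card (perp S) > 0"
    using vec.subspace_0[OF subspace_perp[of S]] by (auto simp: card_gt_0_iff)
  ultimately have "card S = card (perp (perp S))" by (auto simp: card_gt_0_iff)
  moreover have "S \<subseteq> perp (perp S)" using perp_subset_iff[of S "perp S"] by simp
  ultimately show ?thesis using card_subset_eq[of "perp (perp S)" S] by simp
qed

lemma perp_perp_span:
  fixes S :: "('a::{field,finite} ^ 'm::finite) set"
  shows "perp (perp S) = vec.span S"
  using perp_perp[OF vec.subspace_span, of S] by (simp add: perp_span)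

lemma card_hyperplane:
  fixes f :: "'a::{field,finite} ^ 'm::finite"
  assumes "f \<noteq> 0"
  shows "CARD('a) * card (hyperplane f) = CARD('a) ^ CARD('m)"
proof -
  have "f \<notin> perp UNIV" using assms by (simp add: perp_UNIV)
  then show ?thesis using card_subspace_Int_hyperplane[OF vec.subspace_UNIV] by (simp add: card_vectors)
qed

lemma in_span_singleton: "x \<in> vec.span {a} \<longleftrightarrow> (\<exists>c. x = c *s a)"
  by (auto simp: vec.span_singleton)

lemma in_span_pair: "x \<in> vec.span {a, b} \<longleftrightarrow> (\<exists>c d. x = c *s a + d *s b)"
proof
  assume "x \<in> vec.span {a, b}"
  then obtain k where "x - k *s a \<in> vec.span {b}" using vec.span_breakdown_eq by blast
  then obtain d where "x - k *s a = d *s b" by (auto simp: in_span_singleton)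
  then have "x = k *s a + d *s b" by (simp add: algebra_simps)
  then show "\<exists>c d. x = c *s a + d *s b" by blast
next
  have "a \<in> vec.span {a, b}" "b \<in> vec.span {a, b}" by (auto intro: vec.span_base)
  moreover assume "\<exists>c d. x = c *s a + d *s b"
  ultimately show "x \<in> vec.span {a, b}" by (auto simp del: vec.span_insert intro!: vec.span_add vec.span_scale)
qed

lemma card_span_singleton:
  fixes a :: "'a::{field,finite} ^ 'm::finite"
  assumes "a \<noteq> 0"
  shows "card (vec.span {a}) = CARD('a)"
  using card_span_independent[of "{a}"] assms by simp

lemma card_span_insert:
  fixes b :: "'a::{field,finite} ^ 'm::finite"
  assumes "b \<notin> vec.span S"
  shows "card (vec.span (insert b S)) = CARD('a) * card (vec.span S)"
proof -
  obtain B where B0: "B \<subseteq> S" "vec.independent B" "S \<subseteq> vec.span B"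
    using vec.maximal_independent_subset[of S] by blast
  have "vec.span B = vec.span S"
    using vec.span_mono[OF B0(1)] vec.span_minimal[OF B0(3) vec.subspace_span] by blast
  note B = B0(1,2) this
  have "vec.span (insert b B) = vec.span (insert b S)"
    using B(3) by (simp add: vec.span_insert)
  moreover have "vec.independent (insert b B)" "b \<notin> B"
    using B assms vec.span_superset[of B] by (auto simp: vec.independent_insert)
  ultimately show ?thesis
    using card_span_independent[of "insert b B"] card_span_independent[OF B(2)] B(3) by simp
qed

lemma card_span_pair:
  fixes a b :: "'a::{field,finite} ^ 'm::finite"
  assumes "a \<noteq> 0" "b \<notin> vec.span {a}"
  shows "card (vec.span {a, b}) = CARD('a) ^ 2"
  using card_span_insert[OF assms(2)] card_span_singleton[OF assms(1)]
  by (simp add: insert_commute power2_eq_square)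

lemma hyperplane_eq_iff:
  fixes f g :: "'a::{field,finite} ^ 'm::finite"
  shows "hyperplane f = hyperplane g \<longleftrightarrow> vec.span {f} = vec.span {g}"
proof
  assume "hyperplane f = hyperplane g"
  then have "perp (hyperplane f) = perp (hyperplane g)" by simp
  then show "vec.span {f} = vec.span {g}" by (simp only: perp_perp_span)
next
  assume "vec.span {f} = vec.span {g}"
  then have "perp (vec.span {f}) = perp (vec.span {g})" by simp
  then show "hyperplane f = hyperplane g" by (simp only: perp_span)
qed

lemma exists_normal:
  fixes H :: "('a::{field,finite} ^ 'm::finite) set"
  assumes H: "vec.subspace H" and c: "CARD('a) * card H = CARD('a) ^ CARD('m)"
  obtains f where "f \<noteq> 0" "H = hyperplane f"
proof -
  have "card (perp H) = CARD('a)"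
  proof -
    have "card H > 0" using vec.subspace_0[OF H] by (auto simp: card_gt_0_iff)
    moreover have "card H * card (perp H) = card H * CARD('a)"
      using card_perp[OF H] c by (simp add: mult.commute)
    ultimately show ?thesis by (auto simp: card_gt_0_iff)
  qed
  then have "\<not> perp H \<subseteq> {0}"
    using card_mono[of "{0}" "perp H"] field_card_ge_2[where 'a='a] by auto
  then obtain f where f: "f \<in> perp H" "f \<noteq> 0" by blast
  have "H \<subseteq> hyperplane f" using f perp_subset_iff[of "{f}" H] by simp
  moreover have "card H = card (hyperplane f)"
  proof -
    have "CARD('a) * card H = CARD('a) * card (hyperplane f)"
      using c card_hyperplane[OF f(2)] by simp
    then show ?thesis by simp
  qed
  ultimately have "H = hyperplane f" by (simp add: card_subset_eq)
  then show ?thesis using that f by blast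
qed

text \<open>Turns counts of points, as in (P1) and (P2), into the counts of vectors used in the proof.\<close>

lemma card_union_of_lines:
  fixes S :: "('a::{field,finite} ^ 'm::finite) set"
  assumes "0 \<notin> S" and scale: "\<And>x c. x \<in> S \<Longrightarrow> c \<noteq> 0 \<Longrightarrow> c *s x \<in> S"
  shows "card S = (CARD('a) - 1) * card ((\<lambda>x. vec.span {x}) ` S)"
proof -
  let ?f = "\<lambda>x::'a ^ 'm. vec.span {x}"
  have fib: "card {y \<in> S. ?f y = l} = CARD('a) - 1" if l: "l \<in> ?f ` S" for l
  proof -
    obtain x where x: "x \<in> S" "l = ?f x" using l by blast
    have x0: "x \<noteq> 0" using x assms(1) by blast
    have "{y \<in> S. ?f y = l} = (\<lambda>c. c *s x) ` (UNIV - {0})"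
    proof (intro equalityI subsetI)
      fix y assume y: "y \<in> {y \<in> S. ?f y = l}"
      then have "y \<in> ?f x" using vec.span_superset[of "{y}"] x by auto
      then obtain c where "y = c *s x" by (auto simp: in_span_singleton)
      moreover have "y \<noteq> 0" using y assms(1) by blast
      ultimately show "y \<in> (\<lambda>c. c *s x) ` (UNIV - {0})" by auto
    next
      fix y assume "y \<in> (\<lambda>c. c *s x) ` (UNIV - {0})"
      then obtain c where c: "c \<noteq> 0" "y = c *s x" by auto
      have "z \<in> ?f y \<longleftrightarrow> z \<in> ?f x" for z
      proof -
        have "d *s x = (d / c) *s y" "d *s y = (d * c) *s x" for d using c by simp_all
        then show ?thesis unfolding in_span_singleton by metis
      qed
      then show "y \<in> {y \<in> S. ?f y = l}" using c x scale by auto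
    qed
    moreover have "inj_on (\<lambda>c. c *s x) (UNIV - {0})"
      using x0 by (auto simp: inj_on_def vec.scale_right_imp_eq)
    ultimately show ?thesis by (simp add: card_image card_nonzero_scalars)
  qed
  have "card S = (\<Sum>l\<in>?f ` S. card {y \<in> S. ?f y = l})"
    by (rule sum.group[where g = ?f and h = "\<lambda>_. 1::nat" and S = S and T = "?f ` S", simplified, symmetric])
  also have "\<dots> = (\<Sum>l\<in>?f ` S. CARD('a) - 1)" by (rule sum.cong[OF refl fib])
  finally show ?thesis by simp
qed

section \<open>Cones with two intersection numbers\<close>

text \<open>
  \<open>N\<close> is the set of all vectors on the points of a point set of \<open>PG(2n+1,q)\<close>, together with \<open>0\<close>. In
  terms of vectors the two possible sizes of a hyperplane section of a quadric become \<open>Q^2\<close> and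
  \<open>Q^2 + e (q - 1) Q\<close>, where \<open>Q = q^n\<close> and \<open>e\<close> is the sign; they are attained by the non-tangent
  and by the tangent hyperplanes.
\<close>

abbreviation icard :: "'b set \<Rightarrow> int" where
  "icard S \<equiv> int (card S)"

locale two_character_cone =
  fixes N :: "('a::{field,finite} ^ 'm::finite) set" and n :: nat and q Q e :: int
  assumes dim: "CARD('m) = 2 * n + 2" and n_pos: "n \<ge> 1"
    and q_def: "q = int (CARD('a))" and Q_def: "Q = q ^ n"
    and sign: "e = 1 \<or> e = -1"
    and zero: "0 \<in> N" and scale: "\<And>x c. x \<in> N \<Longrightarrow> c *s x \<in> N"
    and section_size: "\<And>v. v \<noteq> 0 \<Longrightarrow>
      icard (N \<inter> hyperplane v) = Q\<^sup>2 \<or> icard (N \<inter> hyperplane v) = Q\<^sup>2 + e * (q - 1) * Q"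
begin

lemma q_ge_2: "q \<ge> 2"
  using field_card_ge_2[where 'a='a] by (simp add: q_def)

lemma Q_ge_q: "Q \<ge> q"
  using power_increasing[of 1 n q] n_pos q_ge_2 by (simp add: Q_def)

lemma e_square: "e * e = 1"
  using sign by auto

lemma size_UNIV: "icard (UNIV :: ('a ^ 'm) set) = q\<^sup>2 * Q\<^sup>2"
  by (simp add: card_vectors dim q_def Q_def power_add power_mult power2_eq_square flip: power_mult_distrib)

lemma size_hyperplane:
  fixes v :: "'a ^ 'm"
  shows "v \<noteq> 0 \<Longrightarrow> icard (hyperplane v) = q * Q\<^sup>2"
proof -
  assume "v \<noteq> 0"
  then have "q * icard (hyperplane v) = q * (q * Q\<^sup>2)"
    using card_hyperplane[of v] size_UNIV
    by (simp add: q_def card_vectors power2_eq_square flip: of_nat_mult)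
  then show ?thesis using q_ge_2 by simp
qed

lemma size_perp:
  fixes S :: "('a ^ 'm) set"
  assumes "vec.subspace S"
  shows "icard S * icard (perp S) = q\<^sup>2 * Q\<^sup>2"
  using card_perp[OF assms] size_UNIV by (simp add: card_vectors flip: of_nat_mult)

lemma size_subspace_hyperplane:
  fixes P :: "('a ^ 'm) set"
  assumes "vec.subspace P"
  shows "q * icard (P \<inter> hyperplane y) = (if y \<in> perp P then q * icard P else icard P)"
proof -
  have "int (CARD('a) * card (P \<inter> hyperplane y)) = int (if y \<in> perp P then CARD('a) * card P else card P)"
    using card_subspace_Int_hyperplane_cases[OF assms, of y] by simp
  then show ?thesis by (simp add: q_def split: if_splits)
qed

lemma first_moment_size:
  assumes P: "vec.subspace P"
  shows "q * (\<Sum>f\<in>P. icard (N \<inter> hyperplane f)) = icard P * (icard N + (q - 1) * icard (N \<inter> perp P))"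
proof -
  have "int (CARD('a) * (\<Sum>f\<in>P. card (N \<inter> hyperplane f))) =
      int (card P * (card N + (CARD('a) - 1) * card (N \<inter> perp P)))"
    using first_moment[OF P, of N] by simp
  then show ?thesis using q_ge_2 by (simp add: q_def of_nat_diff)
qed

lemma second_moment_size:
  assumes P: "vec.subspace P"
  shows "q * (\<Sum>f\<in>P. (icard (N \<inter> hyperplane f))\<^sup>2) =
    (\<Sum>y\<in>N. icard (P \<inter> hyperplane y) * (icard N + (q - 1) * icard (N \<inter> perp (P \<inter> hyperplane y))))"
proof -
  let ?s = "\<lambda>f. icard (N \<inter> hyperplane f)"
  have "(\<Sum>f\<in>P. (?s f)\<^sup>2) = (\<Sum>f\<in>P. \<Sum>y\<in>N. if dot f y = 0 then ?s f else 0)"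
    by (intro sum.cong refl) (simp add: sum.If_cases hyperplane_eq power2_eq_square)
  also have "\<dots> = (\<Sum>y\<in>N. \<Sum>f\<in>P. if dot f y = 0 then ?s f else 0)" by (rule sum.swap)
  also have "\<dots> = (\<Sum>y\<in>N. \<Sum>f\<in>P \<inter> hyperplane y. ?s f)"
  proof (rule sum.cong[OF refl])
    fix y :: "'a ^ 'm"
    have "P \<inter> {f. dot f y = 0} = P \<inter> hyperplane y" by (auto simp: hyperplane_eq dot_commute[of y])
    then show "(\<Sum>f\<in>P. if dot f y = 0 then ?s f else 0) = (\<Sum>f\<in>P \<inter> hyperplane y. ?s f)"
      by (simp add: sum.If_cases)
  qed
  finally have "q * (\<Sum>f\<in>P. (?s f)\<^sup>2) = (\<Sum>y\<in>N. q * (\<Sum>f\<in>P \<inter> hyperplane y. ?s f))"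
    by (simp add: sum_distrib_left)
  also have "\<dots> = (\<Sum>y\<in>N. icard (P \<inter> hyperplane y) *
      (icard N + (q - 1) * icard (N \<inter> perp (P \<inter> hyperplane y))))"
    by (rule sum.cong[OF refl], rule first_moment_size) (simp add: vec.subspace_inter P subspace_perp)
  finally show ?thesis .
qed

text \<open>The polynomial whose roots are the two intersection numbers vanishes at each hyperplane in \<open>P\<close>; the
  zero vector, orthogonal to all of \<open>N\<close>, contributes the right hand side.\<close>

lemma two_character_identity:
  assumes "0 \<in> P"
  shows "(\<Sum>f\<in>P. (icard (N \<inter> hyperplane f))\<^sup>2)
      - (2 * Q\<^sup>2 + e * (q - 1) * Q) * (\<Sum>f\<in>P. icard (N \<inter> hyperplane f))
      + Q\<^sup>2 * (Q\<^sup>2 + e * (q - 1) * Q) * icard P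
    = (icard N - Q\<^sup>2) * (icard N - (Q\<^sup>2 + e * (q - 1) * Q))"
proof -
  let ?A = "Q\<^sup>2" and ?B = "Q\<^sup>2 + e * (q - 1) * Q" and ?s = "\<lambda>f. icard (N \<inter> hyperplane f)"
  have "(\<Sum>f\<in>P. (?s f)\<^sup>2) - (?A + ?B) * (\<Sum>f\<in>P. ?s f) + ?A * ?B * icard P
      = (\<Sum>f\<in>P. (?s f)\<^sup>2 - (?A + ?B) * ?s f + ?A * ?B)"
    by (simp add: sum.distrib sum_subtractf sum_distrib_left)
  also have "\<dots> = (\<Sum>f\<in>P. (?s f - ?A) * (?s f - ?B))"
    by (intro sum.cong refl) (simp add: algebra_simps power2_eq_square)
  also have "\<dots> = (\<Sum>f\<in>{0}. (?s f - ?A) * (?s f - ?B))"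
  proof (rule sum.mono_neutral_right)
    show "\<forall>f\<in>P - {0}. (?s f - ?A) * (?s f - ?B) = 0"
    proof
      fix f assume "f \<in> P - {0}"
      then have "f \<noteq> 0" by simp
      then have "?s f - ?A = 0 \<or> ?s f - ?B = 0" using section_size[of f] by auto
      then show "(?s f - ?A) * (?s f - ?B) = 0" by (simp only: mult_eq_0_iff)
    qed
  qed (use assms in auto)
  also have "\<dots> = (icard N - ?A) * (icard N - ?B)" by (simp add: hyperplane_eq)
  finally show ?thesis by (simp add: algebra_simps)
qed

lemma Int_span_singleton: "y \<in> N \<Longrightarrow> N \<inter> vec.span {y} = vec.span {y}"
  using scale by (auto simp: in_span_singleton)

lemma size_span_singleton:
  fixes y :: "'a ^ 'm"
  shows "y \<noteq> 0 \<Longrightarrow> icard (vec.span {y}) = q"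
  by (simp add: card_span_singleton q_def)

text \<open>The first factor is zero for the quadrics of sign \<open>e\<close>.\<close>

lemma size_quadratic:
  shows "(icard N - (q * Q\<^sup>2 + e * (q - 1) * Q)) *
    ((Q\<^sup>2 - 1) * icard N - Q\<^sup>2 * (q * Q\<^sup>2 + e * (q - 1)\<^sup>2 * Q - 1 - q * (q - 1))) = 0"
proof -
  let ?M = "icard N"
  have "q * (\<Sum>f\<in>UNIV. icard (N \<inter> hyperplane f)) = q * (q * Q\<^sup>2 * (?M + (q - 1)))"
    using first_moment_size[OF vec.subspace_UNIV] zero
    by (simp add: perp_UNIV size_UNIV power2_eq_square mult_ac del: CARD_vec)
  then have m1: "(\<Sum>f\<in>UNIV. icard (N \<inter> hyperplane f)) = q * Q\<^sup>2 * (?M + (q - 1))"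
    using q_ge_2 by simp
  have "q * (\<Sum>f\<in>UNIV. (icard (N \<inter> hyperplane f))\<^sup>2)
      = (\<Sum>y\<in>N. icard (hyperplane y) * (?M + (q - 1) * icard (N \<inter> vec.span {y})))"
    using second_moment_size[OF vec.subspace_UNIV] by (simp add: perp_perp_span)
  also have "\<dots> = q\<^sup>2 * Q\<^sup>2 * (?M + (q - 1))
      + (\<Sum>y\<in>N - {0}. icard (hyperplane y) * (?M + (q - 1) * icard (N \<inter> vec.span {y})))"
    using zero by (subst sum.remove[OF _ zero]) (auto simp: size_UNIV hyperplane_eq simp del: CARD_vec)
  also have "(\<Sum>y\<in>N - {0}. icard (hyperplane y) * (?M + (q - 1) * icard (N \<inter> vec.span {y})))
      = (\<Sum>y\<in>N - {0}. q * Q\<^sup>2 * (?M + (q - 1) * q))"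
    by (intro sum.cong refl) (simp add: size_hyperplane Int_span_singleton size_span_singleton)
  also have "\<dots> = (?M - 1) * (q * Q\<^sup>2 * (?M + (q - 1) * q))"
  proof -
    have "icard (N - {0}) = ?M - 1"
      using zero card_gt_0_iff[of N] by (auto simp: card_Diff_subset of_nat_diff Suc_le_eq)
    then show ?thesis by simp
  qed
  finally have "q * (\<Sum>f\<in>UNIV. (icard (N \<inter> hyperplane f))\<^sup>2)
      = q * (q * Q\<^sup>2 * (?M + (q - 1)) + (?M - 1) * (Q\<^sup>2 * (?M + (q - 1) * q)))"
    by (simp add: algebra_simps power2_eq_square)
  then have m2: "(\<Sum>f\<in>UNIV. (icard (N \<inter> hyperplane f))\<^sup>2)
      = q * Q\<^sup>2 * (?M + (q - 1)) + (?M - 1) * (Q\<^sup>2 * (?M + (q - 1) * q))"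
    using q_ge_2 by simp
  have id: "q * Q\<^sup>2 * (M + (q - 1)) + (M - 1) * (Q\<^sup>2 * (M + (q - 1) * q))
      - (2 * Q\<^sup>2 + e * (q - 1) * Q) * (q * Q\<^sup>2 * (M + (q - 1)))
      + Q\<^sup>2 * (Q\<^sup>2 + e * (q - 1) * Q) * (q\<^sup>2 * Q\<^sup>2)
      - (M - Q\<^sup>2) * (M - (Q\<^sup>2 + e * (q - 1) * Q))
    = (M - (q * Q\<^sup>2 + e * (q - 1) * Q)) *
      ((Q\<^sup>2 - 1) * M - Q\<^sup>2 * (q * Q\<^sup>2 + e * (q - 1)\<^sup>2 * Q - 1 - q * (q - 1)))" for M
    using e_square by algebra
  show ?thesis
    using two_character_identity[of UNIV] id[of ?M] unfolding m1 m2 size_UNIV by simp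
qed

lemma size_minus_1_dvd: "q - 1 dvd icard N - 1"
proof -
  have "card (N - {0}) = (CARD('a) - 1) * card ((\<lambda>x. vec.span {x}) ` (N - {0}))"
    by (rule card_union_of_lines) (auto simp: scale)
  then have "icard (N - {0}) = (q - 1) * icard ((\<lambda>x. vec.span {x}) ` (N - {0}))"
    using q_ge_2 by (simp add: q_def of_nat_diff)
  moreover have "icard (N - {0}) = icard N - 1"
    using zero card_gt_0_iff[of N] by (auto simp: card_Diff_subset of_nat_diff Suc_le_eq)
  ultimately show ?thesis by simp
qed

text \<open>
  The second root of the quadratic for \<open>|N|\<close> is not an integer, or not \<open>1\<close> modulo \<open>q - 1\<close>,
  except for \<open>n = 1\<close> and \<open>e = -1\<close>, where it is the size of a line of \<open>PG(3,q)\<close>.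
\<close>

lemma size_cases:
  "icard N = q * Q\<^sup>2 + e * (q - 1) * Q \<or> n = 1 \<and> e = -1 \<and> icard N = q\<^sup>2"
proof (rule ccontr)
  assume neg: "\<not> ?thesis"
  define R where "R = q * Q\<^sup>2 + e * (q - 1)\<^sup>2 * Q - 1 - q * (q - 1)"
  have eq: "(Q\<^sup>2 - 1) * icard N = Q\<^sup>2 * R"
    using size_quadratic neg by (simp add: R_def)
  \<comment> \<open>\<open>Q\<^sup>2\<close> is prime to \<open>Q\<^sup>2 - 1\<close>, so \<open>Q\<^sup>2 - 1\<close> divides \<open>R\<close>; reducing \<open>R\<close> modulo \<open>Q\<^sup>2 - 1\<close> leaves
    \<open>Q + e\<close> as a divisor of \<open>(q - 1)\<^sup>2\<close>, which is too small if \<open>n \<ge> 2\<close>.\<close>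
  define k where "k = icard N - R - q"
  have "(Q\<^sup>2 - 1) * (icard N - R) = R" using eq by (simp add: algebra_simps)
  moreover have "R = q * (Q\<^sup>2 - 1) + (q - 1)\<^sup>2 * (e * Q - 1)"
    by (simp add: R_def algebra_simps power2_eq_square)
  ultimately have "(Q\<^sup>2 - 1) * k = (q - 1)\<^sup>2 * (e * Q - 1)"
    unfolding k_def right_diff_distrib'[of "Q\<^sup>2 - 1" "icard N - R" q] by simp
  moreover have "Q\<^sup>2 - 1 = (e * Q - 1) * (e * Q + 1)" using e_square by algebra
  ultimately have "(e * Q - 1) * ((e * Q + 1) * k) = (e * Q - 1) * (q - 1)\<^sup>2"
    by (simp add: mult_ac)
  moreover have "e * Q - 1 \<noteq> 0" using sign Q_ge_q q_ge_2 by auto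
  ultimately have k: "(e * Q + 1) * k = (q - 1)\<^sup>2" by simp
  have "(Q + e) * (e * k) = (e * Q + 1) * k" using e_square by algebra
  then have dvd: "Q + e dvd (q - 1)\<^sup>2" using k by (metis dvd_triv_left)
  have "(q - 1)\<^sup>2 > 0" using q_ge_2 by simp
  then have le: "Q + e \<le> (q - 1)\<^sup>2" using dvd zdvd_imp_le by blast
  show False
  proof (cases "n \<ge> 2")
    case True
    then have "Q \<ge> q\<^sup>2" using q_ge_2 power_increasing[of 2 n q] by (simp add: Q_def)
    then have "q\<^sup>2 - 1 \<le> (q - 1)\<^sup>2" using le sign by auto
    then show False using q_ge_2 by (simp add: power2_eq_square algebra_simps)
  next
    case False
    then have n1: "n = 1" using n_pos by simp
    then have Qq: "Q = q" by (simp add: Q_def)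
    show False
    proof (cases "e = 1")
      case True
      have "(q - 1)\<^sup>2 = (q + 1) * (q - 3) + 4" by (simp add: power2_eq_square algebra_simps)
      then have d4: "q + 1 dvd 4" using dvd True Qq by (metis dvd_add_right_iff dvd_triv_left)
      then have "q + 1 \<le> 4" using zdvd_imp_le by simp
      moreover have "q \<noteq> 2" using d4 by auto
      ultimately have q3: "q = 3" using q_ge_2 by linarith
      then have "icard N = 36" using eq True Qq by (simp add: R_def)
      then show False using size_minus_1_dvd q3 by simp
    next
      case False
      then have e: "e = -1" using sign by simp
      have "R = q\<^sup>2 - 1" by (simp add: R_def e Qq power2_eq_square algebra_simps)
      then have "(q\<^sup>2 - 1) * icard N = (q\<^sup>2 - 1) * q\<^sup>2" using eq Qq by (simp add: mult_ac)
      moreover have "q\<^sup>2 - 1 \<noteq> 0" using q_ge_2 by (simp add: power2_eq_1_iff)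
      ultimately have "icard N = q\<^sup>2" by simp
      then show False using neg n1 e by simp
    qed
  qed
qed

text \<open>If \<open>N\<close> is a quadric, these are the normal vectors of its tangent hyperplanes.\<close>

definition dual :: "('a ^ 'm) set" where
  "dual = {v. v = 0 \<or> icard (N \<inter> hyperplane v) = Q\<^sup>2 + e * (q - 1) * Q}"

text \<open>
  As there are only two section sizes, the first moment over \<open>P\<close> depends only on how many
  of the hyperplanes in \<open>P\<close> have the second one.
\<close>

lemma dual_count:
  assumes P: "vec.subspace P"
  shows "q * (e * (q - 1) * Q) * icard (dual \<inter> P) =
    icard P * (icard N + (q - 1) * icard (N \<inter> perp P))
      - q * (icard N - (Q\<^sup>2 + e * (q - 1) * Q)) - q * Q\<^sup>2 * icard P"
proof -
  let ?s = "\<lambda>v. icard (N \<inter> hyperplane v)" and ?D = "e * (q - 1) * Q"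
  have P0: "0 \<in> P" using P by (rule vec.subspace_0)
  have "(\<Sum>v\<in>P. ?s v) = (\<Sum>v\<in>P. (if v \<in> dual then Q\<^sup>2 + ?D else Q\<^sup>2) +
      (if v = 0 then icard N - (Q\<^sup>2 + ?D) else 0))"
  proof (rule sum.cong[OF refl])
    fix v
    show "?s v = (if v \<in> dual then Q\<^sup>2 + ?D else Q\<^sup>2) + (if v = 0 then icard N - (Q\<^sup>2 + ?D) else 0)"
      using section_size[of v] by (auto simp: dual_def hyperplane_eq)
  qed
  also have "\<dots> = (\<Sum>v\<in>P. Q\<^sup>2 + (if v \<in> dual then ?D else 0)) + (icard N - (Q\<^sup>2 + ?D))"
    unfolding sum.distrib[of _ "\<lambda>v. if v = 0 then _ else _"] using P0
    by (simp add: if_distrib cong: if_cong)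
  also have "\<dots> = Q\<^sup>2 * icard P + ?D * icard (dual \<inter> P) + (icard N - (Q\<^sup>2 + ?D))"
    by (simp add: sum.distrib sum.If_cases Int_commute)
  finally have "q * (Q\<^sup>2 * icard P + ?D * icard (dual \<inter> P) + (icard N - (Q\<^sup>2 + ?D))) =
      icard P * (icard N + (q - 1) * icard (N \<inter> perp P))"
    using first_moment_size[OF P] by simp
  then show ?thesis by (simp add: algebra_simps)
qed

end

section \<open>The elliptic case of projective 3-space\<close>

locale elliptic_solid_cone = two_character_cone N n q Q e
  for N :: "('a::{field,finite} ^ 'm::finite) set" and n q Q e +
  assumes n1: "n = 1" and e_minus: "e = -1"
begin

lemma Q_eq: "Q = q"
  using n1 by (simp add: Q_def)

lemma section_size_solid: "v \<noteq> 0 \<Longrightarrow> icard (N \<inter> hyperplane v) = q\<^sup>2 \<or> icard (N \<inter> hyperplane v) = q"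
  using section_size[of v] by (auto simp: Q_eq e_minus power2_eq_square algebra_simps)

text \<open>
  If \<open>N\<close> has the size of a line, then each plane on two of its points has more than one point of
  \<open>N\<close>, hence contains all of \<open>N\<close>; so \<open>N\<close> lies on the line joining the two points.
\<close>

lemma size_of_line_imp_subspace:
  assumes M: "icard N = q\<^sup>2"
  shows "vec.subspace N"
proof -
  have "q < q\<^sup>2" using q_ge_2 by (simp add: power2_eq_square)
  then have "\<not> N \<subseteq> {0}" using M card_mono[of "{0}" N] q_ge_2 by fastforce
  then obtain x where x: "x \<in> N" "x \<noteq> 0" by blast
  have "\<not> N \<subseteq> vec.span {x}"
    using card_mono[of "vec.span {x}" N] size_span_singleton[OF x(2)] \<open>q < q\<^sup>2\<close> M by force
  then obtain y where y: "y \<in> N" "y \<notin> vec.span {x}" by blast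
  have "N \<subseteq> perp (perp {x, y})"
  proof -
    have "N \<subseteq> hyperplane f" if f: "f \<in> perp {x, y}" for f
    proof (cases "f = 0")
      case False
      have fxy: "dot f x = 0" "dot f y = 0" using f by (simp_all add: perp_def)
      have "vec.span {x} \<subseteq> N \<inter> hyperplane f"
        using fxy x(1) by (auto simp: in_span_singleton scale in_hyperplane_iff)
      moreover have "y \<in> N \<inter> hyperplane f"
        using fxy y(1) by (simp add: in_hyperplane_iff)
      ultimately have "vec.span {x} \<subset> N \<inter> hyperplane f" using y(2) by blast
      then have "q < icard (N \<inter> hyperplane f)"
        using psubset_card_mono[of "N \<inter> hyperplane f" "vec.span {x}"] size_span_singleton[OF x(2)]
        by simp
      then have "card (N \<inter> hyperplane f) = card N" using section_size_solid[OF False] M by simp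
      then have "N \<inter> hyperplane f = N" using card_subset_eq[of N "N \<inter> hyperplane f"] by simp
      then show ?thesis by blast
    qed (simp add: hyperplane_eq)
    then have "dot z f = 0" if "z \<in> N" "f \<in> perp {x, y}" for z f
      using that dot_commute[of z f] in_hyperplane_iff[of z f] by auto
    then show ?thesis unfolding perp_def[of "perp {x, y}"] by blast
  qed
  then have "N \<subseteq> vec.span {x, y}" by (simp only: perp_perp_span)
  moreover have "icard (vec.span {x, y}) = q\<^sup>2"
    using card_span_pair[OF x(2) y(2)] by (simp add: q_def)
  ultimately have "N = vec.span {x, y}" using M by (simp add: card_subset_eq)
  then show ?thesis by (simp only: vec.subspace_span)
qed

text \<open>
  If \<open>N\<close> has the size of an ovoid, then \<open>dual\<close> turns out to be an ovoid of the original space: the next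
  counts give its size and bound its intersections with planes and lines.
\<close>

context
  assumes M: "icard N = q * Q\<^sup>2 + e * (q - 1) * Q"
begin

lemma dual_count_solid:
  assumes P: "vec.subspace P"
  shows "q\<^sup>2 * icard (dual \<inter> P) = q ^ 3 + icard P * (q - icard (N \<inter> perp P))"
proof -
  let ?y = "icard (dual \<inter> P)" and ?x = "icard (N \<inter> perp P)" and ?p = "icard P"
  have "(q - 1) * (q\<^sup>2 * ?y) = (q - 1) * (q ^ 3 + ?p * (q - ?x))"
    using dual_count[OF P] M
    by (simp add: e_minus Q_eq algebra_simps power2_eq_square power3_eq_cube)
  then show ?thesis using q_ge_2 by simp
qed

lemma dual_size: "icard dual = q ^ 3 - q\<^sup>2 + q"
proof -
  have "q\<^sup>2 * icard dual = q ^ 3 + q\<^sup>2 * q\<^sup>2 * (q - 1)"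
    using dual_count_solid[OF vec.subspace_UNIV] zero
    by (simp add: perp_UNIV size_UNIV Q_eq del: CARD_vec)
  then have "q\<^sup>2 * icard dual = q\<^sup>2 * (q ^ 3 - q\<^sup>2 + q)"
    by (simp add: power2_eq_square power3_eq_cube algebra_simps)
  then show ?thesis using q_ge_2 by simp
qed

lemma dual_plane:
  assumes "f \<noteq> 0"
  shows "icard (dual \<inter> hyperplane f) = (if f \<in> N then q else q\<^sup>2)"
proof -
  have x: "icard (N \<inter> perp (hyperplane f)) = (if f \<in> N then q else 1)"
  proof (cases "f \<in> N")
    case True
    then show ?thesis using assms by (simp add: perp_perp_span Int_span_singleton size_span_singleton)
  next
    case False
    have "x \<in> N \<inter> vec.span {f} \<longleftrightarrow> x = 0" for x
    proof
      assume "x \<in> N \<inter> vec.span {f}"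
      then obtain c where c: "x = c *s f" "x \<in> N" by (auto simp: in_span_singleton)
      then have "f = inverse c *s x" if "c \<noteq> 0" using that by simp
      then have "c = 0" using scale[OF c(2), of "inverse c"] False by auto
      then show "x = 0" using c by simp
    qed (use zero vec.span_zero in auto)
    then have "N \<inter> vec.span {f} = {0}" by blast
    then show ?thesis using False by (simp add: perp_perp_span)
  qed
  have "q\<^sup>2 * icard (dual \<inter> hyperplane f) = q ^ 3 + q * q\<^sup>2 * (q - (if f \<in> N then q else 1))"
    using dual_count_solid[OF subspace_perp, of "{f}"] size_hyperplane[OF assms] Q_eq x by simp
  then have "q\<^sup>2 * icard (dual \<inter> hyperplane f) = q\<^sup>2 * (if f \<in> N then q else q\<^sup>2)"
    by (simp add: power2_eq_square power3_eq_cube algebra_simps split: if_splits)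
  then show ?thesis using q_ge_2 by simp
qed

lemma dual_line:
  assumes P: "vec.subspace P" and c: "icard P = q\<^sup>2"
  shows "icard (dual \<inter> P) \<le> 2 * q - 1"
proof -
  have "q\<^sup>2 * icard (dual \<inter> P) = q\<^sup>2 * (2 * q - icard (N \<inter> perp P))"
    using dual_count_solid[OF P] c by (simp add: power2_eq_square power3_eq_cube algebra_simps)
  then have "icard (dual \<inter> P) = 2 * q - icard (N \<inter> perp P)" using q_ge_2 by simp
  moreover have "icard (N \<inter> perp P) \<ge> 1"
    using zero vec.subspace_0[OF subspace_perp[of P]] card_gt_0_iff[of "N \<inter> perp P"] by fastforce
  ultimately show ?thesis by simp
qed

end

end

section \<open>Secants and tangents at a point\<close>

text \<open>
  \<open>line\<close> says that the lines meet the point set in 0, 1, 2 or \<open>q + 1\<close> points: for independent \<open>x\<close> and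
  \<open>y\<close>, a third point on the line spanned by them can be scaled to \<open>x + y\<close>. Two
  vectors \<open>x, y\<close> of \<open>N\<close> are collinear in the geometry of contained lines iff \<open>x + y \<in> N\<close>.
\<close>

locale tallini_cone = two_character_cone N n q Q e
  for N :: "('a::{field,finite} ^ 'm::finite) set" and n q Q e +
  assumes line: "\<And>x y c d. x \<in> N \<Longrightarrow> y \<in> N \<Longrightarrow> x + y \<in> N \<Longrightarrow> c *s x + d *s y \<in> N"
    and size_N: "icard N = q * Q\<^sup>2 + e * (q - 1) * Q"
begin

text \<open>For \<open>x\<close> off the point \<open>p\<close>, the number of points of \<open>N\<close> other than \<open>p\<close> on the line \<open>px\<close>.\<close>

definition hits :: "'a ^ 'm \<Rightarrow> 'a ^ 'm \<Rightarrow> int" where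
  "hits p x = icard {t. x + t *s p \<in> N}"

text \<open>The union of the lines on \<open>p\<close> that are not secants, later shown to be the tangent hyperplane.\<close>

definition tangent :: "'a ^ 'm \<Rightarrow> ('a ^ 'm) set" where
  "tangent p = {x. hits p x \<noteq> 1}"

text \<open>The union of the lines on \<open>p\<close> that are contained in \<open>N\<close>.\<close>

definition adj :: "'a ^ 'm \<Rightarrow> ('a ^ 'm) set" where
  "adj p = {x \<in> N. p + x \<in> N}"

lemma two_hits_imp_all:
  assumes p: "p \<in> N" and x: "x + t *s p \<in> N" "x + t' *s p \<in> N" "t \<noteq> t'"
  shows "x + s *s p \<in> N"
proof -
  have "(x + t *s p) + (t' - t) *s p \<in> N" using x(2) by (simp add: vec.scale_left_diff_distrib)
  then have "1 *s (x + t *s p) + ((s - t) / (t' - t)) *s ((t' - t) *s p) \<in> N"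
    using x(1) scale[OF p] by (intro line) auto
  moreover have "1 *s (x + t *s p) + ((s - t) / (t' - t)) *s ((t' - t) *s p) = x + s *s p"
  proof -
    have "((s - t) / (t' - t)) *s ((t' - t) *s p) = (s - t) *s p" using x(3) by simp
    then show ?thesis by (simp add: vec.scale_left_diff_distrib)
  qed
  ultimately show ?thesis by (simp only:)
qed

lemma hits_eq_q_iff: "hits p x = q \<longleftrightarrow> (\<forall>t. x + t *s p \<in> N)"
proof
  assume "hits p x = q"
  then have "card {t. x + t *s p \<in> N} = card (UNIV :: 'a set)" by (simp add: hits_def q_def)
  then have "{t. x + t *s p \<in> N} = UNIV" using card_subset_eq[of "UNIV :: 'a set"] by simp
  then show "\<forall>t. x + t *s p \<in> N" by auto
qed (simp add: hits_def q_def)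

lemma hits_eq_0_iff: "hits p x = 0 \<longleftrightarrow> (\<forall>t. x + t *s p \<notin> N)"
  by (simp add: hits_def)

lemma hits_eq_1_iff: "hits p x = 1 \<longleftrightarrow> (\<exists>!t. x + t *s p \<in> N)"
proof -
  have "hits p x = 1 \<longleftrightarrow> (\<exists>s. {t. x + t *s p \<in> N} = {s})"
    unfolding hits_def using card_1_singleton_iff[of "{t. x + t *s p \<in> N}"] by simp
  also have "\<dots> \<longleftrightarrow> (\<exists>!t. x + t *s p \<in> N)" by (auto simp: set_eq_iff) (metis+)?
  finally show ?thesis .
qed

lemma hits_cases:
  assumes "p \<in> N"
  shows "hits p x = 0 \<or> hits p x = 1 \<or> hits p x = q"
  unfolding hits_eq_q_iff hits_eq_0_iff hits_eq_1_iff
  using two_hits_imp_all[OF assms] by metis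

lemma hits_shift: "hits p (x + s *s p) = hits p x"
proof -
  have "{t. x + s *s p + t *s p \<in> N} = (\<lambda>t. t - s) ` {t. x + t *s p \<in> N}"
  proof (intro equalityI subsetI)
    fix t assume "t \<in> {t. x + s *s p + t *s p \<in> N}"
    then show "t \<in> (\<lambda>t. t - s) ` {t. x + t *s p \<in> N}"
      by (intro image_eqI[of _ _ "s + t"]) (auto simp: vec.scale_left_distrib add.assoc)
  qed (auto simp: vec.scale_left_diff_distrib)
  then show ?thesis by (simp add: hits_def card_image)
qed

lemma in_N_scale_iff: "c \<noteq> 0 \<Longrightarrow> c *s x \<in> N \<longleftrightarrow> x \<in> N"
  using scale[of x c] scale[of "c *s x" "inverse c"] by auto

lemma hits_scale:
  assumes "c \<noteq> 0"
  shows "hits p (c *s x) = hits p x"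
proof -
  have "{t. c *s x + t *s p \<in> N} = (\<lambda>t. c * t) ` {t. x + t *s p \<in> N}"
  proof (intro equalityI subsetI)
    fix t assume t: "t \<in> {t. c *s x + t *s p \<in> N}"
    have "c *s x + t *s p = c *s (x + (t / c) *s p)"
      using assms by (simp add: vec.scale_right_distrib)
    then have "x + (t / c) *s p \<in> N" using t in_N_scale_iff[OF assms] by simp
    then show "t \<in> (\<lambda>t. c * t) ` {t. x + t *s p \<in> N}"
      using assms by (intro image_eqI[of _ _ "t / c"]) auto
  next
    fix t assume "t \<in> (\<lambda>t. c * t) ` {t. x + t *s p \<in> N}"
    then obtain s where s: "t = c * s" "x + s *s p \<in> N" by auto
    then show "t \<in> {t. c *s x + t *s p \<in> N}"
      using scale[OF s(2), of c] by (simp add: vec.scale_right_distrib)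
  qed
  moreover have "card ((\<lambda>t. c * t) ` {t. x + t *s p \<in> N}) = card {t. x + t *s p \<in> N}"
    by (rule card_image) (use assms in \<open>simp add: inj_on_def\<close>)
  ultimately show ?thesis by (simp add: hits_def)
qed

lemma hits_multiple: "p \<in> N \<Longrightarrow> hits p (c *s p) = q"
  unfolding hits_eq_q_iff by (metis scale vec.scale_left_distrib)

lemma in_tangent_iff:
  assumes p: "p \<in> N" and x: "x \<in> N"
  shows "x \<in> tangent p \<longleftrightarrow> p + x \<in> N"
proof -
  have x0: "x + 0 *s p \<in> N" using x by simp
  then have "hits p x \<noteq> 0" unfolding hits_eq_0_iff by blast
  then have "x \<in> tangent p \<longleftrightarrow> hits p x = q"
    using hits_cases[OF p, of x] q_ge_2 by (auto simp: tangent_def)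
  also have "\<dots> \<longleftrightarrow> p + x \<in> N"
    unfolding hits_eq_q_iff using two_hits_imp_all[OF p x0, of 1]
    by (metis add.commute vec.scale_one zero_neq_one)
  finally show ?thesis .
qed

lemma tangent_sym: "p \<in> N \<Longrightarrow> r \<in> N \<Longrightarrow> r \<in> tangent p \<longleftrightarrow> p \<in> tangent r"
  by (simp add: in_tangent_iff add.commute)

lemma adj_eq: "p \<in> N \<Longrightarrow> adj p = N \<inter> tangent p"
  using in_tangent_iff by (auto simp: adj_def)

lemma adj_eq_hits: "p \<in> N \<Longrightarrow> adj p = {x. hits p x = q}"
proof (intro set_eqI iffI)
  fix x assume p: "p \<in> N" and "x \<in> {x. hits p x = q}"
  then have "x + t *s p \<in> N" for t by (simp add: hits_eq_q_iff)
  from this[of 0] this[of 1] show "x \<in> adj p" by (simp add: adj_def add.commute)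
next
  fix x assume p: "p \<in> N" and "x \<in> adj p"
  then show "x \<in> {x. hits p x = q}"
    using two_hits_imp_all[OF p, of x 0 1] by (simp add: adj_def hits_eq_q_iff add.commute)
qed

lemma adj_combination:
  assumes "p \<in> N" "x \<in> adj p"
  shows "c *s p + d *s x \<in> N"
  using assms line by (simp add: adj_def)

lemma tangent_shift: "x + s *s p \<in> tangent p \<longleftrightarrow> x \<in> tangent p"
  by (simp add: tangent_def hits_shift)

lemma tangent_scale: "p \<in> N \<Longrightarrow> x \<in> tangent p \<Longrightarrow> c *s x \<in> tangent p"
  using hits_multiple[of p 0] q_ge_2 by (cases "c = 0") (auto simp: tangent_def hits_scale)

text \<open>Each vector of \<open>N \<inter> P\<close> is hit once from each of the \<open>q\<close> vectors of its coset of the line of \<open>p\<close>.\<close>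

lemma sum_hits:
  assumes P: "vec.subspace P" and p: "p \<in> P"
  shows "(\<Sum>x\<in>P. hits p x) = q * icard (N \<inter> P)"
proof -
  have "(\<Sum>x\<in>P. hits p x) = (\<Sum>x\<in>P. \<Sum>t\<in>UNIV. if x + t *s p \<in> N then 1 else 0)"
    by (rule sum.cong[OF refl]) (simp add: hits_def sum.If_cases)
  also have "\<dots> = (\<Sum>t\<in>UNIV. \<Sum>x\<in>P. if x + t *s p \<in> N then 1 else 0)" by (rule sum.swap)
  also have "\<dots> = (\<Sum>t\<in>(UNIV :: 'a set). icard (N \<inter> P))"
  proof (rule sum.cong[OF refl])
    fix t
    have "(\<lambda>x. x + t *s p) ` (P \<inter> {x. x + t *s p \<in> N}) = N \<inter> P"
    proof (intro equalityI subsetI)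
      fix y assume "y \<in> N \<inter> P"
      then show "y \<in> (\<lambda>x. x + t *s p) ` (P \<inter> {x. x + t *s p \<in> N})"
        using P p by (intro image_eqI[of _ _ "y - t *s p"]) (auto intro: vec.subspace_diff vec.subspace_scale)
    qed (use P p in \<open>auto intro: vec.subspace_add vec.subspace_scale\<close>)
    moreover have "inj_on (\<lambda>x. x + t *s p) (P \<inter> {x. x + t *s p \<in> N})" by (simp add: inj_on_def)
    ultimately have "card (P \<inter> {x. x + t *s p \<in> N}) = card (N \<inter> P)" by (metis card_image)
    then show "(\<Sum>x\<in>P. if x + t *s p \<in> N then 1 else 0) = icard (N \<inter> P)"
      by (simp add: sum.If_cases)
  qed
  finally show ?thesis by (simp add: q_def)
qed

lemma sum_hits_off_line:
  assumes P: "vec.subspace P" and p: "p \<in> P" "p \<in> N" "p \<noteq> 0"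
  shows "(\<Sum>x\<in>P - vec.span {p}. hits p x) = q * icard (N \<inter> P) - q * q"
    and "icard (P - vec.span {p}) = icard P - q"
proof -
  have LP: "vec.span {p} \<subseteq> P" using P p(1) by (intro vec.span_minimal) auto
  have "(\<Sum>x\<in>vec.span {p}. hits p x) = (\<Sum>x\<in>vec.span {p}. q)"
    using hits_multiple[OF p(2)] by (intro sum.cong refl) (auto simp: in_span_singleton)
  also have "\<dots> = q * q" by (simp add: size_span_singleton[OF p(3)])
  finally show "(\<Sum>x\<in>P - vec.span {p}. hits p x) = q * icard (N \<inter> P) - q * q"
    using sum_hits[OF P p(1)] sum.subset_diff[OF LP, of "hits p"] by simp
  show "icard (P - vec.span {p}) = icard P - q"
    using LP card_mono[OF _ LP] size_span_singleton[OF p(3)] by (simp add: card_Diff_subset of_nat_diff)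
qed

lemma size_span_pair: "p \<noteq> 0 \<Longrightarrow> y \<notin> vec.span {p} \<Longrightarrow> icard (vec.span {p, y}) = q\<^sup>2"
  for p y :: "'a ^ 'm"
  by (simp add: card_span_pair q_def del: vec.span_insert)

lemma size_Int_span_pair:
  assumes p: "p \<in> N" "p \<noteq> 0" and y: "y \<notin> vec.span {p}"
  shows "icard (N \<inter> vec.span {p, y}) = q + (q - 1) * hits p y"
proof -
  let ?D = "vec.span {p, y}" and ?L = "vec.span {p}"
  have pD: "p \<in> ?D" by (rule vec.span_base) simp
  have "(\<Sum>x\<in>?D - ?L. hits p x) = (\<Sum>x\<in>?D - ?L. hits p y)"
  proof (rule sum.cong[OF refl])
    fix x assume x: "x \<in> ?D - ?L"
    then obtain c d where cd: "x = c *s p + d *s y" by (auto simp: in_span_pair simp del: vec.span_insert)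
    then have "d \<noteq> 0" using x by (auto simp: in_span_singleton)
    then show "hits p x = hits p y" using hits_shift[of p "d *s y" c] by (simp add: cd add.commute hits_scale)
  qed
  then have "q * icard (N \<inter> ?D) - q * q = (q\<^sup>2 - q) * hits p y"
    using sum_hits_off_line[OF vec.subspace_span pD p] size_span_pair[OF p(2) y]
    by (simp del: vec.span_insert)
  then have "q * icard (N \<inter> ?D) = q * (q + (q - 1) * hits p y)"
    by (simp add: algebra_simps power2_eq_square)
  then show ?thesis using q_ge_2 by simp
qed

text \<open>
  The second moment over the hyperplanes on the point \<open>p\<close> involves the sizes of \<open>N\<close> on the lines
  through \<open>p\<close>. It therefore determines the number of contained lines on \<open>p\<close>.
\<close>

lemma size_adj:
  assumes p: "p \<in> N" "p \<noteq> 0"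
  shows "icard (adj p) = Q\<^sup>2 + e * (q - 1) * Q"
proof -
  let ?M = "icard N" and ?a = "icard (adj p)" and ?H = "hyperplane p" and ?L = "vec.span {p}"
  let ?w = "\<lambda>y. icard (?H \<inter> hyperplane y) * (?M + (q - 1) * icard (N \<inter> perp (?H \<inter> hyperplane y)))"
  have LN: "?L \<subseteq> N" using p(1) scale by (auto simp: in_span_singleton)
  have M1: "q * (\<Sum>f\<in>?H. icard (N \<inter> hyperplane f)) = q * Q\<^sup>2 * (?M + (q - 1) * q)"
    using first_moment_size[OF subspace_perp, of "{p}"] p
    by (simp add: size_hyperplane perp_perp_span Int_span_singleton size_span_singleton)
  have in_L: "?w y = q * Q\<^sup>2 * (?M + (q - 1) * q)" if y: "y \<in> ?L" for y
  proof -
    obtain c where "y = c *s p" using y by (auto simp: in_span_singleton)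
    then have "?H \<inter> hyperplane y = ?H" by (auto simp: hyperplane_eq)
    then show ?thesis using p
      by (simp add: size_hyperplane perp_perp_span Int_span_singleton size_span_singleton)
  qed
  have off_L: "?w y = Q\<^sup>2 * (?M + (q - 1) * (q + (q - 1) * hits p y))" if y: "y \<notin> ?L" for y
  proof -
    have eq: "?H \<inter> hyperplane y = perp {p, y}" using perp_Un[of "{p}" "{y}"] by (simp add: insert_commute)
    have "y \<notin> perp ?H" using y by (simp only: perp_perp_span) simp
    then have "q * icard (?H \<inter> hyperplane y) = q * Q\<^sup>2"
      using size_subspace_hyperplane[OF subspace_perp[of "{p}"], of y] p by (simp add: size_hyperplane)
    then have "icard (?H \<inter> hyperplane y) = Q\<^sup>2" using q_ge_2 by simp
    then show ?thesis
      unfolding eq perp_perp_span using size_Int_span_pair[OF p y] by simp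
  qed
  have hN: "hits p y = 1 + (if y \<in> adj p then q - 1 else 0)" if "y \<in> N" for y
  proof -
    have "y + 0 *s p \<in> N" using that by simp
    then have "hits p y \<noteq> 0" unfolding hits_eq_0_iff by blast
    then show ?thesis using hits_cases[OF p(1), of y] adj_eq_hits[OF p(1)] by auto
  qed
  have "(\<Sum>y\<in>N. hits p y) = ?M + (q - 1) * ?a"
  proof -
    have "(\<Sum>y\<in>N. hits p y) = (\<Sum>y\<in>N. 1 + (if y \<in> adj p then q - 1 else 0))"
      by (rule sum.cong[OF refl hN])
    moreover have "N \<inter> {y. y \<in> adj p} = adj p" by (auto simp: adj_def)
    ultimately show ?thesis by (simp add: sum.distrib sum.If_cases)
  qed
  moreover have "(\<Sum>y\<in>N. hits p y) = (\<Sum>y\<in>N - ?L. hits p y) + (\<Sum>y\<in>?L. hits p y)"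
    by (rule sum.subset_diff[OF LN]) simp
  moreover have "(\<Sum>y\<in>?L. hits p y) = (\<Sum>y\<in>?L. q)"
    using hits_multiple[OF p(1)] by (intro sum.cong refl) (auto simp: in_span_singleton)
  ultimately have hsum: "(\<Sum>y\<in>N - ?L. hits p y) = ?M + (q - 1) * ?a - q * q"
    using size_span_singleton[OF p(2)] by simp
  have cL: "icard (N - ?L) = ?M - q"
    using LN card_mono[OF _ LN] size_span_singleton[OF p(2)] by (simp add: card_Diff_subset of_nat_diff)
  have "(\<Sum>y\<in>N. ?w y) = (\<Sum>y\<in>N - ?L. ?w y) + (\<Sum>y\<in>?L. ?w y)"
    by (rule sum.subset_diff[OF LN]) simp
  also have "(\<Sum>y\<in>?L. ?w y) = (\<Sum>y\<in>?L. q * Q\<^sup>2 * (?M + (q - 1) * q))"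
    by (rule sum.cong[OF refl in_L])
  also have "(\<Sum>y\<in>N - ?L. ?w y) =
      (\<Sum>y\<in>N - ?L. Q\<^sup>2 * (?M + (q - 1) * q) + Q\<^sup>2 * (q - 1)\<^sup>2 * hits p y)"
    by (rule sum.cong[OF refl], subst off_L) (auto simp: algebra_simps power2_eq_square)
  also have "\<dots> = (?M - q) * (Q\<^sup>2 * (?M + (q - 1) * q)) + Q\<^sup>2 * (q - 1)\<^sup>2 * (?M + (q - 1) * ?a - q * q)"
    by (simp add: sum.distrib cL hsum flip: sum_distrib_left)
  finally have M2: "q * (\<Sum>f\<in>?H. (icard (N \<inter> hyperplane f))\<^sup>2) =
      (?M - q) * (Q\<^sup>2 * (?M + (q - 1) * q)) + Q\<^sup>2 * (q - 1)\<^sup>2 * (?M + (q - 1) * ?a - q * q)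
      + q * (q * Q\<^sup>2 * (?M + (q - 1) * q))"
    using second_moment_size[OF subspace_perp[of "{p}"]] size_span_singleton[OF p(2)] by simp
  have "0 \<in> ?H" by (simp add: hyperplane_eq)
  note id = two_character_identity[OF this]
  let ?S1 = "\<Sum>f\<in>?H. icard (N \<inter> hyperplane f)" and ?S2 = "\<Sum>f\<in>?H. (icard (N \<inter> hyperplane f))\<^sup>2"
  \<comment> \<open>Eliminating both moments leaves a linear equation for \<open>|adj p|\<close>.\<close>
  define D where "D = e * (q - 1) * Q"
  have D2: "D * D = (q - 1)\<^sup>2 * Q\<^sup>2" unfolding D_def using e_square by algebra
  have MD: "?M = q * Q\<^sup>2 + D" using size_N by (simp add: D_def)
  have poly: "Q\<^sup>2 * (q - 1) ^ 3 * (a - (Q\<^sup>2 + D)) =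
      (M - q) * (Q\<^sup>2 * (M + (q - 1) * q)) + Q\<^sup>2 * (q - 1)\<^sup>2 * (M + (q - 1) * a - q * q)
      + q * (q * Q\<^sup>2 * (M + (q - 1) * q))
      - (2 * Q\<^sup>2 + D) * (q * Q\<^sup>2 * (M + (q - 1) * q)) + Q\<^sup>2 * (Q\<^sup>2 + D) * (q * (q * Q\<^sup>2))
      - q * ((M - Q\<^sup>2) * (M - (Q\<^sup>2 + D)))" if "M = q * Q\<^sup>2 + D" for M a :: int
    unfolding that using D2 by algebra
  have "q * ?S2 - (2 * Q\<^sup>2 + D) * (q * ?S1) + Q\<^sup>2 * (Q\<^sup>2 + D) * (q * (q * Q\<^sup>2))
      - q * ((?M - Q\<^sup>2) * (?M - (Q\<^sup>2 + D))) =
    q * (?S2 - (2 * Q\<^sup>2 + D) * ?S1 + Q\<^sup>2 * (Q\<^sup>2 + D) * (q * Q\<^sup>2)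
      - (?M - Q\<^sup>2) * (?M - (Q\<^sup>2 + D)))"
    by (simp only: right_diff_distrib distrib_left mult_ac)
  also have "\<dots> = 0" using id p(2) by (simp add: size_hyperplane D_def)
  finally have "Q\<^sup>2 * (q - 1) ^ 3 * (?a - (Q\<^sup>2 + D)) = 0"
    unfolding poly[OF MD] M1 M2 .
  then show ?thesis using q_ge_2 Q_ge_q by (auto simp: D_def)
qed

lemma size_hits_1:
  assumes p: "p \<in> N" "p \<noteq> 0"
  shows "icard {x. hits p x = 1} = q\<^sup>2 * Q\<^sup>2 - q * Q\<^sup>2"
proof -
  have h: "hits p x = (if hits p x = 1 then 1 else 0) + (if hits p x = q then q else 0)" for x
    using hits_cases[OF p(1), of x] q_ge_2 by auto
  have "q * icard N = (\<Sum>x\<in>UNIV. hits p x)" using sum_hits[OF vec.subspace_UNIV, of p] by simp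
  also have "\<dots> = (\<Sum>x\<in>UNIV. (if hits p x = 1 then 1 else 0) + (if hits p x = q then q else 0))"
    by (rule sum.cong[OF refl h])
  also have "\<dots> = icard {x. hits p x = 1} + q * icard (adj p)"
    by (simp add: sum.distrib sum.If_cases adj_eq_hits[OF p(1)])
  finally show ?thesis using size_N size_adj[OF p] by (simp add: algebra_simps power2_eq_square)
qed

text \<open>This is the size of a hyperplane.\<close>

lemma size_tangent:
  assumes p: "p \<in> N" "p \<noteq> 0"
  shows "icard (tangent p) = q * Q\<^sup>2"
proof -
  have "tangent p = UNIV - {x. hits p x = 1}" by (auto simp: tangent_def)
  then have "icard (tangent p) = icard (UNIV :: ('a ^ 'm) set) - icard {x. hits p x = 1}"
    using card_mono[of UNIV "{x. hits p x = 1}"] by (simp add: card_Diff_subset of_nat_diff)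
  then show ?thesis using size_hits_1[OF p] size_UNIV by simp
qed

end

section \<open>Planes meeting the cone in a hyperoval\<close>

lemma double_count:
  assumes "finite A" "finite B"
  shows "(\<Sum>a\<in>A. icard {b \<in> B. R a b}) = (\<Sum>b\<in>B. icard {a \<in> A. R a b})"
proof -
  have "(\<Sum>a\<in>A. icard {b \<in> B. R a b}) = (\<Sum>a\<in>A. \<Sum>b\<in>B. if R a b then 1 else 0)"
    using assms by (intro sum.cong refl) (simp add: sum.If_cases Int_def conj_commute)
  also have "\<dots> = (\<Sum>b\<in>B. \<Sum>a\<in>A. if R a b then 1 else 0)" by (rule sum.swap)
  also have "\<dots> = (\<Sum>b\<in>B. icard {a \<in> A. R a b})"
    using assms by (intro sum.cong refl) (simp add: sum.If_cases Int_def conj_commute)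
  finally show ?thesis .
qed

text \<open>
  A plane \<open>E\<close> meeting the point set in \<open>q + 2\<close> points with no contained line. Sets of type
  \<open>(0,1,2,q+1)\<close> with such planes exist, for instance the cones over a hyperoval, so the exclusion has to use
  the number of contained lines on a point. Two contained lines through a point \<open>u\<close> of the hyperoval
  span a plane that meets \<open>E\<close> in \<open>u\<close> only, so a solid on \<open>E\<close> has at most one contained line through each
  point of the hyperoval. In such a solid any two of these lines meet, hence all of them have a common
  point. This forces the solids on \<open>E\<close> to contain more points than there are in total.
\<close>

locale hyperoval_plane = tallini_cone N n q Q e
  for N :: "('a::{field,finite} ^ 'm::finite) set" and n q Q e +
  fixes E :: "('a ^ 'm) set"
  assumes subspace_E: "vec.subspace E" and size_E: "icard E = q ^ 3" and q_gt_2: "q > 2"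
    and size_oval: "icard (N \<inter> E) = q\<^sup>2 + q - 1"
    and no_line: "\<And>u v. u \<in> N \<inter> E \<Longrightarrow> v \<in> N \<inter> E \<Longrightarrow> u + v \<in> N \<Longrightarrow> u \<noteq> 0 \<Longrightarrow> v \<in> vec.span {u}"
begin

definition oval :: "('a ^ 'm) set" where
  "oval = N \<inter> E - {0}"

lemma oval_D: "u \<in> oval \<Longrightarrow> u \<in> N" "u \<in> oval \<Longrightarrow> u \<in> E" "u \<in> oval \<Longrightarrow> u \<noteq> 0"
  by (auto simp: oval_def)

lemma E_combination: "u \<in> E \<Longrightarrow> v \<in> E \<Longrightarrow> c *s u + d *s v \<in> E"
  using subspace_E by (intro vec.subspace_add vec.subspace_scale)

lemma size_oval_points: "icard oval = (q - 1) * (q + 2)"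
proof -
  have "0 \<in> N \<inter> E" using zero vec.subspace_0[OF subspace_E] by simp
  then have "icard oval = icard (N \<inter> E) - 1"
    using card_gt_0_iff[of "N \<inter> E"] by (auto simp: oval_def card_Diff_subset of_nat_diff Suc_le_eq)
  then show ?thesis using size_oval by (simp add: algebra_simps power2_eq_square)
qed

lemma not_in_span_sym:
  fixes u v :: "'a ^ 'm"
  assumes "u \<noteq> 0" "v \<notin> vec.span {u}" "v \<noteq> 0"
  shows "u \<notin> vec.span {v}"
proof
  assume "u \<in> vec.span {v}"
  then obtain c where "u = c *s v" by (auto simp: in_span_singleton)
  then have "c \<noteq> 0" "v = inverse c *s u" using assms(1) by auto
  then show False using assms(2) unfolding in_span_singleton by blast
qed

lemma adj_closed:
  assumes u: "u \<in> N" and a: "a \<in> adj u" and d: "d \<noteq> 0"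
  shows "c *s u + d *s a \<in> adj u"
proof -
  have "u + (c *s u + d *s a) = (c + 1) *s u + d *s a" by (simp add: vec.scale_left_distrib add_ac)
  moreover have "(c + 1) *s u + d *s a \<in> N" "c *s u + d *s a \<in> N"
    by (rule adj_combination[OF u a])+
  ultimately show ?thesis unfolding adj_def by (simp only: mem_Collect_eq simp_thms)
qed

lemma adj_shift: "u \<in> N \<Longrightarrow> a \<in> adj u \<Longrightarrow> a + c *s u \<in> adj u"
  using adj_closed[of u a 1 c] by (simp add: add.commute)

lemma adj_multiple:
  assumes "u \<in> N" "a \<in> adj u"
  shows "a \<in> adj (c *s u)"
  using adj_combination[OF assms, of c 1] assms by (simp add: adj_def)

text \<open>None of the \<open>q + 1\<close> lines on \<open>u\<close> in \<open>E\<close> has more than one of the \<open>q + 1\<close> other points, so each has one.\<close>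

lemma hits_oval:
  assumes u: "u \<in> oval" and y: "y \<in> E" "y \<notin> vec.span {u}"
  shows "hits u y = 1"
proof -
  let ?L = "vec.span {u}"
  note uD = oval_D[OF u]
  have le: "hits u x = 0 \<or> hits u x = 1" if x: "x \<in> E - ?L" for x
  proof (rule ccontr)
    assume "\<not> ?thesis"
    then have "hits u x = q" using hits_cases[OF uD(1), of x] by auto
    then have "x \<in> adj u" by (simp add: adj_eq_hits[OF uD(1)])
    then have "x \<in> N" "u + x \<in> N" by (auto simp: adj_def)
    then show False using no_line[of u x] x uD by auto
  qed
  have "(\<Sum>x\<in>E - ?L. hits u x) = q * (q\<^sup>2 + q - 1) - q * q" "icard (E - ?L) = q ^ 3 - q"
    using sum_hits_off_line[OF subspace_E uD(2,1,3)] size_oval size_E by simp_all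
  moreover have "(\<Sum>x\<in>E - ?L. 1 - hits u x) = icard (E - ?L) - (\<Sum>x\<in>E - ?L. hits u x)"
    by (simp add: sum_subtractf)
  ultimately have "(\<Sum>x\<in>E - ?L. 1 - hits u x) = q ^ 3 - q - (q * (q\<^sup>2 + q - 1) - q * q)" by simp
  then have "(\<Sum>x\<in>E - ?L. 1 - hits u x) = 0"
    by (simp add: algebra_simps power2_eq_square power3_eq_cube)
  then have "\<forall>x\<in>E - ?L. 1 - hits u x = 0"
    using le by (subst (asm) sum_nonneg_eq_0_iff) force+
  then show ?thesis using y by auto
qed

lemma no_three_collinear_oval:
  assumes u: "u1 \<in> oval" "u2 \<in> oval" "u3 \<in> oval" and "u2 \<notin> vec.span {u1}"
    and eq: "u3 = c *s u1 + d *s u2"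
  shows "u3 \<in> vec.span {u1} \<or> u3 \<in> vec.span {u2}"
proof (cases "c = 0 \<or> d = 0")
  case True
  then show ?thesis using eq by (auto simp: in_span_singleton)
next
  case False
  have "c *s u1 \<in> N \<inter> E" "d *s u2 \<in> N \<inter> E"
    using oval_D[OF u(1)] oval_D[OF u(2)] subspace_E by (auto simp: scale vec.subspace_scale)
  moreover have "c *s u1 + d *s u2 \<in> N" using eq oval_D[OF u(3)] by simp
  ultimately have "d *s u2 \<in> vec.span {c *s u1}" using no_line False oval_D[OF u(1)] by simp
  then obtain k where "d *s u2 = (k * c) *s u1" by (auto simp: in_span_singleton)
  then have "inverse d *s (d *s u2) = (inverse d * (k * c)) *s u1" by simp
  then have "u2 = (inverse d * (k * c)) *s u1" using False by simp
  then have "u2 \<in> vec.span {u1}" unfolding in_span_singleton by blast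
  then show ?thesis using assms(4) by simp
qed

lemma exists_oval_point:
  assumes "finite F" "0 \<notin> F" "icard F \<le> q + 1"
  shows "\<exists>u\<in>oval. \<forall>v\<in>F. u \<notin> vec.span {v}"
proof -
  let ?U = "\<Union>v\<in>F. vec.span {v} - {0}"
  have "icard ?U \<le> (\<Sum>v\<in>F. icard (vec.span {v} - {0}))"
    unfolding of_nat_sum[symmetric] of_nat_le_iff by (rule card_UN_le[OF assms(1)])
  also have "\<dots> = (\<Sum>v\<in>F. q - 1)"
  proof (rule sum.cong[OF refl])
    fix v assume "v \<in> F"
    then have "v \<noteq> 0" using assms(2) by auto
    then have c: "icard (vec.span {v}) = q" by (rule size_span_singleton)
    have "card (vec.span {v} - {0}) = card (vec.span {v}) - 1"
      by (rule card_Diff_singleton[OF vec.span_zero])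
    then show "icard (vec.span {v} - {0}) = q - 1" using c q_ge_2 by (simp add: of_nat_diff)
  qed
  also have "\<dots> < icard oval"
    using assms(3) q_ge_2 by (simp add: size_oval_points mult.commute)
  finally have "\<not> oval \<subseteq> ?U" using card_mono[of ?U oval] assms(1) by fastforce
  then obtain u where "u \<in> oval" "u \<notin> ?U" by blast
  then show ?thesis using oval_D(3) by blast
qed

text \<open>
  If the plane of two contained lines on \<open>u\<close> met \<open>E\<close> in a line, it would contain a third point \<open>r\<close>
  of the hyperoval. All points of this plane outside the line \<open>ur\<close> are then in \<open>N\<close>, and for
  \<open>q > 2\<close> they force \<open>ur\<close> into \<open>N\<close>.
\<close>

lemma unique_contained_line:
  assumes u: "u \<in> oval" and a: "a \<in> adj u" and b: "b \<in> adj u" and y: "b - a \<in> E"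
  shows "b - a \<in> vec.span {u}"
proof (rule ccontr)
  assume "b - a \<notin> vec.span {u}"
  note uD = oval_D[OF u]
  have "hits u (b - a) = 1" by (rule hits_oval[OF u y]) fact
  then obtain t where t: "b - a + t *s u \<in> N" unfolding hits_eq_1_iff by blast
  define r where "r = b - a + t *s u"
  have r: "r \<in> N" "r \<in> E" using t y uD subspace_E
    by (auto simp: r_def vec.subspace_add vec.subspace_scale)
  have "r \<notin> vec.span {u}"
  proof
    assume "r \<in> vec.span {u}"
    then obtain c where "r = c *s u" by (auto simp: in_span_singleton)
    then have "b - a = (c - t) *s u" by (simp add: r_def vec.scale_left_diff_distrib algebra_simps)
    then show False using \<open>b - a \<notin> vec.span {u}\<close> unfolding in_span_singleton by blast
  qed
  have big: "c *s r + d *s a + f *s u \<in> N" if "d \<noteq> 0" for c d f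
  proof -
    have "a + (f / d) *s u \<in> N" "b + (t + f / d) *s u \<in> N"
      using adj_shift[OF uD(1) a] adj_shift[OF uD(1) b] by (auto simp: adj_def)
    moreover have "r + (a + (f / d) *s u) = b + (t + f / d) *s u"
      by (simp add: r_def vec.scale_left_distrib)
    ultimately have "c *s r + d *s (a + (f / d) *s u) \<in> N" using line[OF r(1)] by simp
    then show ?thesis using that by (simp add: vec.scale_right_distrib add.assoc)
  qed
  have "\<exists>d::'a. d \<noteq> 0 \<and> d \<noteq> -1"
  proof (rule ccontr)
    assume "\<nexists>d::'a. d \<noteq> 0 \<and> d \<noteq> -1"
    then have "(UNIV :: 'a set) \<subseteq> {0, -1}" by auto
    then have "CARD('a) \<le> card {0, -1 :: 'a}" by (intro card_mono) auto
    also have "\<dots> \<le> 2" by (simp add: card_insert_if)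
    finally show False using q_gt_2 by (simp add: q_def)
  qed
  then obtain d :: 'a where d: "d \<noteq> 0" "1 + d \<noteq> 0"
    by (metis add.commute add_eq_0_iff2)
  have "1 *s r + 1 *s a + 1 *s u \<in> N" by (rule big) simp
  then have X1: "r + a + u \<in> N" by simp
  have "0 *s r + d *s a + 0 *s u \<in> N" by (rule big[OF d(1)])
  then have X2: "d *s a \<in> N" by simp
  have "1 *s r + (1 + d) *s a + 1 *s u \<in> N" by (rule big[OF d(2)])
  then have "(r + a + u) + d *s a \<in> N" by (simp add: vec.scale_left_distrib add_ac)
  from line[OF X1 X2 this, of 1 "-1 / d"] have "u + r \<in> N" using d by (simp add: add_ac)
  then show False using no_line[of u r] r uD \<open>r \<notin> vec.span {u}\<close> by auto
qed

lemma span_triple_eq_E: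
  assumes u: "u1 \<in> E" "u1 \<noteq> 0" "u2 \<in> E" "u2 \<notin> vec.span {u1}" and y: "y \<in> E" "y \<notin> vec.span {u1, u2}"
    and z: "z \<in> E"
  obtains c d f where "z = c *s u1 + d *s u2 + f *s y"
proof -
  have "card (vec.span {y, u1, u2}) = CARD('a) * card (vec.span {u1, u2})"
    by (rule card_span_insert[OF y(2)])
  also have "\<dots> = CARD('a) * (CARD('a))\<^sup>2" by (simp only: card_span_pair[OF u(2,4)])
  finally have "icard (vec.span {y, u1, u2}) = icard E"
    using size_E by (simp add: q_def power2_eq_square power3_eq_cube del: vec.span_insert)
  moreover have "vec.span {y, u1, u2} \<subseteq> E" using u y subspace_E by (intro vec.span_minimal) auto
  ultimately have "vec.span {y, u1, u2} = E" by (intro card_subset_eq) (auto simp del: vec.span_insert)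
  then have "z \<in> vec.span {y, u1, u2}" using z by (simp del: vec.span_insert)
  then obtain f where "z - f *s y \<in> vec.span {u1, u2}" using vec.span_breakdown_eq by blast
  then obtain c d where "z - f *s y = c *s u1 + d *s u2" unfolding in_span_pair by blast
  then have "z = c *s u1 + d *s u2 + f *s y" by (simp add: algebra_simps)
  then show ?thesis using that by blast
qed

text \<open>
  Two skew contained lines, through the points \<open>u1\<close> and \<open>u2\<close> of the hyperoval: the transversal to
  both through a third point \<open>u3\<close> has three points in \<open>N\<close>, so it is contained.
\<close>

lemma transversal_contained:
  assumes u: "u1 \<in> oval" "u2 \<in> oval" "u2 \<notin> vec.span {u1}"
    and a: "a1 \<in> adj u1" "a2 \<in> adj u2" "a2 - a1 \<in> E" "a2 - a1 \<notin> vec.span {u1, u2}"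
    and u3: "u3 \<in> oval" "u3 \<notin> vec.span {u1}" "u3 \<notin> vec.span {u2}"
  obtains c d f where "f \<noteq> 0" "u3 = f *s (c *s u1 + d *s u2 + (a2 - a1))" "a1 - c *s u1 \<in> adj u3"
proof -
  note D1 = oval_D[OF u(1)] and D2 = oval_D[OF u(2)] and D3 = oval_D[OF u3(1)]
  obtain c d f where eq: "u3 = c *s u1 + d *s u2 + f *s (a2 - a1)"
    using span_triple_eq_E[OF D1(2,3) D2(2) u(3) a(3,4) D3(2)] .
  have f: "f \<noteq> 0"
    using no_three_collinear_oval[OF u(1,2) u3(1) u(3), of c d] eq u3 by auto
  define x where "x = c *s u1 + (-f) *s a1"
  define y where "y = d *s u2 + f *s a2"
  have xN: "x \<in> N" using adj_combination[OF D1(1) a(1)] unfolding x_def .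
  have yN: "y \<in> N" using adj_combination[OF D2(1) a(2)] unfolding y_def .
  have xy: "x + y = u3" by (simp add: x_def y_def eq algebra_simps vec.scale_right_diff_distrib)
  have "2 *s x + 1 *s y \<in> N" by (rule line[OF xN yN]) (use xy D3(1) in simp)
  moreover have "2 *s x + 1 *s y = u3 + x"
    unfolding xy[symmetric] by (simp add: vec.scale_left_distrib[of 1 1, simplified])
  ultimately have "x \<in> adj u3" using xN by (simp add: adj_def)
  then have "0 *s u3 + (- inverse f) *s x \<in> adj u3" using f by (intro adj_closed D3(1)) auto
  moreover have "0 *s u3 + (- inverse f) *s x = a1 - (c / f) *s u1"
    using f by (simp add: x_def vec.scale_right_diff_distrib divide_inverse mult.commute)
  ultimately have "a1 - (c / f) *s u1 \<in> adj u3" by simp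
  moreover have "u3 = f *s ((c / f) *s u1 + (d / f) *s u2 + (a2 - a1))"
    using f by (simp add: eq vec.scale_right_distrib)
  ultimately show ?thesis using that[OF f] by blast
qed

text \<open>
  Hence there are no skew contained lines on points \<open>u1, u2\<close> of the hyperoval within a solid on \<open>E\<close>:
  otherwise take three more points \<open>u3, u4, u5\<close>. The transversals on \<open>u3\<close> and \<open>u4\<close> are skew again, and
  the line on \<open>u5\<close> is transversal to both pairs, which makes \<open>u1, u3, u5\<close> collinear.
\<close>

lemma contained_lines_meet:
  assumes u: "u1 \<in> oval" "u2 \<in> oval" "u2 \<notin> vec.span {u1}"
    and a: "a1 \<in> adj u1" "a2 \<in> adj u2" and y: "a2 - a1 \<in> E"
  shows "a2 - a1 \<in> vec.span {u1, u2}"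
proof (rule ccontr)
  assume skew: "a2 - a1 \<notin> vec.span {u1, u2}"
  note trans = transversal_contained[OF u a y skew]
  have nz: "u1 \<noteq> 0" "u2 \<noteq> 0" using u oval_D by auto
  have "icard {u1, u2} \<le> q + 1" using q_gt_2 by (simp add: card_insert_if)
  then obtain u3 where u3: "u3 \<in> oval" "u3 \<notin> vec.span {u1}" "u3 \<notin> vec.span {u2}"
    using exists_oval_point[of "{u1, u2}"] nz by auto
  have nz3: "u3 \<noteq> 0" using u3 oval_D by auto
  have "icard {u1, u2, u3} \<le> q + 1" using q_gt_2 by (simp add: card_insert_if)
  then obtain u4 where u4: "u4 \<in> oval" "u4 \<notin> vec.span {u1}" "u4 \<notin> vec.span {u2}" "u4 \<notin> vec.span {u3}"
    using exists_oval_point[of "{u1, u2, u3}"] nz nz3 by auto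
  have nz4: "u4 \<noteq> 0" using u4 oval_D by auto
  have "icard {u1, u2, u3, u4} \<le> q + 1" using q_gt_2 by (simp add: card_insert_if)
  then obtain u5 where u5: "u5 \<in> oval" "u5 \<notin> vec.span {u1}" "u5 \<notin> vec.span {u2}"
      "u5 \<notin> vec.span {u3}" "u5 \<notin> vec.span {u4}"
    using exists_oval_point[of "{u1, u2, u3, u4}"] nz nz3 nz4 by auto
  obtain c3 d3 f3 where t3: "f3 \<noteq> 0" "u3 = f3 *s (c3 *s u1 + d3 *s u2 + (a2 - a1))"
      "a1 - c3 *s u1 \<in> adj u3" using trans[OF u3] .
  obtain c4 d4 f4 where t4: "f4 \<noteq> 0" "u4 = f4 *s (c4 *s u1 + d4 *s u2 + (a2 - a1))"
      "a1 - c4 *s u1 \<in> adj u4" using trans[OF u4(1-3)] .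
  obtain c5 d5 f5 where t5: "f5 \<noteq> 0" "u5 = f5 *s (c5 *s u1 + d5 *s u2 + (a2 - a1))"
      "a1 - c5 *s u1 \<in> adj u5" using trans[OF u5(1-3)] .
  \<comment> \<open>Two transversals meet the first line in different points, as otherwise \<open>u2\<close>, \<open>v\<close>, \<open>w\<close> would be collinear.\<close>
  have diff: "c \<noteq> c'" if v: "v \<in> oval" "v \<notin> vec.span {u2}" "v = f *s (c *s u1 + d *s u2 + (a2 - a1))" "f \<noteq> 0"
    and w: "w \<in> oval" "w \<notin> vec.span {u2}" "w \<notin> vec.span {v}" "w = f' *s (c' *s u1 + d' *s u2 + (a2 - a1))"
    for v w c d f c' d' f'
  proof
    assume "c = c'"
    then have "w = f' *s ((c *s u1 + d *s u2 + (a2 - a1)) + (d' - d) *s u2)"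
      unfolding w(4) by (simp add: algebra_simps)
    also have "c *s u1 + d *s u2 + (a2 - a1) = inverse f *s v" using v(3,4) by simp
    finally have "w = (f' * inverse f) *s v + (f' * (d' - d)) *s u2"
      by (simp add: vec.scale_right_distrib)
    then show False
      using no_three_collinear_oval[OF v(1) u(2) w(1)] not_in_span_sym[OF nz(2) v(2)] oval_D[OF v(1)] nz w(2,3)
      by blast
  qed
  have c34: "c3 \<noteq> c4" using diff[OF u3(1,3) t3(2,1) u4(1,3,4) t4(2)] .
  have c35: "c3 \<noteq> c5" using diff[OF u3(1,3) t3(2,1) u5(1,3,4) t5(2)] .
  have D: "u1 \<in> E" "u3 \<in> E" using u u3 oval_D by auto
  have y': "(a1 - c4 *s u1) - (a1 - c3 *s u1) = (c3 - c4) *s u1"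
    by (simp add: vec.scale_left_diff_distrib)
  have skew': "(c3 - c4) *s u1 \<notin> vec.span {u3, u4}"
  proof
    assume "(c3 - c4) *s u1 \<in> vec.span {u3, u4}"
    then have "inverse (c3 - c4) *s ((c3 - c4) *s u1) \<in> vec.span {u3, u4}" by (rule vec.span_scale)
    then have "u1 \<in> vec.span {u3, u4}" using c34 by simp
    then obtain c d where "u1 = c *s u3 + d *s u4" unfolding in_span_pair by blast
    then have "u1 \<in> vec.span {u3} \<or> u1 \<in> vec.span {u4}"
      using no_three_collinear_oval[OF u3(1) u4(1) u(1) u4(4)] by blast
    then show False using not_in_span_sym[OF nz(1) u3(2) nz3] not_in_span_sym[OF nz(1) u4(2) nz4] by blast
  qed
  have E': "(a1 - c4 *s u1) - (a1 - c3 *s u1) \<in> E"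
    unfolding y' by (rule vec.subspace_scale[OF subspace_E D(1)])
  obtain c where t: "a1 - c3 *s u1 - c *s u3 \<in> adj u5"
    using transversal_contained[OF u3(1) u4(1,4) t3(3) t4(3) E' _ u5(1,4,5)] skew' unfolding y' by blast
  have eq: "(a1 - c3 *s u1 - c *s u3) - (a1 - c5 *s u1) = (c5 - c3) *s u1 + (- c) *s u3"
    by (simp add: vec.scale_left_diff_distrib)
  have "(a1 - c3 *s u1 - c *s u3) - (a1 - c5 *s u1) \<in> vec.span {u5}"
    by (rule unique_contained_line[OF u5(1) t5(3) t]) (simp only: eq E_combination D)
  then obtain k where k: "(c5 - c3) *s u1 + (- c) *s u3 = k *s u5"
    unfolding eq by (auto simp: in_span_singleton)
  show False
  proof (cases "k = 0")
    case True
    then have "(c5 - c3) *s u1 = c *s u3" using k by simp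
    then have "inverse (c5 - c3) *s ((c5 - c3) *s u1) = (inverse (c5 - c3) * c) *s u3" by simp
    then have "u1 = (inverse (c5 - c3) * c) *s u3" using c35 by simp
    then have "u1 \<in> vec.span {u3}" unfolding in_span_singleton by blast
    then show False using not_in_span_sym[OF nz(1) u3(2) nz3] by blast
  next
    case False
    have "inverse k *s (k *s u5) = (inverse k * (c5 - c3)) *s u1 + (inverse k * (- c)) *s u3"
      unfolding k[symmetric] by (simp add: vec.scale_right_diff_distrib)
    then have "u5 = (inverse k * (c5 - c3)) *s u1 + (inverse k * (- c)) *s u3" using False by simp
    then show False using no_three_collinear_oval[OF u(1) u3(1) u5(1) u3(2)] u5 by blast
  qed
qed

text \<open>The cosets \<open>a + E\<close> stand for the solids on \<open>E\<close>; \<open>feet a\<close> collects the points of the hyperoval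
  on a contained line of the solid.\<close>

definition feet :: "'a ^ 'm \<Rightarrow> ('a ^ 'm) set" where
  "feet a = {u \<in> oval. \<exists>z\<in>adj u. z - a \<in> E}"

text \<open>Pairwise meeting lines on three non-collinear points of \<open>E\<close> are not coplanar, so they have a
  common point.\<close>

lemma common_vertex:
  assumes "feet a \<noteq> {}"
  obtains w where "w - a \<in> E" "\<And>u. u \<in> feet a \<Longrightarrow> w \<in> adj u"
proof -
  obtain u1 z1 where u1: "u1 \<in> oval" "z1 \<in> adj u1" "z1 - a \<in> E"
    using assms by (auto simp: feet_def)
  note D1 = oval_D[OF u1(1)]
  have mult: "w \<in> adj v" if "w \<in> adj u" "u \<in> oval" "v \<in> vec.span {u}" for u v w
    using that adj_multiple[of u w] oval_D by (auto simp: in_span_singleton)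
  show ?thesis
  proof (cases "feet a \<subseteq> vec.span {u1}")
    case True
    then show ?thesis using that[of z1] u1 mult by blast
  next
    case False
    then obtain u2 z2 where u2: "u2 \<in> oval" "u2 \<notin> vec.span {u1}" "z2 \<in> adj u2" "z2 - a \<in> E"
      by (auto simp: feet_def)
    note D2 = oval_D[OF u2(1)]
    have sub: "x - y \<in> E" if "x - a \<in> E" "y - a \<in> E" for x y
      using vec.subspace_diff[OF subspace_E that] by simp
    have "z2 - z1 \<in> vec.span {u1, u2}"
      by (rule contained_lines_meet[OF u1(1) u2(1,2) u1(2) u2(3) sub[OF u2(4) u1(3)]])
    then obtain c d where cd: "z2 - z1 = c *s u1 + d *s u2" unfolding in_span_pair by blast
    define w where "w = z1 + c *s u1"
    have w2: "w = z2 + (- d) *s u2" using cd by (simp add: w_def algebra_simps)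
    have wE: "w - a \<in> E" using vec.subspace_add[OF subspace_E u1(3) vec.subspace_scale[OF subspace_E D1(2), of c]]
      by (simp add: w_def algebra_simps)
    have w1: "w \<in> adj u1" using adj_shift[OF D1(1) u1(2)] by (simp add: w_def)
    have w2': "w \<in> adj u2" unfolding w2 by (rule adj_shift[OF D2(1) u2(3)])
    have "w \<in> adj u" if u: "u \<in> feet a" for u
    proof (cases "u \<in> vec.span {u1} \<or> u \<in> vec.span {u2}")
      case True
      then show ?thesis using mult w1 w2' u1 u2 by blast
    next
      case False
      obtain z where z: "u \<in> oval" "z \<in> adj u" "z - a \<in> E" using u by (auto simp: feet_def)
      have zw: "z - w \<in> E" by (rule sub[OF z(3) wE])
      obtain k l where kl: "z - w = k *s u1 + l *s u"
        using contained_lines_meet[OF u1(1) z(1) _ w1 z(2) zw] False unfolding in_span_pair by blast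
      obtain k' l' where kl': "z - w = k' *s u2 + l' *s u"
        using contained_lines_meet[OF u2(1) z(1) _ w2' z(2) zw] False unfolding in_span_pair by blast
      have "k = 0"
      proof (rule ccontr)
        assume k: "k \<noteq> 0"
        have "k *s u1 = k' *s u2 + (l' - l) *s u"
          using kl kl' by (simp add: vec.scale_left_diff_distrib algebra_simps)
        then have "inverse k *s (k *s u1) = (inverse k * k') *s u2 + (inverse k * (l' - l)) *s u"
          by (simp add: vec.scale_right_distrib)
        then have "u1 = (inverse k * k') *s u2 + (inverse k * (l' - l)) *s u" using k by simp
        then have "u1 \<in> vec.span {u2} \<or> u1 \<in> vec.span {u}"
          using no_three_collinear_oval[OF u2(1) z(1) u1(1)] False by blast
        then show False
          using not_in_span_sym[OF D1(3) u2(2) D2(3)] not_in_span_sym[of u1 u] False D1(3) oval_D[OF z(1)]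
          by blast
      qed
      then have "w = z + (- l) *s u" using kl by (simp add: algebra_simps)
      then show ?thesis using adj_shift[OF oval_D(1)[OF z(1)] z(2)] by (simp only:)
    qed
    then show ?thesis using that[OF wE] by blast
  qed
qed

text \<open>The contained lines of the solid have only the vertex \<open>w\<close> in common; \<open>w + u\<close> runs through
  the other points on them off \<open>E\<close>.\<close>

lemma size_solid_ge:
  "icard {z \<in> N. z - a \<in> E} \<ge> icard (feet a) + (if feet a \<noteq> {} then 1 else 0)"
proof (cases "feet a = {}")
  case False
  obtain w where w: "w - a \<in> E" "\<And>u. u \<in> feet a \<Longrightarrow> w \<in> adj u"
    using common_vertex[OF False] by blast
  have inj: "inj_on (\<lambda>u. u + w) (feet a)" by (simp add: inj_on_def)
  have fD: "u \<in> N" "u \<in> E" "u \<noteq> 0" if "u \<in> feet a" for u using that oval_D by (auto simp: feet_def)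
  have "w \<notin> (\<lambda>u. u + w) ` feet a" using fD(3) by auto
  then have "card (insert w ((\<lambda>u. u + w) ` feet a)) = card (feet a) + 1"
    using card_image[OF inj] by simp
  moreover have sub: "insert w ((\<lambda>u. u + w) ` feet a) \<subseteq> {z \<in> N. z - a \<in> E}"
  proof -
    have "w \<in> N" using False w(2) by (auto simp: adj_def)
    moreover have "u + w \<in> N" if "u \<in> feet a" for u using w(2)[OF that] by (simp add: adj_def)
    moreover have "u + w - a \<in> E" if "u \<in> feet a" for u
      using vec.subspace_add[OF subspace_E fD(2)[OF that] w(1)] by (simp add: algebra_simps)
    ultimately show ?thesis using w(1) by auto
  qed
  ultimately have "card (feet a) + 1 \<le> card {z \<in> N. z - a \<in> E}"
    using card_mono[OF _ sub] by simp
  then show ?thesis using False by simp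
qed simp

lemma size_coset: "icard {a. z - a \<in> E} = q ^ 3"
proof -
  have "{a. z - a \<in> E} = (\<lambda>x. z - x) ` E"
  proof (intro equalityI subsetI)
    fix a assume "a \<in> {a. z - a \<in> E}"
    then show "a \<in> (\<lambda>x. z - x) ` E" by (intro image_eqI[of _ _ "z - a"]) auto
  qed auto
  moreover have "inj_on (\<lambda>x. z - x) E" by (simp add: inj_on_def)
  ultimately show ?thesis using size_E by (simp add: card_image)
qed

lemma coset_not_in_E: "z - a \<in> E \<Longrightarrow> z \<notin> E \<longleftrightarrow> a \<notin> E"
  using vec.subspace_diff[OF subspace_E, of z "z - a"] vec.subspace_add[OF subspace_E, of "z - a" a] by auto

text \<open>Of the solids on \<open>E\<close>, exactly \<open>(B - q)/(q\<^sup>2 - q)\<close> contain a contained line on \<open>u\<close>, where \<open>B\<close> is the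
  size of \<open>adj u\<close>. Each of them is counted \<open>q\<^sup>4 - q\<^sup>3\<close> times here.\<close>

lemma size_feet_of_point:
  assumes u: "u \<in> oval"
  shows "icard {a \<in> - E. u \<in> feet a} = q\<^sup>2 * (icard (adj u) - q)"
proof -
  let ?C = "{a \<in> - E. u \<in> feet a}" and ?B = "adj u - E"
  note D = oval_D[OF u]
  have "adj u \<inter> E = vec.span {u}"
  proof (intro equalityI subsetI)
    fix x assume "x \<in> adj u \<inter> E"
    then show "x \<in> vec.span {u}" using no_line[of u x] D by (auto simp: adj_def)
  next
    fix x assume "x \<in> vec.span {u}"
    then show "x \<in> adj u \<inter> E"
      using D hits_multiple[OF D(1)] subspace_E
      by (auto simp: adj_eq_hits in_span_singleton vec.subspace_scale)
  qed
  then have "icard (adj u \<inter> E) = q" using size_span_singleton[OF D(3)] by simp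
  then have cB: "icard ?B = icard (adj u) - q"
    using card_Diff_subset_Int[of "adj u" E] card_mono[of "adj u" "adj u \<inter> E"]
    by (simp add: of_nat_diff)
  have "(\<Sum>a\<in>?C. icard {z \<in> ?B. z - a \<in> E}) = (\<Sum>z\<in>?B. icard {a \<in> ?C. z - a \<in> E})"
    by (rule double_count) auto
  moreover have "icard {z \<in> ?B. z - a \<in> E} = q" if a: "a \<in> ?C" for a
  proof -
    obtain z where z: "z \<in> adj u" "z - a \<in> E" using a by (auto simp: feet_def)
    have "{z \<in> ?B. z - a \<in> E} = (\<lambda>t. z + t *s u) ` UNIV"
    proof (intro equalityI subsetI)
      fix x assume x: "x \<in> {z \<in> ?B. z - a \<in> E}"
      have "x - z \<in> E" using x vec.subspace_diff[OF subspace_E _ z(2), of "x - a"] by simp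
      then have "x - z \<in> vec.span {u}" using unique_contained_line[OF u z(1), of x] x by auto
      then obtain t where "x - z = t *s u" by (auto simp: in_span_singleton)
      then show "x \<in> (\<lambda>t. z + t *s u) ` UNIV" by (intro image_eqI[of _ _ t]) (auto simp: algebra_simps)
    next
      fix x assume "x \<in> (\<lambda>t. z + t *s u) ` UNIV"
      then obtain t where t: "x = z + t *s u" by auto
      have "x - a \<in> E"
        using vec.subspace_add[OF subspace_E z(2) vec.subspace_scale[OF subspace_E D(2), of t]]
        by (simp add: t algebra_simps)
      moreover have "x \<in> adj u" unfolding t by (rule adj_shift[OF D(1) z(1)])
      ultimately show "x \<in> {z \<in> ?B. z - a \<in> E}" using a coset_not_in_E by auto
    qed
    moreover have "inj (\<lambda>t. z + t *s u)" using D(3) by (auto simp: inj_on_def)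
    ultimately show ?thesis by (simp add: card_image q_def)
  qed
  moreover have "icard {a \<in> ?C. z - a \<in> E} = q ^ 3" if z: "z \<in> ?B" for z
  proof -
    have "{a \<in> ?C. z - a \<in> E} = {a. z - a \<in> E}"
      using z u coset_not_in_E by (auto simp: feet_def)
    then show ?thesis by (simp add: size_coset)
  qed
  ultimately have "icard ?C * q = icard ?B * q ^ 3" by simp
  then have "q * icard ?C = q * (q\<^sup>2 * (icard (adj u) - q))"
    using cB by (simp add: power2_eq_square power3_eq_cube mult_ac)
  then show ?thesis using q_ge_2 by simp
qed

text \<open>
  Summing the bound over all solids on \<open>E\<close> gives \<open>q (|N| - q\<^sup>2 - q + 1) \<ge> (q\<^sup>2 + q - 1) (B - q)\<close>, which is false
  iff \<open>Q + e (q\<^sup>2 - 1) > 0\<close>. The summand 1 for the vertices is needed in the elliptic case with \<open>n = 2\<close>.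
\<close>

lemma no_hyperoval_plane:
  assumes big: "e = 1 \<or> n \<ge> 2"
  shows False
proof -
  let ?B = "Q\<^sup>2 + e * (q - 1) * Q"
  have adjB: "icard (adj u) = ?B" if "u \<in> oval" for u using size_adj oval_D[OF that] by simp
  have "icard ({} :: ('a ^ 'm) set) \<le> q + 1" using q_ge_2 by simp
  then obtain u0 where u0: "u0 \<in> oval" using exists_oval_point[of "{}"] by auto
  have all: "(\<Sum>a\<in>-E. icard {z \<in> N. z - a \<in> E}) = q ^ 3 * (icard N - (q\<^sup>2 + q - 1))"
  proof -
    have "(\<Sum>a\<in>-E. icard {z \<in> N. z - a \<in> E}) = (\<Sum>z\<in>N. icard {a \<in> -E. z - a \<in> E})"
      by (rule double_count) auto
    also have "\<dots> = (\<Sum>z\<in>N. if z \<in> E then 0 else q ^ 3)"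
    proof (rule sum.cong[OF refl])
      fix z
      have "{a \<in> -E. z - a \<in> E} = (if z \<in> E then {} else {a. z - a \<in> E})"
        using coset_not_in_E by auto
      then show "icard {a \<in> -E. z - a \<in> E} = (if z \<in> E then 0 else q ^ 3)" by (simp add: size_coset)
    qed
    also have "\<dots> = q ^ 3 * icard (N - E)" by (simp add: sum.If_cases Diff_eq)
    also have "icard (N - E) = icard N - icard (N \<inter> E)"
      using card_Diff_subset_Int[of N E] card_mono[of N "N \<inter> E"] by (simp add: of_nat_diff)
    finally show ?thesis by (simp add: size_oval)
  qed
  have feet: "(\<Sum>a\<in>-E. icard (feet a)) = (q - 1) * (q + 2) * (q\<^sup>2 * (?B - q))"
  proof -
    have "(\<Sum>a\<in>-E. icard {u \<in> oval. u \<in> feet a}) = (\<Sum>u\<in>oval. icard {a \<in> -E. u \<in> feet a})"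
      by (rule double_count) auto
    also have "\<dots> = (\<Sum>u\<in>oval. q\<^sup>2 * (?B - q))"
      by (rule sum.cong[OF refl]) (simp only: size_feet_of_point adjB)
    finally have "(\<Sum>a\<in>-E. icard {u \<in> oval. u \<in> feet a}) = icard oval * (q\<^sup>2 * (?B - q))" by simp
    moreover have "{u \<in> oval. u \<in> feet a} = feet a" for a by (auto simp: feet_def)
    ultimately show ?thesis by (simp add: size_oval_points)
  qed
  have "(\<Sum>a\<in>-E. if feet a \<noteq> {} then 1 else 0) = icard {a \<in> -E. feet a \<noteq> {}}"
    by (simp add: sum.If_cases Int_def)
  moreover have "card {a \<in> -E. u0 \<in> feet a} \<le> card {a \<in> -E. feet a \<noteq> {}}" by (rule card_mono) auto
  ultimately have nonempty: "(\<Sum>a\<in>-E. if feet a \<noteq> {} then 1 else 0) \<ge> q\<^sup>2 * (?B - q)"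
    using size_feet_of_point[OF u0] adjB[OF u0] by simp
  have "(\<Sum>a\<in>-E. icard (feet a) + (if feet a \<noteq> {} then 1 else 0)) \<le> (\<Sum>a\<in>-E. icard {z \<in> N. z - a \<in> E})"
    by (rule sum_mono) (rule size_solid_ge)
  then have "(q - 1) * (q + 2) * (q\<^sup>2 * (?B - q)) + q\<^sup>2 * (?B - q) \<le> q ^ 3 * (icard N - (q\<^sup>2 + q - 1))"
    using all feet nonempty by (simp add: sum.distrib)
  moreover have "(q - 1) * (q + 2) * (q\<^sup>2 * (?B - q)) + q\<^sup>2 * (?B - q) - q ^ 3 * (icard N - (q\<^sup>2 + q - 1))
      = q\<^sup>2 * ((q - 1) * Q * (Q + e * (q\<^sup>2 - 1)))"
    unfolding size_N by (simp add: algebra_simps power2_eq_square power3_eq_cube)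
  moreover have "Q + e * (q\<^sup>2 - 1) > 0"
  proof (cases "e = 1")
    case True
    have "q\<^sup>2 > 0" using q_ge_2 by simp
    then have "1 \<le> q\<^sup>2" by (simp only: int_one_le_iff_zero_less)
    moreover have "e * (q\<^sup>2 - 1) = q\<^sup>2 - 1" using True by simp
    ultimately show ?thesis using Q_ge_q q_ge_2 by linarith
  next
    case False
    then have "n \<ge> 2" "e = -1" using big sign by auto
    moreover have "q\<^sup>2 \<le> Q" using power_increasing[OF \<open>n \<ge> 2\<close>, of q] q_ge_2 by (simp add: Q_def)
    ultimately show ?thesis by simp
  qed
  moreover have "q\<^sup>2 > 0" "(q - 1) * Q > 0" using q_ge_2 Q_ge_q by auto
  ultimately show False by (smt (verit) mult_pos_pos)
qed

end

section \<open>The tangent lines at a point form a hyperplane\<close>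

context tallini_cone
begin

lemma sum_translates:
  fixes r :: "'a ^ 'm"
  shows "(\<Sum>x\<in>UNIV. icard {s. x + s *s r \<in> T}) = q * icard T"
proof -
  have "(\<Sum>x\<in>UNIV. icard {s \<in> UNIV. x + s *s r \<in> T}) = (\<Sum>s\<in>UNIV. icard {x \<in> UNIV. x + s *s r \<in> T})"
    by (rule double_count) auto
  moreover have "card {x. x + s *s r \<in> T} = card T" for s
  proof -
    have "{x. x + s *s r \<in> T} = (\<lambda>y. y - s *s r) ` T"
    proof (intro equalityI subsetI)
      fix x assume "x \<in> {x. x + s *s r \<in> T}"
      then show "x \<in> (\<lambda>y. y - s *s r) ` T" by (intro image_eqI[of _ _ "x + s *s r"]) auto
    qed auto
    then show ?thesis by (simp add: card_image inj_on_def)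
  qed
  ultimately show ?thesis by (simp add: q_def)
qed

lemma secant_combination:
  assumes "p \<in> N" "r \<in> N" "p + r \<notin> N" "b *s r + c *s p \<in> N"
  shows "b = 0 \<or> c = 0"
proof (rule ccontr)
  assume "\<not> ?thesis"
  then have bc: "b \<noteq> 0" "c \<noteq> 0" by auto
  have "c *s p + b *s r \<in> N" using assms(4) by (simp add: add.commute)
  then have "(1 / c) *s (c *s p) + (1 / b) *s (b *s r) \<in> N"
    by (rule line[OF scale[OF assms(1)] scale[OF assms(2)]])
  then show False using bc assms(3) by simp
qed

text \<open>
  A plane on the secant \<open>pr\<close> without a tangent or contained line on \<open>p\<close> has \<open>q + 2\<close> points. As it is
  not a hyperoval plane, it consists of \<open>p\<close> and a contained line on \<open>r\<close>. The other lines on \<open>r\<close> are then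
  tangents.
\<close>

lemma no_tangent_on_secant_plane:
  assumes p: "p \<in> N" "p \<noteq> 0" and r: "r \<in> N" "r \<noteq> 0" and sec: "p + r \<notin> N"
    and big: "q > 2" "e = 1 \<or> n \<ge> 2" and none: "\<And>s. x + s *s r \<notin> tangent p"
  shows "x + s *s p \<in> tangent r"
proof -
  have uniq: "\<exists>!t. x + s *s r + t *s p \<in> N" for s
    using none[of s] by (simp add: tangent_def hits_eq_1_iff)
  have x: "x \<notin> vec.span {r, p}"
  proof
    assume "x \<in> vec.span {r, p}"
    then obtain b c where "x = b *s r + c *s p" unfolding in_span_pair by blast
    then have "x + (- b) *s r = c *s p" by simp
    moreover have "c *s p \<in> tangent p" using hits_multiple[OF p(1)] q_ge_2 by (simp add: tangent_def)
    ultimately show False using none[of "- b"] by simp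
  qed
  have rp: "r \<notin> vec.span {p}"
  proof
    assume "r \<in> vec.span {p}"
    then obtain c where "r = c *s p" by (auto simp: in_span_singleton)
    then have "p + r = (1 + c) *s p" by (simp add: vec.scale_left_distrib)
    then show False using sec scale[OF p(1)] by simp
  qed
  define E where "E = vec.span {x, r, p}"
  have E_iff: "y \<in> E \<longleftrightarrow> (\<exists>a b c. y = a *s x + b *s r + c *s p)" for y
  proof
    assume "y \<in> E"
    then obtain a where "y - a *s x \<in> vec.span {r, p}" unfolding E_def using vec.span_breakdown_eq by blast
    then obtain b c where "y - a *s x = b *s r + c *s p" unfolding in_span_pair by blast
    then have "y = a *s x + b *s r + c *s p" by (simp add: algebra_simps)
    then show "\<exists>a b c. y = a *s x + b *s r + c *s p" by blast
  next
    assume "\<exists>a b c. y = a *s x + b *s r + c *s p"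
    moreover have "x \<in> E" "r \<in> E" "p \<in> E" unfolding E_def by (rule vec.span_base, simp)+
    ultimately show "y \<in> E"
      unfolding E_def by (auto simp del: vec.span_insert intro!: vec.span_add vec.span_scale)
  qed
  have E: "vec.subspace E" unfolding E_def by (rule vec.subspace_span)
  have hits1: "hits p y = 1" if y: "y \<in> E" "y \<notin> vec.span {p}" for y
  proof -
    obtain a b c where y': "y = (a *s x + b *s r) + c *s p" using y unfolding E_iff by blast
    have "hits p y = hits p (a *s x + b *s r)" unfolding y' by (rule hits_shift)
    also have "\<dots> = 1"
    proof (cases "a = 0")
      case True
      then have "b \<noteq> 0" using y y' by (auto simp: in_span_singleton)
      have "r \<notin> tangent p" using in_tangent_iff[OF p(1) r(1)] sec by simp
      then show ?thesis using True hits_scale[OF \<open>b \<noteq> 0\<close>] by (simp add: tangent_def)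
    next
      case False
      then have "a *s x + b *s r = a *s (x + (b / a) *s r)" by (simp add: vec.scale_right_distrib)
      then show ?thesis using none[of "b / a"] hits_scale[OF False] by (simp add: tangent_def)
    qed
    finally show ?thesis .
  qed
  have "\<exists>s1 s2 t. s1 \<noteq> s2 \<and> x + s1 *s r + t *s p \<in> N \<and> x + s2 *s r + t *s p \<in> N"
  proof (rule ccontr)
    assume neg: "\<not> ?thesis"
    have inj: "s1 = s2" if "x + s1 *s r + t *s p \<in> N" "x + s2 *s r + t *s p \<in> N" for s1 s2 t
      using that neg by blast
    have "hyperoval_plane N n q Q e E"
    proof (intro hyperoval_plane.intro[OF tallini_cone_axioms] hyperoval_plane_axioms.intro E)
      have "card (vec.span {x, r, p}) = CARD('a) * card (vec.span {r, p})" by (rule card_span_insert[OF x])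
      moreover have "card (vec.span {r, p}) = CARD('a) * card (vec.span {p})" by (rule card_span_insert[OF rp])
      ultimately show cE: "icard E = q ^ 3"
        using size_span_singleton[OF p(2)] by (simp add: E_def q_def power3_eq_cube del: vec.span_insert)
      show "q > 2" by (rule big(1))
      have pE: "p \<in> E" unfolding E_def by (rule vec.span_base) simp
      have "(\<Sum>y\<in>E - vec.span {p}. hits p y) = (\<Sum>y\<in>E - vec.span {p}. 1)"
        by (rule sum.cong[OF refl]) (use hits1 in auto)
      then have "q * icard (N \<inter> E) = q ^ 3 - q + q * q"
        using sum_hits_off_line[OF E pE p] cE by simp
      then have "q * icard (N \<inter> E) = q * (q\<^sup>2 + q - 1)"
        by (simp add: algebra_simps power2_eq_square power3_eq_cube)
      then show "icard (N \<inter> E) = q\<^sup>2 + q - 1" using q_ge_2 by simp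
    next
      fix u v assume u: "u \<in> N \<inter> E" and v: "v \<in> N \<inter> E" and uv: "u + v \<in> N" and u0: "u \<noteq> 0"
      obtain a1 b1 c1 where ue: "u = a1 *s x + b1 *s r + c1 *s p" using u E_iff by blast
      obtain a2 b2 c2 where ve: "v = a2 *s x + b2 *s r + c2 *s p" using v E_iff by blast
      have uN: "u \<in> N" and vN: "v \<in> N" using u v by auto
      \<comment> \<open>A contained line with a point \<open>w\<close> off the line \<open>pr\<close> would meet \<open>pr\<close> in \<open>p\<close> or in \<open>r\<close>.\<close>
      have contra: False
        if w: "w = x + b *s r + c *s p" and z: "z = b' *s r + c' *s p" "z \<noteq> 0" "z \<in> N" "w \<in> N" "w + z \<in> N"
        for w z b c b' c'
      proof -
        have "b' = 0 \<or> c' = 0" using secant_combination[OF p(1) r(1) sec] z by blast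
        then show False
        proof
          assume b': "b' = 0"
          then have "w + z = x + b *s r + (c + c') *s p" by (simp add: w z(1) vec.scale_left_distrib)
          then have "c + c' = c" using uniq[of b] w z(4,5) by metis
          then show False using z(1,2) b' by simp
        next
          assume c': "c' = 0"
          then have "w + z = x + (b + b') *s r + c *s p" by (simp add: w z(1) vec.scale_left_distrib)
          then have "x + (b + b') *s r + c *s p \<in> N" using z(5) by (simp only:)
          then have "b + b' = b" by (rule inj) (use w z(4) in simp)
          then show False using z(1,2) c' by simp
        qed
      qed
      show "v \<in> vec.span {u}"
      proof (rule ccontr)
        assume nv: "v \<notin> vec.span {u}"
        consider "a1 \<noteq> 0" | "a1 = 0" "a2 \<noteq> 0" | "a1 = 0" "a2 = 0" by blast
        then show False
        proof cases
          case 1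
          let ?w = "(1 / a1) *s u" and ?z = "v - (a2 / a1) *s u"
          have "?z \<noteq> 0" using nv unfolding in_span_singleton by auto
          moreover have "(1 / a1 - a2 / a1) *s u + 1 *s v \<in> N" "(- (a2 / a1)) *s u + 1 *s v \<in> N"
            by (rule line[OF uN vN uv])+
          moreover have "?w = x + (b1 / a1) *s r + (c1 / a1) *s p"
            using 1 by (simp add: ue vec.scale_right_distrib)
          moreover have "?z = (b2 - a2 * b1 / a1) *s r + (c2 - a2 * c1 / a1) *s p"
            using 1 by (simp add: ue ve vec.scale_right_distrib vec.scale_left_diff_distrib)
          moreover have "?w + ?z = (1 / a1 - a2 / a1) *s u + 1 *s v" "?z = (- (a2 / a1)) *s u + 1 *s v"
            by (simp_all add: vec.scale_left_diff_distrib)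
          ultimately show False using contra[of ?w _ _ ?z] scale[OF uN] by metis
        next
          case 2
          let ?w = "(1 / a2) *s v"
          have "1 *s u + (1 / a2) *s v \<in> N" by (rule line[OF uN vN uv])
          then have "?w + u \<in> N" by (simp add: add.commute)
          moreover have "?w = x + (b2 / a2) *s r + (c2 / a2) *s p"
            using 2 by (simp add: ve vec.scale_right_distrib)
          moreover have "u = b1 *s r + c1 *s p" using 2 by (simp add: ue)
          ultimately show False using contra[of ?w _ _ u] scale[OF vN] u0 uN by blast
        next
          case 3
          have eqs: "u = b1 *s r + c1 *s p" "v = b2 *s r + c2 *s p" using 3 by (simp_all add: ue ve)
          have "u + v = (b1 + b2) *s r + (c1 + c2) *s p" by (simp add: eqs vec.scale_left_distrib)
          then have "b1 + b2 = 0 \<or> c1 + c2 = 0" "b1 = 0 \<or> c1 = 0" "b2 = 0 \<or> c2 = 0"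
            using secant_combination[OF p(1) r(1) sec] uN vN uv eqs by metis+
          moreover have "b1 \<noteq> 0 \<or> c1 \<noteq> 0" using u0 eqs by auto
          ultimately have cases: "b1 = 0 \<and> b2 = 0 \<or> c1 = 0 \<and> c2 = 0" by auto
          have same: False if "u = c *s y" "v = d *s y" for c d y
          proof -
            have "c \<noteq> 0" using that u0 by auto
            then have "v = (d / c) *s u" using that by simp
            then show False using nv unfolding in_span_singleton by blast
          qed
          show False using cases same[of c1 p c2] same[of b1 r b2] eqs by auto
        qed
      qed
    qed
    then show False using hyperoval_plane.no_hyperoval_plane big(2) by blast
  qed
  then obtain s1 s2 t where s12: "s1 \<noteq> s2" "x + s1 *s r + t *s p \<in> N" "x + s2 *s r + t *s p \<in> N"
    by blast
  have all: "x + a *s r + t *s p \<in> N" for a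
    using two_hits_imp_all[OF r(1), of "x + t *s p" s1 s2 a] s12 by (simp add: add_ac)
  have "hits r (x + s *s p) \<noteq> 1"
  proof (cases "s = t")
    case True
    have "hits r (x + t *s p) = q" unfolding hits_eq_q_iff using all by (simp add: add_ac)
    then show ?thesis using q_ge_2 True by simp
  next
    case False
    have "x + s *s p + a *s r \<notin> N" for a
      using uniq[of a] all[of a] False by (auto simp: add_ac)
    then have "hits r (x + s *s p) = 0" unfolding hits_eq_0_iff by blast
    then show ?thesis by simp
  qed
  then show ?thesis by (simp add: tangent_def)
qed

text \<open>
  By the size of \<open>tangent p\<close>, the planes on the secant \<open>pr\<close> contain one tangent or contained line on \<open>p\<close> on
  average, and the same holds for \<open>r\<close>. None of them contains fewer than two such lines on \<open>p\<close> and \<open>r\<close>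
  together, so each contains exactly one on \<open>p\<close>.
\<close>

lemma one_tangent_on_secant_plane:
  assumes p: "p \<in> N" "p \<noteq> 0" and r: "r \<in> N" "r \<noteq> 0" and sec: "p + r \<notin> N"
    and big: "q > 2" "e = 1 \<or> n \<ge> 2"
  shows "icard {s. x + s *s r \<in> tangent p} = 1"
proof -
  let ?f = "\<lambda>x. icard {s. x + s *s r \<in> tangent p}" and ?g = "\<lambda>x. icard {s. x + s *s p \<in> tangent r}"
  have sec': "r + p \<notin> N" using sec by (simp add: add.commute)
  have f0: "?g x = q" if "?f x = 0" for x
  proof -
    have "x + s *s r \<notin> tangent p" for s using that by auto
    then have "{s. x + s *s p \<in> tangent r} = UNIV"
      using no_tangent_on_secant_plane[OF p r sec big] by blast
    then show ?thesis by (simp add: q_def)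
  qed
  have g0: "?f x = q" if "?g x = 0" for x
  proof -
    have "x + s *s p \<notin> tangent r" for s using that by auto
    then have "{s. x + s *s r \<in> tangent p} = UNIV"
      using no_tangent_on_secant_plane[OF r p sec' big] by blast
    then show ?thesis by (simp add: q_def)
  qed
  have ge: "?f x + ?g x - 2 \<ge> 0" for x
    using f0[of x] g0[of x] big(1) by linarith
  have "(\<Sum>x\<in>UNIV. ?f x + ?g x - 2) = 0"
  proof -
    have "(\<Sum>x\<in>UNIV. ?f x) = icard (UNIV :: ('a ^ 'm) set)" "(\<Sum>x\<in>UNIV. ?g x) = icard (UNIV :: ('a ^ 'm) set)"
      unfolding sum_translates size_tangent[OF p] size_tangent[OF r] size_UNIV
      by (simp_all add: power2_eq_square)
    then show ?thesis by (simp add: sum.distrib sum_subtractf del: CARD_vec)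
  qed
  then have "\<forall>x\<in>UNIV. ?f x + ?g x - 2 = 0"
    using ge by (subst (asm) sum_nonneg_eq_0_iff) auto
  then have "?f x + ?g x = 2" by auto
  then show ?thesis using f0[of x] g0[of x] big(1) by linarith
qed

lemma tangent_subspaceI:
  assumes p: "p \<in> N"
    and add: "\<And>x y. x \<in> tangent p \<Longrightarrow> y \<in> tangent p \<Longrightarrow> x + y \<in> tangent p"
  shows "vec.subspace (tangent p)"
proof -
  have "0 \<in> tangent p" using hits_multiple[OF p, of 0] q_ge_2 by (simp add: tangent_def)
  then show ?thesis using add tangent_scale[OF p] by (simp add: vec.subspace_def)
qed

text \<open>
  If \<open>x\<close> and \<open>y\<close> are in \<open>tangent p\<close>, but \<open>x + y\<close> is not, then the line of \<open>p\<close> and \<open>x + y\<close> is a secant \<open>pr\<close>,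
  and the plane of \<open>p\<close>, \<open>x\<close>, \<open>y\<close> contradicts the preceding lemma.
\<close>

lemma tangent_subspace_general:
  assumes p: "p \<in> N" "p \<noteq> 0" and big: "q > 2" "e = 1 \<or> n \<ge> 2"
  shows "vec.subspace (tangent p)"
proof (rule tangent_subspaceI[OF p(1)], rule ccontr)
  fix x y assume x: "x \<in> tangent p" and y: "y \<in> tangent p" and neg: "x + y \<notin> tangent p"
  then obtain t where t: "x + y + t *s p \<in> N" unfolding tangent_def by (auto simp: hits_eq_1_iff)
  define r where "r = x + y + t *s p"
  have rN: "r \<in> N" using t by (simp add: r_def)
  have nr: "r \<notin> tangent p" unfolding r_def tangent_shift by (rule neg)
  have r0: "r \<noteq> 0" using nr tangent_scale[OF p(1) x, of 0] by auto
  have sec: "p + r \<notin> N" using in_tangent_iff[OF p(1) rN] nr by simp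
  \<comment> \<open>The secant \<open>pr\<close> and \<open>x\<close> span a plane with the two lines \<open>px\<close> and \<open>py\<close> on \<open>p\<close>.\<close>
  have "x + (-1) *s r = (-1) *s y + (- t) *s p" by (simp add: r_def)
  moreover have "(-1) *s y + (- t) *s p \<in> tangent p" unfolding tangent_shift by (rule tangent_scale[OF p(1) y])
  ultimately have "{0, -1} \<subseteq> {s. x + s *s r \<in> tangent p}" using x by simp
  then have "card {0, -1 :: 'a} \<le> card {s. x + s *s r \<in> tangent p}" by (intro card_mono) auto
  then show False using one_tangent_on_secant_plane[OF p(1,2) rN r0 sec big, of x] by simp
qed

text \<open>
  In the hyperbolic case of projective 3-space, there are two contained lines on \<open>p\<close>. Their plane has
  no room for further points of \<open>N\<close>.
\<close>

lemma tangent_subspace_hyperbolic_solid: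
  assumes p: "p \<in> N" "p \<noteq> 0" and n1: "n = 1" and e1: "e = 1"
  shows "vec.subspace (tangent p)"
proof -
  have Qq: "Q = q" using n1 by (simp add: Q_def)
  have cA: "icard (adj p) = 2 * q\<^sup>2 - q" using size_adj[OF p] by (simp add: e1 Qq power2_eq_square algebra_simps)
  have qq: "q < q\<^sup>2" "0 < q\<^sup>2" using q_ge_2 by (simp_all add: power2_eq_square)
  have "icard (vec.span {p}) < icard (adj p)" using cA size_span_singleton[OF p(2)] qq by simp
  then have "\<not> adj p \<subseteq> vec.span {p}" using card_mono[of "vec.span {p}" "adj p"] by auto
  then obtain a where a: "a \<in> adj p" "a \<notin> vec.span {p}" by blast
  have cpa: "icard (vec.span {p, a}) = q\<^sup>2" by (rule size_span_pair[OF p(2) a(2)])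
  then have "icard (vec.span {p, a}) < icard (adj p)" using cA qq by simp
  then have "\<not> adj p \<subseteq> vec.span {p, a}" using card_mono[of "vec.span {p, a}" "adj p"] by auto
  then obtain b where b: "b \<in> adj p" "b \<notin> vec.span {p, a}" by blast
  have bp: "b \<notin> vec.span {p}" using b(2) vec.span_mono[of "{p}" "{p, a}"] by auto
  have cpb: "icard (vec.span {p, b}) = q\<^sup>2" by (rule size_span_pair[OF p(2) bp])
  define E where "E = vec.span {b, p, a}"
  have cE: "icard E = q ^ 3"
    using card_span_insert[OF b(2)] cpa by (simp add: E_def q_def power2_eq_square power3_eq_cube del: vec.span_insert)
  have E: "vec.subspace E" unfolding E_def by (rule vec.subspace_span)
  have "q * icard E = q * q ^ 3" using cE by simp
  then have "CARD('a) * card E = CARD('a) ^ CARD('m)"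
    using dim n1 by (simp add: q_def power3_eq_cube numeral_eq_Suc flip: of_nat_mult)
  then obtain f where f: "f \<noteq> 0" "E = hyperplane f" using exists_normal[OF E] by blast
  let ?U = "vec.span {p, a} \<union> vec.span {p, b}"
  have UN: "?U \<subseteq> N \<inter> E"
  proof -
    have "vec.span {p, a} \<subseteq> N" "vec.span {p, b} \<subseteq> N"
      using adj_combination[OF p(1)] a(1) b(1) unfolding subset_iff in_span_pair by blast+
    moreover have "vec.span {p, a} \<subseteq> E" unfolding E_def by (rule vec.span_mono) simp
    moreover have "vec.span {p, b} \<subseteq> E" unfolding E_def by (rule vec.span_mono) simp
    ultimately show ?thesis by blast
  qed
  have "vec.span {p, a} \<inter> vec.span {p, b} \<subseteq> vec.span {p}"
  proof
    fix x assume "x \<in> vec.span {p, a} \<inter> vec.span {p, b}"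
    then obtain c d c' d' where x: "x = c *s p + d *s a" "x = c' *s p + d' *s b" unfolding Int_iff in_span_pair by blast
    have "d' = 0"
    proof (rule ccontr)
      assume d': "d' \<noteq> 0"
      have "d' *s b = (c - c') *s p + d *s a" using x by (simp add: vec.scale_left_diff_distrib algebra_simps)
      then have "(1 / d') *s (d' *s b) = ((c - c') / d') *s p + (d / d') *s a"
        by (simp add: vec.scale_right_distrib)
      then have "b = ((c - c') / d') *s p + (d / d') *s a" using d' by simp
      then show False using b(2) unfolding in_span_pair by blast
    qed
    then show "x \<in> vec.span {p}" using x(2) by (auto simp: in_span_singleton)
  qed
  then have "card (vec.span {p, a} \<inter> vec.span {p, b}) \<le> card (vec.span {p})" by (intro card_mono) auto
  then have cU: "icard ?U \<ge> 2 * q\<^sup>2 - q"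
    using card_Un_Int[of "vec.span {p, a}" "vec.span {p, b}"] cpa cpb size_span_singleton[OF p(2)]
    by (simp del: vec.span_insert)
  moreover have cNE: "icard (N \<inter> E) \<le> 2 * q\<^sup>2 - q"
    using section_size[OF f(1)] f(2) qq by (auto simp: e1 Qq power2_eq_square algebra_simps)
  ultimately have U_eq: "?U = N \<inter> E"
    using UN card_mono[OF _ UN] by (intro card_subset_eq) (auto simp del: vec.span_insert)
  have "E \<subseteq> tangent p"
  proof
    fix y assume y: "y \<in> E"
    show "y \<in> tangent p"
    proof (rule ccontr)
      assume "y \<notin> tangent p"
      then have h: "hits p y = 1" by (simp add: tangent_def)
      then obtain t where t: "y + t *s p \<in> N" unfolding hits_eq_1_iff by blast
      have pE: "p \<in> E" unfolding E_def by (rule vec.span_base) simp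
      have shiftE: "y + s *s p \<in> E" for s using y pE E by (intro vec.subspace_add vec.subspace_scale)
      have "y + t *s p \<in> ?U" unfolding U_eq using t shiftE by blast
      then obtain c where "y + t *s p \<in> vec.span {p, c}" "vec.span {p, c} \<subseteq> N" using UN by blast
      moreover have "p \<in> vec.span {p, c}" for c :: "'a ^ 'm" by (rule vec.span_base) simp
      ultimately have "(y + t *s p) + (s - t) *s p \<in> N" for s by (blast intro: vec.span_add vec.span_scale)
      then have "y + s *s p \<in> N" for s by (simp add: vec.scale_left_diff_distrib)
      then have "hits p y = q" unfolding hits_eq_q_iff by blast
      then show False using h q_ge_2 by simp
    qed
  qed
  moreover have "icard (tangent p) = icard E"
    using size_tangent[OF p] cE Qq by (simp add: power2_eq_square power3_eq_cube)
  ultimately have "E = tangent p" by (intro card_subset_eq) auto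
  then show ?thesis using E by simp
qed

end

section \<open>Recognizing quadratic forms\<close>

lemma quadratic_form_add:
  assumes "quadratic_form F" "quadratic_form G"
  shows "quadratic_form (\<lambda>x. F x + G x)"
proof -
  obtain c where c: "\<forall>x. F x = (\<Sum>i\<in>UNIV. \<Sum>j\<in>UNIV. c i j * x $ i * x $ j)"
    using assms(1) by (auto simp: quadratic_form_def)
  obtain d where d: "\<forall>x. G x = (\<Sum>i\<in>UNIV. \<Sum>j\<in>UNIV. d i j * x $ i * x $ j)"
    using assms(2) by (auto simp: quadratic_form_def)
  have "\<forall>x. F x + G x = (\<Sum>i\<in>UNIV. \<Sum>j\<in>UNIV. (c i j + d i j) * x $ i * x $ j)"
    by (simp add: c d distrib_right sum.distrib)
  then show ?thesis unfolding quadratic_form_def by (intro exI[of _ "\<lambda>i j. c i j + d i j"]) simp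
qed

lemma quadratic_form_mult: "quadratic_form (\<lambda>x. dot a x * dot b x)"
proof -
  have "dot a x * dot b x = (\<Sum>i\<in>UNIV. \<Sum>j\<in>UNIV. (a $ i * b $ j) * x $ i * x $ j)" for x
    unfolding dot_def sum_product by (intro sum.cong refl) (simp add: mult_ac)
  then show ?thesis unfolding quadratic_form_def by (intro exI[of _ "\<lambda>i j. a $ i * b $ j"]) simp
qed

lemma polar_form_commute: "polar_form F x y = polar_form F y x"
  by (simp add: polar_form_def add.commute)

text \<open>Coordinates are added one at a time; each contributes a product of two linear functionals.\<close>

lemma quadratic_formI:
  fixes F :: "'a::field ^ 'm::finite \<Rightarrow> 'a"
  assumes polar: "\<And>y. \<exists>h. \<forall>x. polar_form F x y = dot h x"
    and hom: "\<And>c x. F (c *s x) = c\<^sup>2 * F x"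
  shows "quadratic_form F"
proof -
  let ?e = "\<lambda>i::'m. axis i (1::'a)"
  have F0: "F 0 = 0" using hom[of 0 0] by simp
  have "quadratic_form (\<lambda>x. F (\<Sum>i\<in>J. (x $ i) *s ?e i))" for J :: "'m set"
  proof (induction J rule: infinite_finite_induct)
    case empty
    have "quadratic_form (\<lambda>x::'a ^ 'm. dot 0 x * dot 0 x)" by (rule quadratic_form_mult)
    then show ?case by (simp add: F0)
  next
    case (insert k J)
    define y where "y x = (\<Sum>i\<in>J. (x $ i) *s ?e i)" for x :: "'a ^ 'm"
    obtain h where h: "\<forall>x. polar_form F x (?e k) = dot h x" using polar by blast
    define g :: "'a ^ 'm" where "g = (\<chi> i. if i \<in> J then h $ i else 0)"
    have hy: "dot h (y x) = dot g x" for x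
    proof -
      have "dot h (y x) = (\<Sum>i\<in>J. dot h ((x $ i) *s ?e i))"
        unfolding y_def by (induction J rule: infinite_finite_induct) simp_all
      also have "\<dots> = (\<Sum>i\<in>J. x $ i * h $ i)" by (simp add: dot_axis)
      also have "\<dots> = (\<Sum>i\<in>J. g $ i * x $ i)" by (rule sum.cong) (simp_all add: g_def mult.commute)
      also have "\<dots> = dot g x" unfolding dot_def by (rule sum.mono_neutral_left) (auto simp: g_def)
      finally show ?thesis .
    qed
    have step: "F (\<Sum>i\<in>insert k J. (x $ i) *s ?e i) =
        F (y x) + (dot (F (?e k) *s ?e k + g) x * dot (?e k) x)" for x
    proof -
      obtain h' where h': "\<forall>z. polar_form F z (y x) = dot h' z" using polar by blast
      have "F (y x + (x $ k) *s ?e k) = F (y x) + F ((x $ k) *s ?e k) + polar_form F ((x $ k) *s ?e k) (y x)"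
        by (simp add: polar_form_def add.commute)
      also have "polar_form F ((x $ k) *s ?e k) (y x) = x $ k * polar_form F (?e k) (y x)"
        using h' by simp
      also have "polar_form F (?e k) (y x) = dot g x"
        using h hy by (simp add: polar_form_commute[of F "?e k"])
      finally show ?thesis using insert.hyps
        by (simp add: hom y_def add.commute algebra_simps power2_eq_square dot_commute[of "?e k"] dot_axis)
    qed
    show ?case unfolding step
      by (rule quadratic_form_add[OF _ quadratic_form_mult]) (use insert.IH in \<open>simp add: y_def\<close>)
  qed simp
  from this[of UNIV] show ?thesis by (simp add: basis_expansion)
qed

text \<open>
  The algebraic core: a function that is affine along the lines with a direction in
  a spanning set \<open>S\<close> is a quadratic form if the slopes vanish on hyperplanes. Indeed the difference
  \<open>F (w + u) - F w\<close> is itself affine along \<open>S\<close>. Its slope in a direction off the hyperplane of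
  zeros has no zero; an affine function of one variable without zeros is constant, so this slope is
  constant and the difference is linear in \<open>w\<close>.
\<close>

locale affine_along =
  fixes W S :: "('a::field ^ 'm::finite) set" and F :: "'a ^ 'm \<Rightarrow> 'a"
  assumes W: "vec.subspace W" and SW: "S \<subseteq> W" and span: "W \<subseteq> vec.span S"
    and S_scale: "\<And>u c. u \<in> S \<Longrightarrow> c *s u \<in> S"
    and F_S: "\<And>u. u \<in> S \<Longrightarrow> F u = 0" and F_0: "F 0 = 0"
    and affine: "\<And>w u. w \<in> W \<Longrightarrow> u \<in> S \<Longrightarrow> \<exists>k. \<forall>t. F (w + t *s u) = F w + t * k"
    and slope_zero: "\<And>u. u \<in> S \<Longrightarrow> \<exists>g. \<forall>w\<in>W. F (w + u) = F w \<longleftrightarrow> dot g w = 0"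
begin

lemma W_add: "x \<in> W \<Longrightarrow> y \<in> W \<Longrightarrow> x + c *s y \<in> W"
  using W by (intro vec.subspace_add vec.subspace_scale)

lemma W_add1: "x \<in> W \<Longrightarrow> y \<in> W \<Longrightarrow> x + y \<in> W"
  using W by (rule vec.subspace_add)

lemma W_induct [consumes 1, case_names zero step]:
  assumes "w \<in> W" "P 0" "\<And>u y. u \<in> S \<Longrightarrow> y \<in> W \<Longrightarrow> P y \<Longrightarrow> P (y + u)"
  shows "P w"
proof -
  have "w \<in> vec.span S" using assms(1) span by blast
  then have "w \<in> W \<and> P w"
  proof (induction rule: vec.span_induct_alt)
    case base
    then show ?case using assms(2) vec.subspace_0[OF W] by simp
  next
    case (step c x y)
    then have "c *s x \<in> S" "y \<in> W" "P y" by (auto intro: S_scale)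
    then show ?case using assms(3)[of "c *s x" y] W_add1[of y "c *s x"] SW by (auto simp: add.commute)
  qed
  then show ?thesis by simp
qed

lemma difference_linear:
  assumes u: "u \<in> S"
  shows "\<exists>h. \<forall>w\<in>W. F (w + u) - F w = dot h w"
proof -
  define D where "D w = F (w + u) - F w" for w
  have uW: "u \<in> W" using u SW by blast
  obtain g where g: "\<forall>w\<in>W. F (w + u) = F w \<longleftrightarrow> dot g w = 0" using slope_zero[OF u] by blast
  then have D0: "D w = 0 \<longleftrightarrow> dot g w = 0" if "w \<in> W" for w using that by (simp add: D_def)
  show ?thesis
  proof (cases "\<forall>x\<in>S. dot g x = 0")
    case True
    have "dot g w = 0" if "w \<in> W" for w using that
      by (induction rule: W_induct) (use True in simp_all)
    then show ?thesis using D0 by (intro exI[of _ 0]) (simp add: D_def)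
  next
    case False
    then obtain v where v: "v \<in> S" "dot g v \<noteq> 0" by blast
    have vW: "v \<in> W" using v SW by blast
    have affD: "\<exists>k. \<forall>t. D (w + t *s x) = D w + t * k" if w: "w \<in> W" and x: "x \<in> S" for w x
    proof -
      obtain k where k: "\<forall>t. F (w + t *s x) = F w + t * k" using affine[OF w x] by blast
      obtain l where l: "\<forall>t. F ((w + u) + t *s x) = F (w + u) + t * l"
        using affine[OF W_add1[OF w uW] x] by blast
      have "D (w + t *s x) = D w + t * (l - k)" for t
      proof -
        have "w + t *s x + u = (w + u) + t *s x" by (simp add: add_ac)
        then show ?thesis using k l by (simp add: D_def algebra_simps)
      qed
      then show ?thesis by blast
    qed
    define C where "C w = D (w + v) - D w" for w
    have slope: "D (w + t *s v) = D w + t * C w" if w: "w \<in> W" for w t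
    proof -
      obtain k where k: "\<forall>t. D (w + t *s v) = D w + t * k" using affD[OF w v(1)] by blast
      then have "D (w + 1 *s v) = D w + 1 * k" by blast
      then show ?thesis using k by (simp add: C_def)
    qed
    have C_nz: "C w \<noteq> 0" if w: "w \<in> W" for w
    proof
      assume "C w = 0"
      then have const: "D (w + t *s v) = D w" for t using slope[OF w] by simp
      define t where "t = - dot g w / dot g v"
      have "dot g (w + t *s v) = 0" using v(2) by (simp add: t_def)
      moreover have "dot g (w + (t + 1) *s v) = dot g v" using v(2) by (simp add: t_def field_simps)
      ultimately have "dot g (w + t *s v) = 0" "dot g (w + (t + 1) *s v) \<noteq> 0" using v(2) by simp_all
      then show False using D0 W_add[OF w vW] const by metis
    qed
    have C_const: "C (w + x) = C w" if w: "w \<in> W" and x: "x \<in> S" for w x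
    proof -
      obtain k where k: "\<forall>t. D (w + t *s x) = D w + t * k" using affD[OF w x] by blast
      obtain l where l: "\<forall>t. D ((w + v) + t *s x) = D (w + v) + t * l"
        using affD[OF W_add1[OF w vW] x] by blast
      have aff: "C (w + t *s x) = C w + t * (l - k)" for t
      proof -
        have "w + t *s x + v = (w + v) + t *s x" by (simp add: add_ac)
        then show ?thesis using k l by (simp add: C_def algebra_simps)
      qed
      have "l - k = 0"
      proof (rule ccontr)
        assume "l - k \<noteq> 0"
        then have "C (w + (- C w / (l - k)) *s x) = 0" unfolding aff by simp
        then show False using C_nz W_add[OF w] x SW by blast
      qed
      then show ?thesis using aff[of 1] by simp
    qed
    have C: "C w = C 0" if "w \<in> W" for w using that
      by (induction rule: W_induct) (simp_all add: C_const)
    have "D w = dot ((C 0 / dot g v) *s g) w" if w: "w \<in> W" for w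
    proof -
      define t where "t = dot g w / dot g v"
      define w0 where "w0 = w + (- t) *s v"
      have w0: "w0 \<in> W" unfolding w0_def by (rule W_add[OF w vW])
      have "dot g w0 = 0" using v(2) by (simp add: w0_def t_def)
      then have "D w0 = 0" using D0[OF w0] by simp
      moreover have "w = w0 + t *s v" by (simp add: w0_def)
      ultimately have "D w = t * C 0" using slope[OF w0, of t] C[OF w0] by simp
      then show ?thesis by (simp add: t_def)
    qed
    then show ?thesis unfolding D_def by blast
  qed
qed

lemma polar_linear:
  assumes "y \<in> W"
  shows "\<exists>h. \<forall>w\<in>W. polar_form F w y = dot h w"
  using assms
proof (induction rule: W_induct)
  case zero
  then show ?case by (intro exI[of _ 0]) (simp add: polar_form_def F_0)
next
  case (step u y)
  obtain h where h: "\<forall>w\<in>W. polar_form F w y = dot h w" using step by blast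
  obtain g where g: "\<forall>w\<in>W. F (w + u) - F w = dot g w" using difference_linear[OF step(1)] by blast
  have "polar_form F w (y + u) = dot (h + g) w" if w: "w \<in> W" for w
  proof -
    have "F (w + (y + u)) - F (w + y) = dot g (w + y)"
      using g[rule_format, OF W_add1[OF w step(2)]] by (simp only: add.assoc)
    moreover have "F (y + u) - F y = dot g y" using g step(2) by simp
    moreover have "F (w + y) - F w - F y = dot h w" using h w by (simp add: polar_form_def)
    ultimately show ?thesis by (simp add: polar_form_def algebra_simps)
  qed
  then show ?case by blast
qed

lemma homogeneous:
  assumes "w \<in> W"
  shows "F (c *s w) = c\<^sup>2 * F w"
  using assms
proof (induction rule: W_induct)
  case (step u y)
  have uW: "u \<in> W" using step SW by blast
  have cW: "c *s u \<in> W" "c *s y \<in> W" using W uW step by (auto intro: vec.subspace_scale)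
  obtain h where h: "\<forall>w\<in>W. polar_form F w u = dot h w" using polar_linear[OF uW] by blast
  obtain h' where h': "\<forall>w\<in>W. polar_form F w (c *s y) = dot h' w" using polar_linear[OF cW(2)] by blast
  have "polar_form F (c *s u) (c *s y) = c * polar_form F u (c *s y)"
    using h' cW(1) uW by simp
  also have "polar_form F u (c *s y) = c * polar_form F u y"
    using h cW(2) step by (simp add: polar_form_commute[of F u])
  finally have "F (c *s u + c *s y) = F (c *s u) + F (c *s y) + c * (c * polar_form F u y)"
    by (simp add: polar_form_def algebra_simps)
  moreover have "F (u + y) = F u + F y + polar_form F u y" by (simp add: polar_form_def)
  moreover have "F (c *s u) = 0" "F u = 0" using step F_S S_scale by auto
  ultimately show ?case
    using step by (simp add: vec.scale_right_distrib add.commute power2_eq_square algebra_simps)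
qed (simp add: F_0)

end

section \<open>The quadratic form of the cone\<close>

text \<open>
  The second assumption excludes the ovoids, which have tangent planes without being
  quadrics in general: there, \<open>N\<close> has no contained lines that could determine the form.
\<close>

locale quadratic_cone = tallini_cone N n q Q e
  for N :: "('a::{field,finite} ^ 'm::finite) set" and n q Q e +
  assumes tangent_subspace: "\<And>p. p \<in> N \<Longrightarrow> p \<noteq> 0 \<Longrightarrow> vec.subspace (tangent p)"
    and not_elliptic_solid: "n = 1 \<Longrightarrow> e = 1"
begin

lemma tangent_normal:
  assumes p: "p \<in> N" "p \<noteq> 0"
  obtains f where "f \<noteq> 0" "tangent p = hyperplane f"
proof -
  have "q * icard (tangent p) = int (CARD('a) ^ CARD('m))"
    using size_tangent[OF p] size_UNIV by (simp add: power2_eq_square card_vectors)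
  then have "CARD('a) * card (tangent p) = CARD('a) ^ CARD('m)"
    unfolding q_def by (simp only: of_nat_mult[symmetric] of_nat_eq_iff)
  then show ?thesis using exists_normal[OF tangent_subspace[OF p]] that by blast
qed

lemma exists_secant:
  assumes p: "p \<in> N" "p \<noteq> 0"
  obtains r where "r \<in> N" "r \<noteq> 0" "r \<notin> tangent p"
proof -
  have "q\<^sup>2 * Q\<^sup>2 - q * Q\<^sup>2 = q * (q - 1) * Q\<^sup>2" by (simp add: power2_eq_square algebra_simps)
  also have "\<dots> > 0" using q_ge_2 Q_ge_q by simp
  finally have "{x. hits p x = 1} \<noteq> {}" using size_hits_1[OF p] by force
  then obtain x where x: "hits p x = 1" by blast
  then obtain t where t: "x + t *s p \<in> N" unfolding hits_eq_1_iff by blast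
  have nt: "x + t *s p \<notin> tangent p" unfolding tangent_shift using x by (simp add: tangent_def)
  moreover have "0 \<in> tangent p" by (rule vec.subspace_0[OF tangent_subspace[OF p]])
  ultimately have "x + t *s p \<noteq> 0" by metis
  then show ?thesis using that t nt by blast
qed

lemma in_N_shift_tangent:
  assumes p: "p \<in> N" and w: "w \<in> tangent p"
  shows "w + x *s p \<in> N \<longleftrightarrow> w \<in> N"
proof -
  have "w + s *s p \<in> N" if "w + t *s p \<in> N" for s t
  proof -
    have "hits p w \<noteq> 0" unfolding hits_eq_0_iff using that by blast
    then have "hits p w = q" using w hits_cases[OF p, of w] by (auto simp: tangent_def)
    then show ?thesis by (simp add: hits_eq_q_iff)
  qed
  from this[of x 0] this[of 0 x] show ?thesis by auto
qed

lemma self_tangent: "p \<in> N \<Longrightarrow> p \<in> tangent p"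
  using hits_multiple[of p 1] q_ge_2 by (simp add: tangent_def)

end

text \<open>
  Two points \<open>p\<close> and \<open>r\<close> of the cone on a secant, and the intersection \<open>W\<close> of their tangent
  hyperplanes. The points off \<open>tangent p\<close> have the form \<open>r + w - F w p\<close> with \<open>w\<close> in \<open>W\<close>, where
  the function \<open>F\<close> will turn out to be the restriction of the quadratic form to \<open>W\<close>.
\<close>

locale secant_pair = quadratic_cone N n q Q e
  for N :: "('a::{field,finite} ^ 'm::finite) set" and n q Q e +
  fixes p r a b :: "'a ^ 'm"
  assumes p: "p \<in> N" "p \<noteq> 0" and r: "r \<in> N" "r \<noteq> 0" "r \<notin> tangent p"
    and a: "tangent r = hyperplane a" "dot a p = 1" and b: "tangent p = hyperplane b" "dot b r = 1"
begin

definition W :: "('a ^ 'm) set" where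
  "W = tangent p \<inter> tangent r"

definition F :: "'a ^ 'm \<Rightarrow> 'a" where
  "F w = - (THE s. r + w + s *s p \<in> N)"

lemma p_r: "dot a r = 0" "dot b p = 0" "p \<notin> tangent r"
  using self_tangent[OF r(1)] self_tangent[OF p(1)] tangent_sym[OF p(1) r(1)] r(3)
  by (simp_all add: a(1) b(1) in_hyperplane_iff a(2) b(2))

lemma W_iff: "w \<in> W \<longleftrightarrow> dot a w = 0 \<and> dot b w = 0"
  by (auto simp: W_def a(1) b(1) in_hyperplane_iff)

lemma W_subspace: "vec.subspace W"
  by (auto simp: W_iff vec.subspace_def)

lemma F_iff:
  assumes w: "w \<in> W"
  shows "r + w + s *s p \<in> N \<longleftrightarrow> s = - F w"
proof -
  have "r + w \<notin> tangent p" using w b(2) by (simp add: b(1) in_hyperplane_iff W_iff)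
  then have ex: "\<exists>!s. r + w + s *s p \<in> N" by (simp add: tangent_def hits_eq_1_iff)
  have F: "- F w = (THE s. r + w + s *s p \<in> N)" by (simp add: F_def)
  have "r + w + (- F w) *s p \<in> N" unfolding F by (rule theI'[OF ex])
  then show ?thesis using ex by blast
qed

lemma F_zero_iff:
  assumes w: "w \<in> W"
  shows "F w = 0 \<longleftrightarrow> w \<in> N"
proof -
  have "F w = 0 \<longleftrightarrow> r + w \<in> N" using F_iff[OF w, of 0] by auto
  also have "\<dots> \<longleftrightarrow> w \<in> N"
    using in_N_shift_tangent[OF r(1), of w 1] w by (simp add: W_def add.commute)
  finally show ?thesis .
qed

lemma lift_in_N: "w \<in> W \<Longrightarrow> r + w + (- F w) *s p \<in> N"
  using F_iff[of w "- F w"] by blast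

text \<open>
  For a point \<open>v\<close> of \<open>N\<close> in \<open>W\<close>, the line \<open>pv\<close> is contained in \<open>N\<close>. It meets the tangent hyperplane of
  the point \<open>z\<close> over \<open>w\<close> in a point, which is joined to \<open>z\<close> by a contained line. So \<open>F\<close> is affine
  in direction \<open>v\<close>. The slope is zero iff \<open>v\<close> is in the tangent hyperplane of \<open>z\<close>, equivalently if \<open>z\<close> is
  in the tangent hyperplane of \<open>v\<close>, a linear condition on \<open>w\<close>.
\<close>

lemma F_affine:
  assumes w: "w \<in> W" and v: "v \<in> W" "v \<in> N" "v \<noteq> 0"
  shows "\<exists>k. (\<forall>t. F (w + t *s v) = F w + t * k) \<and> (k = 0 \<longleftrightarrow> r + w + (- F w) *s p \<in> tangent v)"
proof -
  define z where "z = r + w + (- F w) *s p"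
  have zN: "z \<in> N" unfolding z_def by (rule lift_in_N[OF w])
  have zp: "z \<notin> tangent p"
    using w b(2) p_r by (simp add: z_def b(1) in_hyperplane_iff W_iff)
  have z0: "z \<noteq> 0" using zp by (auto simp: b(1) in_hyperplane_iff)
  have pz: "p \<notin> tangent z" using tangent_sym[OF p(1) zN] zp by simp
  obtain g where g: "tangent z = hyperplane g" using tangent_normal[OF zN z0] by blast
  have gp: "dot g p \<noteq> 0" using pz g by (simp add: in_hyperplane_iff)
  define c where "c = - dot g v / dot g p"
  have "v + c *s p \<in> N" using in_N_shift_tangent[OF p(1), of v c] v by (simp add: W_def)
  moreover have "v + c *s p \<in> tangent z" using gp by (simp add: g in_hyperplane_iff c_def)
  ultimately have contained: "z + t *s (v + c *s p) \<in> N" for t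
    using in_tangent_iff[OF zN] line[OF zN, of "v + c *s p" 1 t] by simp
  have F_t: "F (w + t *s v) = F w + t * (- c)" for t
  proof -
    have wt: "w + t *s v \<in> W" using w v(1) W_subspace by (intro vec.subspace_add vec.subspace_scale)
    have "z + t *s (v + c *s p) = r + (w + t *s v) + (t * c - F w) *s p"
      by (simp add: z_def vec.scale_right_distrib vec.scale_left_diff_distrib add_ac)
    then have "t * c - F w = - F (w + t *s v)" using contained[of t] F_iff[OF wt] by simp
    then show ?thesis by (simp add: algebra_simps)
  qed
  have "- c = 0 \<longleftrightarrow> dot g v = 0" using gp by (simp add: c_def)
  also have "\<dots> \<longleftrightarrow> v \<in> tangent z" by (simp add: g in_hyperplane_iff)
  also have "\<dots> \<longleftrightarrow> z \<in> tangent v" by (rule tangent_sym[OF zN v(2)])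
  finally show ?thesis using F_t unfolding z_def by blast
qed

lemma slope_zero_hyperplane:
  assumes v: "v \<in> W" "v \<in> N"
  shows "\<exists>g. \<forall>w\<in>W. F (w + v) = F w \<longleftrightarrow> dot g w = 0"
proof (cases "v = 0")
  case True
  then show ?thesis by (intro exI[of _ 0]) simp
next
  case False
  obtain g where g: "tangent v = hyperplane g" using tangent_normal[OF v(2) False] by blast
  have "p \<in> tangent v" "r \<in> tangent v"
    using v tangent_sym[OF p(1) v(2)] tangent_sym[OF r(1) v(2)] by (auto simp: W_def)
  then have gpr: "dot g p = 0" "dot g r = 0" by (simp_all add: g in_hyperplane_iff)
  have "F (w + v) = F w \<longleftrightarrow> dot g w = 0" if w: "w \<in> W" for w
  proof -
    obtain k where k: "\<forall>t. F (w + t *s v) = F w + t * k" "k = 0 \<longleftrightarrow> r + w + (- F w) *s p \<in> tangent v"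
      using F_affine[OF w v False] by blast
    have "F (w + v) = F w + k" using k(1)[rule_format, of 1] by simp
    then show ?thesis using k(2) gpr by (simp add: g in_hyperplane_iff)
  qed
  then show ?thesis by blast
qed

text \<open>
  If the points of \<open>N\<close> in \<open>W\<close> did not span \<open>W\<close>, there would be a hyperplane on \<open>p\<close>, other than
  \<open>tangent p\<close>, containing all of \<open>N\<close> in \<open>tangent p\<close>. As the lines on \<open>p\<close> off \<open>tangent p\<close> are secants, its
  intersection with \<open>N\<close> would be too large.
\<close>

lemma W_spanned: "W \<subseteq> vec.span (W \<inter> N)"
proof (rule ccontr)
  assume "\<not> ?thesis"
  then obtain w where w: "w \<in> W" "w \<notin> vec.span (W \<inter> N)" by blast
  let ?U = "vec.span (insert p (W \<inter> N))"
  have "w \<notin> ?U"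
  proof
    assume "w \<in> ?U"
    then obtain k where k: "w - k *s p \<in> vec.span (W \<inter> N)" using vec.span_breakdown_eq by blast
    moreover have "vec.span (W \<inter> N) \<subseteq> W" by (rule vec.span_minimal[OF _ W_subspace]) simp
    ultimately have "w - k *s p \<in> W" by blast
    then have "k = 0" using w(1) a(2) by (simp add: W_iff)
    then show False using k w(2) by simp
  qed
  then have "w \<notin> perp (perp (insert p (W \<inter> N)))" by (simp only: perp_perp_span) simp
  then obtain f where f: "f \<in> perp (insert p (W \<inter> N))" "dot w f \<noteq> 0" by (auto simp: perp_def)
  have fW: "dot f x = 0" if "x \<in> W \<inter> N" for x
    using f(1) that by (auto simp: perp_def)
  have fp: "dot f p = 0" using f(1) by (auto simp: perp_def)
  have f0: "f \<noteq> 0" using f(2) by auto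
  have wH: "w \<notin> hyperplane f" using f(2) by (simp add: in_hyperplane_iff dot_commute)
  let ?H = "hyperplane f"
  have adjH: "adj p \<subseteq> ?H"
  proof
    fix v assume v: "v \<in> adj p"
    then have vN: "v \<in> N" and vT: "v \<in> tangent p" using adj_eq[OF p(1)] by auto
    define x where "x = v + (- dot a v) *s p"
    have "x \<in> N" unfolding x_def using in_N_shift_tangent[OF p(1) vT] vN by blast
    moreover have "x \<in> W" using vT a(2) p_r by (simp add: x_def W_iff b(1) in_hyperplane_iff)
    ultimately have "dot f x = 0" using fW by blast
    then show "v \<in> ?H" using fp by (simp add: x_def in_hyperplane_iff)
  qed
  have "icard (?H \<inter> tangent p) = Q\<^sup>2"
  proof -
    have "b \<notin> perp ?H"
    proof
      assume "b \<in> perp ?H"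
      then obtain c where c: "b = c *s f" unfolding perp_perp_span in_span_singleton by blast
      have "b \<noteq> 0" using b(2) by auto
      then have "c \<noteq> 0" using c by auto
      then have "dot b w \<noteq> 0" using c wH by (simp add: in_hyperplane_iff)
      then show False using w(1) by (simp add: W_iff)
    qed
    then have "q * icard (?H \<inter> tangent p) = q * Q\<^sup>2"
      using size_subspace_hyperplane[OF subspace_perp[of "{f}"], of b] size_hyperplane[OF f0] by (simp add: b(1))
    then show ?thesis using q_ge_2 by simp
  qed
  then have rest: "icard (?H - tangent p) = q * Q\<^sup>2 - Q\<^sup>2"
    using card_Diff_subset_Int[of ?H "tangent p"] card_mono[of ?H "?H \<inter> tangent p"] size_hyperplane[OF f0]
    by (simp add: of_nat_diff)
  have "q * icard (N \<inter> ?H) = (\<Sum>x\<in>?H. hits p x)"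
    using sum_hits[OF subspace_perp, of p "{f}"] fp by (simp add: in_hyperplane_iff)
  also have "\<dots> = (\<Sum>x\<in>?H. (if x \<in> tangent p then 0 else 1) + (if x \<in> adj p then q else 0))"
  proof (rule sum.cong[OF refl])
    fix x
    show "hits p x = (if x \<in> tangent p then 0 else 1) + (if x \<in> adj p then q else 0)"
      using hits_cases[OF p(1), of x] q_ge_2 by (auto simp: tangent_def adj_eq_hits[OF p(1)])
  qed
  also have "\<dots> = icard (?H - tangent p) + q * icard (adj p)"
    using adjH by (simp add: sum.distrib sum.If_cases Diff_eq Int_absorb1)
  finally have eq: "q * icard (N \<inter> ?H) = q * Q\<^sup>2 - Q\<^sup>2 + q * (Q\<^sup>2 + e * (q - 1) * Q)"
    using rest size_adj[OF p] by simp
  have "Q > 0" using Q_ge_q q_ge_2 by simp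
  from section_size[OF f0] show False
  proof
    assume "icard (N \<inter> ?H) = Q\<^sup>2"
    from eq[unfolded this] have "(q - 1) * Q * (Q + q * e) = 0" by algebra
    then have "Q = - q * e" using q_ge_2 \<open>Q > 0\<close> by simp
    then have "e = -1" "Q = q" using sign \<open>Q > 0\<close> q_ge_2 by auto
    moreover have "n = 1"
    proof (rule ccontr)
      assume "n \<noteq> 1"
      then have "q\<^sup>2 \<le> Q" using n_pos power_increasing[of 2 n q] q_ge_2 by (simp add: Q_def)
      then show False using \<open>Q = q\<close> q_ge_2 by (simp add: power2_eq_square)
    qed
    ultimately show False using not_elliptic_solid by simp
  next
    assume "icard (N \<inter> ?H) = Q\<^sup>2 + e * (q - 1) * Q"
    from eq[unfolded this] have "(q - 1) * Q\<^sup>2 = 0" by algebra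
    then show False using q_ge_2 \<open>Q > 0\<close> by simp
  qed
qed

sublocale F: affine_along W "W \<inter> N" F
proof
  show "vec.subspace W" by (rule W_subspace)
  show "W \<subseteq> vec.span (W \<inter> N)" by (rule W_spanned)
  show "c *s u \<in> W \<inter> N" if "u \<in> W \<inter> N" for u c
    using that scale W_subspace by (auto intro: vec.subspace_scale)
  show "F u = 0" if "u \<in> W \<inter> N" for u using that F_zero_iff by auto
  show "F 0 = 0" using F_zero_iff vec.subspace_0[OF W_subspace] zero by auto
  show "\<exists>k. \<forall>t. F (w + t *s u) = F w + t * k" if "w \<in> W" "u \<in> W \<inter> N" for w u
    using F_affine[OF that(1), of u] that(2) by (cases "u = 0") (auto intro: exI[of _ 0])
  show "\<exists>g. \<forall>w\<in>W. F (w + u) = F w \<longleftrightarrow> dot g w = 0" if "u \<in> W \<inter> N" for u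
    using slope_zero_hyperplane that by blast
qed simp

definition proj :: "'a ^ 'm \<Rightarrow> 'a ^ 'm" where
  "proj v = v - dot a v *s p - dot b v *s r"

lemma proj_W: "proj v \<in> W"
  by (simp add: proj_def W_iff a(2) b(2) p_r)

lemma proj_add: "proj (x + y) = proj x + proj y"
  by (simp add: proj_def vec.scale_left_distrib algebra_simps)

lemma proj_scale: "proj (c *s x) = c *s proj x"
  by (simp add: proj_def vec.scale_right_diff_distrib)

lemma quadratic_form_on_V: "quadratic_form (\<lambda>v. dot a v * dot b v + F (proj v))"
proof (rule quadratic_form_add[OF quadratic_form_mult quadratic_formI])
  show "\<exists>h. \<forall>x. polar_form (\<lambda>v. F (proj v)) x y = dot h x" for y
  proof -
    obtain h where h: "\<forall>w\<in>W. polar_form F w (proj y) = dot h w" using F.polar_linear[OF proj_W] by blast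
    have "polar_form (\<lambda>v. F (proj v)) x y = dot (h - dot h p *s a - dot h r *s b) x" for x
    proof -
      have "polar_form (\<lambda>v. F (proj v)) x y = polar_form F (proj x) (proj y)"
        by (simp add: polar_form_def proj_add)
      also have "\<dots> = dot h (proj x)" using h proj_W by blast
      also have "\<dots> = dot (h - dot h p *s a - dot h r *s b) x" by (simp add: proj_def mult.commute)
      finally show ?thesis .
    qed
    then show ?thesis by blast
  qed
  show "F (proj (c *s x)) = c\<^sup>2 * F (proj x)" for c x
    unfolding proj_scale by (rule F.homogeneous[OF proj_W])
qed

text \<open>Off \<open>tangent p\<close>, a vector can be scaled to coordinate 1 at \<open>r\<close>, by homogeneity of \<open>F\<close>. Within
  \<open>tangent p\<close>, the coordinate at \<open>p\<close> does not matter.\<close>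

lemma in_N_iff: "v \<in> N \<longleftrightarrow> dot a v * dot b v + F (proj v) = 0"
proof -
  define x y w where "x = dot a v" and "y = dot b v" and "w = proj v"
  have w: "w \<in> W" unfolding w_def by (rule proj_W)
  have v: "v = x *s p + y *s r + w" by (simp add: x_def y_def w_def proj_def)
  have "v \<in> N \<longleftrightarrow> x * y + F w = 0"
  proof (cases "y = 0")
    case True
    then have "v = w + x *s p" using v by simp
    then show ?thesis
      using True F_zero_iff[OF w] in_N_shift_tangent[OF p(1), of w x] w by (simp add: W_def)
  next
    case False
    let ?w = "(1 / y) *s w"
    have w': "?w \<in> W" using W_subspace w by (rule vec.subspace_scale)
    have "v = y *s (r + ?w + (x / y) *s p)" using False by (simp add: v vec.scale_right_distrib)
    then have "v \<in> N \<longleftrightarrow> r + ?w + (x / y) *s p \<in> N" using in_N_scale_iff[OF False] by simp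
    also have "\<dots> \<longleftrightarrow> x / y = - F ?w" by (rule F_iff[OF w'])
    also have "F ?w = (1 / y)\<^sup>2 * F w" by (rule F.homogeneous[OF w])
    also have "x / y = - ((1 / y)\<^sup>2 * F w) \<longleftrightarrow> x * y + F w = 0"
      using False eq_neg_iff_add_eq_0[of "x * y" "F w"] by (simp add: field_simps power2_eq_square)
    finally show ?thesis .
  qed
  then show ?thesis by (simp add: x_def y_def w_def)
qed

end

context quadratic_cone
begin

theorem quadratic_equation: "\<exists>F. quadratic_form F \<and> N = {v. F v = 0}"
proof -
  have "\<not> N \<subseteq> {0}"
  proof
    assume "N \<subseteq> {0}"
    then have "icard N \<le> 1" using card_mono[of "{0}" N] by simp
    moreover have "icard N = Q * (q * Q + e * (q - 1))" unfolding size_N by (simp add: algebra_simps power2_eq_square)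
    moreover have "q * Q + e * (q - 1) \<ge> 2"
    proof -
      have "q * Q \<ge> q * 2" using Q_ge_q q_ge_2 by (intro mult_left_mono) auto
      moreover have "e * (q - 1) \<ge> - (q - 1)" using sign q_ge_2 by auto
      ultimately show ?thesis using q_ge_2 by linarith
    qed
    moreover have "Q \<ge> 2" using Q_ge_q q_ge_2 by simp
    ultimately show False using mult_mono[of 2 Q 2 "q * Q + e * (q - 1)"] by simp
  qed
  then obtain p where p: "p \<in> N" "p \<noteq> 0" by blast
  obtain r where r: "r \<in> N" "r \<noteq> 0" "r \<notin> tangent p" using exists_secant[OF p] .
  have p_r: "p \<notin> tangent r" using tangent_sym[OF p(1) r(1)] r(3) by simp
  obtain f where f: "tangent r = hyperplane f" using tangent_normal[OF r(1,2)] by blast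
  obtain g where g: "tangent p = hyperplane g" using tangent_normal[OF p] by blast
  have fp: "dot f p \<noteq> 0" and gr: "dot g r \<noteq> 0" using p_r r(3) f g by (auto simp: in_hyperplane_iff)
  have "hyperplane ((1 / dot f p) *s f) = hyperplane f" "hyperplane ((1 / dot g r) *s g) = hyperplane g"
    using fp gr by (auto simp: hyperplane_eq)
  then interpret secant_pair N n q Q e p r "(1 / dot f p) *s f" "(1 / dot g r) *s g"
    using p r f g fp gr by unfold_locales auto
  show ?thesis using quadratic_form_on_V in_N_iff by blast
qed

end

section \<open>Non-degenerate quadratic forms\<close>

lemma quadratic_form_polar:
  assumes "quadratic_form F"
  obtains f where "\<And>x y. polar_form F x y = dot (f y) x" "\<And>x y. f (x + y) = f x + f y"
    "\<And>c x. f (c *s x) = c *s f x" "\<And>c x. F (c *s x) = c\<^sup>2 * F x"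
proof -
  obtain c where c: "\<forall>x. F x = (\<Sum>i\<in>UNIV. \<Sum>j\<in>UNIV. c i j * x $ i * x $ j)"
    using assms by (auto simp: quadratic_form_def)
  define f where "f y = (\<chi> i. \<Sum>j\<in>UNIV. (c i j + c j i) * y $ j)" for y
  have "polar_form F x y = dot (f y) x" for x y
  proof -
    have "polar_form F x y = (\<Sum>i\<in>UNIV. \<Sum>j\<in>UNIV. c i j * x $ i * y $ j)
        + (\<Sum>i\<in>UNIV. \<Sum>j\<in>UNIV. c i j * y $ i * x $ j)"
      by (simp add: polar_form_def c algebra_simps sum.distrib)
    also have "(\<Sum>i\<in>UNIV. \<Sum>j\<in>UNIV. c i j * y $ i * x $ j) = (\<Sum>i\<in>UNIV. \<Sum>j\<in>UNIV. c j i * y $ j * x $ i)"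
      by (rule sum.swap)
    also have "(\<Sum>i\<in>UNIV. \<Sum>j\<in>UNIV. c i j * x $ i * y $ j) + \<dots> = dot (f y) x"
      by (simp add: dot_def f_def sum_distrib_left algebra_simps sum.distrib)
    finally show ?thesis .
  qed
  moreover have "f (x + y) = f x + f y" for x y
    by (simp add: f_def vec_eq_iff algebra_simps sum.distrib)
  moreover have "f (d *s x) = d *s f x" for d x
    by (simp add: f_def vec_eq_iff sum_distrib_left algebra_simps)
  moreover have "F (d *s x) = d\<^sup>2 * F x" for d x
    by (simp add: c sum_distrib_left algebra_simps power2_eq_square)
  ultimately show ?thesis using that by blast
qed

lemma card_affine_section:
  fixes S :: "('a::{field,finite} ^ 'm::finite) set"
  assumes S: "vec.subspace S" and f: "f \<notin> perp S"
  shows "CARD('a) * card {u \<in> S. dot f u = c} = card S"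
proof -
  obtain y where y: "y \<in> S" "dot f y \<noteq> 0" using f by (auto simp: perp_def)
  define x where "x = (c / dot f y) *s y"
  have x: "x \<in> S" "dot f x = c" using y S by (auto simp: x_def vec.subspace_scale)
  have "{u \<in> S. dot f u = c} = (\<lambda>u. u + x) ` (S \<inter> hyperplane f)"
  proof (intro equalityI subsetI)
    fix u assume "u \<in> {u \<in> S. dot f u = c}"
    then show "u \<in> (\<lambda>u. u + x) ` (S \<inter> hyperplane f)"
      using x S by (intro image_eqI[of _ _ "u - x"]) (auto simp: in_hyperplane_iff vec.subspace_diff)
  qed (use x S in \<open>auto simp: in_hyperplane_iff vec.subspace_add\<close>)
  then have "card {u \<in> S. dot f u = c} = card (S \<inter> hyperplane f)" by (simp add: card_image inj_on_def)
  then show ?thesis using card_subspace_Int_hyperplane[OF S f] by simp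
qed

text \<open>The map \<open>f\<close> is the polarity: it sends a vector to a normal vector of its polar hyperplane.\<close>

locale nondegenerate_form =
  fixes F :: "'a::{field,finite} ^ 'm::finite \<Rightarrow> 'a" and f :: "'a ^ 'm \<Rightarrow> 'a ^ 'm"
  assumes polar: "\<And>x y. polar_form F x y = dot (f y) x"
    and f_add: "\<And>x y. f (x + y) = f x + f y" and f_scale: "\<And>c x. f (c *s x) = c *s f x"
    and F_scale: "\<And>c x. F (c *s x) = c\<^sup>2 * F x"
    and f_zero_imp: "\<And>x. f x = 0 \<Longrightarrow> x = 0"
begin

lemma F_add: "F (x + y) = F x + F y + dot (f y) x"
  using polar[of x y] unfolding polar_form_def by (simp add: diff_eq_eq add.commute add.left_commute)

lemma F_0: "F 0 = 0"
  using F_scale[of 0 0] by simp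

lemma f_commute: "dot (f x) y = dot (f y) x"
  using polar[of x y] polar[of y x] polar_form_commute[of F x y] by simp

lemma f_diff: "f (x - y) = f x - f y"
  using f_add[of "x - y" y] by (simp add: algebra_simps)

lemma f_inj: "inj f"
proof (rule injI)
  fix x y assume "f x = f y"
  then have "f (x - y) = 0" by (simp add: f_diff)
  then have "x - y = 0" by (rule f_zero_imp)
  then show "x = y" by simp
qed

definition singular :: "('a ^ 'm) set \<Rightarrow> bool" where
  "singular U \<longleftrightarrow> vec.subspace U \<and> (\<forall>u\<in>U. F u = 0)"

lemma singular_polar: "singular U \<Longrightarrow> u \<in> U \<Longrightarrow> v \<in> U \<Longrightarrow> dot (f u) v = 0"
  using F_add[of v u] by (auto simp: singular_def vec.subspace_add)

text \<open>
  Each coset of \<open>U\<close> off the orthogonal space of \<open>U\<close> contains \<open>|U|/q\<close> zeros of \<open>F\<close>. If \<open>U\<close> is a maximal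
  totally singular subspace, then the zeros in the orthogonal space are those in \<open>U\<close>. So the number of
  zeros is determined by the size of \<open>U\<close>, and conversely.
\<close>

lemma count_zeros:
  assumes U: "singular U" and max: "\<And>V. singular V \<Longrightarrow> card V \<le> card U"
  shows "CARD('a) * card {x. F x = 0} + card (perp (f ` U)) = CARD('a) * card U + CARD('a) ^ CARD('m)"
proof -
  let ?q = "CARD('a)" and ?P = "perp (f ` U)" and ?Z = "{x. F x = 0}"
  have sub: "vec.subspace U" and FU: "\<And>u. u \<in> U \<Longrightarrow> F u = 0" using U by (auto simp: singular_def)
  have P_iff: "x \<in> ?P \<longleftrightarrow> (\<forall>u\<in>U. dot (f x) u = 0)" for x
  proof -
    have "dot x (f u) = dot (f x) u" for u using f_commute[of u x] by (simp add: dot_commute[of x])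
    then show ?thesis by (simp add: perp_def)
  qed
  have in_U: "x \<in> U" if x: "x \<in> ?P" "F x = 0" for x
  proof (rule ccontr)
    assume nx: "x \<notin> U"
    have "singular (vec.span (insert x U))"
      unfolding singular_def
    proof (intro conjI ballI vec.subspace_span)
      fix v assume "v \<in> vec.span (insert x U)"
      then obtain k where "v - k *s x \<in> vec.span U" using vec.span_breakdown_eq by blast
      moreover have "vec.span U = U" using sub by (simp only: vec.span_eq_iff)
      ultimately have u: "v - k *s x \<in> U" by simp
      have "F v = F ((v - k *s x) + k *s x)" by simp
      also have "\<dots> = F (v - k *s x) + F (k *s x) + dot (f (k *s x)) (v - k *s x)" by (rule F_add)
      also have "dot (f (k *s x)) (v - k *s x) = 0"
      proof -
        have "dot (f x) (v - k *s x) = 0" using x(1)[unfolded P_iff] u by blast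
        then show ?thesis unfolding f_scale dot_scale_left by (simp only: mult_zero_right)
      qed
      finally show "F v = 0" using FU[OF u] x(2) by (simp add: F_scale)
    qed
    then have "card (vec.span (insert x U)) \<le> card U" by (rule max)
    moreover have "card (vec.span (insert x U)) = ?q * card U"
      by (rule card_span_insert[of x U, unfolded vec.span_eq_iff[THEN iffD2, OF sub], OF nx])
    moreover have "card U > 0" using vec.subspace_0[OF sub] by (auto simp: card_gt_0_iff)
    ultimately show False using field_card_ge_2[where 'a='a] by simp
  qed
  have Z_P: "?Z \<inter> ?P = U"
  proof (intro equalityI subsetI)
    fix x assume "x \<in> U"
    then show "x \<in> ?Z \<inter> ?P" using FU singular_polar[OF U] unfolding Int_iff P_iff by blast
  qed (use in_U in blast)
  have coset: "?q * card {u \<in> U. F (x + u) = 0} =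
      (if x \<in> ?P then ?q * (if F x = 0 then card U else 0) else card U)" for x
  proof (cases "x \<in> ?P")
    case True
    have "F (x + u) = F x" if u: "u \<in> U" for u
    proof -
      have "dot (f u) x = 0" using True[unfolded P_iff] u f_commute[of x u] by simp
      then show ?thesis using F_add[of x u] FU[OF u] by simp
    qed
    then have "{u \<in> U. F (x + u) = 0} = (if F x = 0 then U else {})" by auto
    then show ?thesis using True by simp
  next
    case False
    then have np: "f x \<notin> perp U" unfolding P_iff by (simp add: perp_def)
    have "F (x + u) = 0 \<longleftrightarrow> dot (f x) u = - F x" if u: "u \<in> U" for u
      using F_add[of x u] FU[OF u] f_commute[of x u] by (simp add: add_eq_0_iff)
    then have "{u \<in> U. F (x + u) = 0} = {u \<in> U. dot (f x) u = - F x}" by auto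
    then show ?thesis using card_affine_section[OF sub np] False by simp
  qed
  have "(\<Sum>x\<in>UNIV. ?q * card {u \<in> U. F (x + u) = 0}) = ?q * (card U * card ?Z)"
  proof -
    have "(\<Sum>x\<in>UNIV. icard {u \<in> U. F (x + u) = 0}) = (\<Sum>u\<in>U. icard {x \<in> UNIV. F (x + u) = 0})"
      by (rule double_count) auto
    moreover have "card {x. F (x + u) = 0} = card ?Z" for u
    proof -
      have "{x. F (x + u) = 0} = (\<lambda>x. x - u) ` ?Z"
      proof (intro equalityI subsetI)
        fix x assume "x \<in> {x. F (x + u) = 0}"
        then show "x \<in> (\<lambda>x. x - u) ` ?Z" by (intro image_eqI[of _ _ "x + u"]) auto
      qed auto
      then show ?thesis by (simp add: card_image inj_on_def)
    qed
    ultimately have "int (\<Sum>x\<in>UNIV. card {u \<in> U. F (x + u) = 0}) = int (card U * card ?Z)" by simp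
    then show ?thesis unfolding of_nat_eq_iff sum_distrib_left[symmetric] by (rule arg_cong)
  qed
  moreover have "(\<Sum>x\<in>UNIV. ?q * card {u \<in> U. F (x + u) = 0}) =
      ?q * (card U * card U) + (?q ^ CARD('m) - card ?P) * card U"
  proof -
    have "(\<Sum>x\<in>UNIV. ?q * card {u \<in> U. F (x + u) = 0}) =
        (\<Sum>x\<in>UNIV. if x \<in> ?P then ?q * (if F x = 0 then card U else 0) else card U)"
      by (rule sum.cong[OF refl coset])
    also have "\<dots> = (\<Sum>x\<in>?P. ?q * (if F x = 0 then card U else 0)) + card (- ?P) * card U"
      by (simp add: sum.If_cases)
    also have "(\<Sum>x\<in>?P. ?q * (if F x = 0 then card U else 0)) = ?q * (card (?P \<inter> ?Z) * card U)"
      unfolding sum_distrib_left[symmetric] by (subst sum.If_cases) simp_all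
    also have "?P \<inter> ?Z = U" using Z_P by blast
    also have "card (- ?P) = ?q ^ CARD('m) - card ?P"
      by (simp add: Compl_eq_Diff_UNIV card_Diff_subset)
    finally show ?thesis .
  qed
  ultimately have "card U * (?q * card ?Z) = card U * (?q * card U + (?q ^ CARD('m) - card ?P))"
    by (simp add: algebra_simps)
  moreover have "card U > 0" using vec.subspace_0[OF sub] by (auto simp: card_gt_0_iff)
  ultimately have "?q * card ?Z = ?q * card U + (?q ^ CARD('m) - card ?P)"
    by (auto simp: card_gt_0_iff)
  moreover have "card ?P \<le> ?q ^ CARD('m)"
    using card_mono[of "UNIV :: ('a ^ 'm) set" ?P] card_vectors[where 'a='a and 'm='m] by simp
  ultimately show ?thesis by simp
qed

text \<open>As \<open>|U| |U\<^sup>\<bottom>|\<close> is the number of all vectors, the count is a quadratic equation for \<open>|U|\<close>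
  with exactly one positive root.\<close>

lemma maximal_singular_size:
  assumes U: "singular U" and max: "\<And>V. singular V \<Longrightarrow> card V \<le> card U"
    and dim: "CARD('m) = 2 * n + 2" and e: "e = 1 \<or> e = -1"
    and q: "q = int (CARD('a))" and Q: "Q = q ^ n"
    and zeros: "icard {x. F x = 0} = q * Q\<^sup>2 + e * (q - 1) * Q"
  shows "icard U = (if e = 1 then q * Q else Q)"
proof -
  let ?u = "icard U" and ?P = "perp (f ` U)"
  have q2: "q \<ge> 2" using field_card_ge_2[where 'a='a] by (simp add: q)
  have sub: "vec.subspace U" using U by (simp add: singular_def)
  have u0: "?u > 0" using vec.subspace_0[OF sub] by (auto simp: card_gt_0_iff)
  have V: "int (CARD('a) ^ CARD('m)) = q\<^sup>2 * Q\<^sup>2"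
    by (simp add: dim q Q power_add power_mult power2_eq_square flip: power_mult_distrib)
  have subf: "vec.subspace (f ` U)"
  proof (rule vec.subspaceI)
    have "f 0 = 0" using f_scale[of 0 0] by simp
    then show "0 \<in> f ` U" using vec.subspace_0[OF sub] by (metis imageI)
    show "x + y \<in> f ` U" if "x \<in> f ` U" "y \<in> f ` U" for x y
      using that vec.subspace_add[OF sub] by (auto simp: f_add[symmetric])
    show "c *s x \<in> f ` U" if "x \<in> f ` U" for c x
      using that vec.subspace_scale[OF sub] by (auto simp: f_scale[symmetric])
  qed
  have "card (f ` U) = card U" using f_inj by (simp add: card_image inj_on_subset)
  then have "card U * card ?P = CARD('a) ^ CARD('m)" using card_perp[OF subf] by simp
  then have UP: "?u * icard ?P = q\<^sup>2 * Q\<^sup>2" unfolding V[symmetric] by (simp only: of_nat_mult[symmetric])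
  have "int (CARD('a) * card {x. F x = 0} + card ?P) = int (CARD('a) * card U + CARD('a) ^ CARD('m))"
    using count_zeros[OF U max] by simp
  then have main: "q * (q * Q\<^sup>2 + e * (q - 1) * Q) + icard ?P = q * ?u + q\<^sup>2 * Q\<^sup>2"
    unfolding of_nat_add of_nat_mult zeros V q[symmetric] .
  have "q * (?u * ?u - e * (q - 1) * Q * ?u - q * Q\<^sup>2) = 0"
    using UP main by algebra
  then have eq: "?u * ?u - e * (q - 1) * Q * ?u - q * Q\<^sup>2 = 0" using q2 by simp
  have Q0: "Q > 0" using q2 by (simp add: Q)
  from e show ?thesis
  proof
    assume e1: "e = 1"
    have "(?u - q * Q) * (?u + Q) = 0" using eq unfolding e1 by algebra
    then show ?thesis using e1 u0 Q0 by auto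
  next
    assume e1: "e = -1"
    have "(?u - Q) * (?u + q * Q) = 0" using eq unfolding e1 by algebra
    moreover have "?u + q * Q \<noteq> 0" using u0 Q0 q2 by (smt (verit) mult_pos_pos)
    ultimately show ?thesis using e1 by simp
  qed
qed

end

section \<open>Points and quadrics\<close>

lemma proj_point_iff: "proj_subspace 0 p \<longleftrightarrow> (\<exists>v. v \<noteq> 0 \<and> p = vec.span {v})"
  for p :: "('a::{field,finite} ^ 'm::finite) set"
proof
  assume "proj_subspace 0 p"
  then have sub: "vec.subspace p" and d: "vec.dim p = 1" by (auto simp: proj_subspace_def)
  then have c: "card p = CARD('a)" using dim_eq_iff_card[of p 1] by simp
  then have "\<not> p \<subseteq> {0}" using card_mono[of "{0}" p] field_card_ge_2[where 'a='a] by auto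
  then obtain v where v: "v \<in> p" "v \<noteq> 0" by blast
  have "vec.span {v} \<subseteq> p" using v sub by (intro vec.span_minimal) auto
  then have "vec.span {v} = p" using c card_span_singleton[OF v(2)] by (intro card_subset_eq) auto
  then show "\<exists>v. v \<noteq> 0 \<and> p = vec.span {v}" using v by blast
next
  assume "\<exists>v. v \<noteq> 0 \<and> p = vec.span {v}"
  then obtain v where "v \<noteq> 0" "p = vec.span {v}" by blast
  then show "proj_subspace 0 p"
    using card_span_singleton[of v] dim_eq_iff_card[of p 1] by (simp add: proj_subspace_def)
qed

lemma span_in_points_of:
  fixes v :: "'a::{field,finite} ^ 'm::finite"
  assumes "v \<noteq> 0"
  shows "vec.subspace S \<Longrightarrow> vec.span {v} \<in> points_of S \<longleftrightarrow> v \<in> S"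
proof -
  assume S: "vec.subspace S"
  have "vec.span {v} \<subseteq> S \<longleftrightarrow> v \<in> S"
    using vec.span_minimal[OF _ S, of "{v}"] vec.span_superset[of "{v}"] by auto
  moreover have "proj_subspace 0 (vec.span {v})" using assms by (auto simp: proj_point_iff)
  ultimately show ?thesis by (simp add: points_of_def)
qed

lemma vanish_on_span:
  assumes "\<And>c x. G (c *s x) = c\<^sup>2 * (G x :: 'a::field)"
  shows "(\<forall>x\<in>vec.span {v}. G x = 0) \<longleftrightarrow> G v = 0"
proof
  assume "\<forall>x\<in>vec.span {v}. G x = 0"
  then show "G v = 0" using vec.span_base[of v "{v}"] by blast
next
  assume "G v = 0"
  then have "G (c *s v) = 0" for c by (simp add: assms)
  then show "\<forall>x\<in>vec.span {v}. G x = 0" unfolding Ball_def in_span_singleton by blast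
qed

definition quadric_of :: "('a::field ^ 'm::finite \<Rightarrow> 'a) \<Rightarrow> ('a ^ 'm) set set" where
  "quadric_of F = {p \<in> points_of UNIV. \<forall>v\<in>p. F v = 0}"

lemma points_subset_quadric_iff:
  fixes U :: "('a::{field,finite} ^ 'm::finite) set"
  assumes U: "vec.subspace U" and F0: "F 0 = 0"
  shows "points_of U \<subseteq> quadric_of F \<longleftrightarrow> (\<forall>u\<in>U. F u = 0)"
proof
  assume sub: "points_of U \<subseteq> quadric_of F"
  show "\<forall>u\<in>U. F u = 0"
  proof
    fix u assume u: "u \<in> U"
    show "F u = 0"
    proof (cases "u = 0")
      case False
      then have "vec.span {u} \<in> quadric_of F" using sub span_in_points_of[OF False U] u by blast
      then show ?thesis using vec.span_superset[of "{u}"] by (auto simp: quadric_of_def)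
    qed (simp add: F0)
  qed
qed (auto simp: quadric_of_def points_of_def)

context nondegenerate_form
begin

lemma proj_index:
  assumes dim: "CARD('m) = 2 * n + 2" and n: "n \<ge> 1" and e: "e = 1 \<or> e = -1"
    and q: "q = int (CARD('a))" and Q: "Q = q ^ n"
    and zeros: "icard {x. F x = 0} = q * Q\<^sup>2 + e * (q - 1) * Q"
  shows "has_proj_index (quadric_of F) (if e = 1 then n else n - 1)"
proof -
  let ?d = "if e = 1 then n else n - 1"
  have "singular {0}" by (simp add: singular_def F_0)
  moreover have "\<forall>V. singular V \<longrightarrow> card V < Suc (CARD('a ^ 'm))"
    using card_mono[of "UNIV :: ('a ^ 'm) set"] by (auto simp del: CARD_vec simp: less_Suc_eq_le)
  ultimately obtain U where U: "singular U" and max: "\<And>V. singular V \<Longrightarrow> card V \<le> card U"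
    using ex_has_greatest_nat[of singular "{0}" card] by blast
  have "icard U = q ^ (?d + 1)"
    using maximal_singular_size[OF U max dim e q Q zeros] n e by (auto simp: Q simp flip: power_Suc)
  then have "card U = CARD('a) ^ (?d + 1)"
    unfolding q by (simp only: of_nat_power[symmetric] of_nat_eq_iff)
  moreover have sub: "vec.subspace U" using U by (simp add: singular_def)
  ultimately have dU: "vec.dim U = ?d + 1" by (simp only: dim_eq_iff_card)
  have iff: "proj_subspace d V \<and> points_of V \<subseteq> quadric_of F \<longleftrightarrow> singular V \<and> vec.dim V = d + 1" for d V
    using points_subset_quadric_iff[of V F] F_0 by (auto simp: proj_subspace_def singular_def)
  show ?thesis
    unfolding has_proj_index_def iff
  proof (intro conjI allI impI exI)
    show "singular U" "vec.dim U = ?d + 1" by fact+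
    fix d V assume V: "singular V \<and> vec.dim V = d + 1"
    then have "card V \<le> card U" "vec.subspace V" using max by (auto simp: singular_def)
    then have "CARD('a) ^ (d + 1) \<le> CARD('a) ^ (?d + 1)"
      using card_subspace[of V] card_subspace[OF sub] V dU by simp
    then have "d + 1 \<le> ?d + 1" by (rule power_le_imp_le_exp[rotated]) (use field_card_ge_2[where 'a='a] in simp)
    then show "d \<le> ?d" by simp
  qed
qed

text \<open>
  The polarity \<open>f\<close> carries the quadric of \<open>F\<close> over to a quadric in the dual space; its form is
  \<open>F \<circ> f\<^sup>-\<^sup>1\<close>. The hyperplane with normal vector \<open>h\<close> is the polar of the point \<open>f h\<close>.
\<close>

definition dual_form :: "'a ^ 'm \<Rightarrow> 'a" where
  "dual_form x = F (inv f x)"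

lemma bij_f: "bij f"
  using f_inj by (simp add: bij_def finite_UNIV_inj_surj)

lemma inv_f [simp]: "inv f (f x) = x" "f (inv f x) = x"
  using f_inj bij_f by (simp_all add: bij_is_surj surj_f_inv_f)

lemma inv_f_add: "inv f (x + y) = inv f x + inv f y"
  using f_add[of "inv f x" "inv f y"] inv_f(1)[of "inv f x + inv f y"] by simp

lemma inv_f_scale: "inv f (c *s x) = c *s inv f x"
  using f_scale[of c "inv f x"] inv_f(1)[of "c *s inv f x"] by simp

lemma dual_form_polar: "polar_form dual_form x y = dot (inv f y) x"
proof -
  have "polar_form dual_form x y = polar_form F (inv f x) (inv f y)"
    by (simp add: polar_form_def dual_form_def inv_f_add)
  also have "\<dots> = dot y (inv f x)" by (simp add: polar)
  also have "\<dots> = dot (f (inv f x)) (inv f y)" using f_commute[of "inv f x" "inv f y"] by simp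
  finally show ?thesis by (simp add: dot_commute[of x])
qed

interpretation dual: nondegenerate_form dual_form "inv f"
proof
  show "polar_form dual_form x y = dot (inv f y) x" for x y by (rule dual_form_polar)
  show "dual_form (c *s x) = c\<^sup>2 * dual_form x" for c x
    by (simp add: dual_form_def inv_f_scale F_scale)
  show "x = 0" if "inv f x = 0" for x
    using that inv_f(2)[of x] f_scale[of 0 0] by simp
qed (simp_all add: inv_f_add inv_f_scale)

lemma quadratic_form_dual: "quadratic_form dual_form"
  by (rule quadratic_formI) (use dual.polar dual.F_scale in blast)+

lemma nonsingular_dual: "nonsingular_quadric UNIV (quadric_of dual_form)"
proof -
  have "v = 0" if v: "\<forall>w. polar_form dual_form v w = 0" for v
  proof (rule dot_nondegenerate)
    fix x
    have "polar_form dual_form v (f x) = dot x v" by (simp add: dual.polar)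
    then show "dot v x = 0" using v by (simp add: dot_commute[of v])
  qed
  then have "nonsingular_on UNIV dual_form" by (simp add: nonsingular_on_def)
  then show ?thesis unfolding nonsingular_quadric_def quadric_of_def using quadratic_form_dual by blast
qed

lemma card_dual_zeros: "card {x. dual_form x = 0} = card {x. F x = 0}"
proof -
  have "{x. F x = 0} = inv f ` {x. dual_form x = 0}"
  proof (intro equalityI subsetI)
    fix x assume "x \<in> {x. F x = 0}"
    then show "x \<in> inv f ` {x. dual_form x = 0}"
      by (intro image_eqI[of _ _ "f x"]) (auto simp: dual_form_def)
  qed (auto simp: dual_form_def)
  moreover have "inj (inv f)" using bij_f by (simp add: bij_imp_bij_inv bij_is_inj)
  ultimately show ?thesis by (metis card_image inj_on_subset top_greatest)
qed

lemma dual_proj_index: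
  assumes "CARD('m) = 2 * n + 2" "n \<ge> 1" "e = 1 \<or> e = -1" "q = int (CARD('a))" "Q = q ^ n"
    and "icard {x. F x = 0} = q * Q\<^sup>2 + e * (q - 1) * Q"
  shows "has_proj_index (quadric_of dual_form) (if e = 1 then n else n - 1)"
  using dual.proj_index[OF assms(1-5)] assms(6) by (simp add: card_dual_zeros)

text \<open>
  If \<open>F h = 0\<close>, then \<open>f h\<close> is a singular point of the section. No other form \<open>G\<close> with the same zeros on
  the hyperplane can be non-singular: it would have a secant through \<open>f h\<close>.
\<close>

lemma nonsingular_section_iff:
  assumes h: "h \<noteq> 0"
  shows "nonsingular_quadric (hyperplane h) (quadric_of dual_form \<inter> points_of (hyperplane h)) \<longleftrightarrow> F h \<noteq> 0"
proof -
  let ?H = "hyperplane h"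
  have sect: "quadric_of dual_form \<inter> points_of ?H = {p \<in> points_of ?H. \<forall>v\<in>p. dual_form v = 0}"
    by (auto simp: quadric_of_def points_of_def)
  show ?thesis
  proof (rule iffI)
    assume "nonsingular_quadric ?H (quadric_of dual_form \<inter> points_of ?H)"
    then obtain G where G: "quadratic_form G" "nonsingular_on ?H G"
      "quadric_of dual_form \<inter> points_of ?H = {p \<in> points_of ?H. \<forall>v\<in>p. G v = 0}"
      unfolding nonsingular_quadric_def by blast
    obtain g where g: "\<And>x y. polar_form G x y = dot (g y) x" "\<And>x y. g (x + y) = g x + g y"
      "\<And>c x. g (c *s x) = c *s g x" "\<And>c x. G (c *s x) = c\<^sup>2 * G x"
      by (rule quadratic_form_polar[OF G(1)]) (rule that)
    have same: "G v = 0 \<longleftrightarrow> dual_form v = 0" if v: "v \<in> ?H" for v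
    proof (cases "v = 0")
      case True
      then show ?thesis using g(4)[of 0 0] dual.F_0 by simp
    next
      case False
      then have "vec.span {v} \<in> points_of ?H" using span_in_points_of[OF False subspace_perp] v by blast
      moreover have "vec.span {v} \<in> {p \<in> points_of ?H. \<forall>v\<in>p. dual_form v = 0} \<longleftrightarrow>
          vec.span {v} \<in> {p \<in> points_of ?H. \<forall>v\<in>p. G v = 0}"
        unfolding G(3)[unfolded sect] by (rule refl)
      ultimately have "(\<forall>x\<in>vec.span {v}. G x = 0) \<longleftrightarrow> (\<forall>x\<in>vec.span {v}. dual_form x = 0)"
        by (simp only: mem_Collect_eq simp_thms)
      moreover have "(\<forall>x\<in>vec.span {v}. G x = 0) \<longleftrightarrow> G v = 0"
        using g(4) by (rule vanish_on_span)
      moreover have "(\<forall>x\<in>vec.span {v}. dual_form x = 0) \<longleftrightarrow> dual_form v = 0"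
        using dual.F_scale by (rule vanish_on_span)
      ultimately show ?thesis by blast
    qed
    show "F h \<noteq> 0"
    proof
      assume Fh: "F h = 0"
      define z where "z = f h"
      have "h + h = (2::'a) *s h" by (simp add: vec.scale_left_distrib[of 1 1, simplified])
      then have "dot (f h) h = 0" using F_add[of h h] F_scale[of 2 h] Fh by simp
      then have zH: "z \<in> ?H" by (simp add: z_def in_hyperplane_iff dot_commute[of h])
      have z0: "z \<noteq> 0" using h f_zero_imp[of h] unfolding z_def by blast
      have "G z = 0" using same[OF zH] Fh by (simp add: dual_form_def z_def)
      then obtain w where w: "w \<in> ?H" "polar_form G z w \<noteq> 0"
        using G(2) zH z0 unfolding nonsingular_on_def by blast
      have wt: "w + t *s z \<in> ?H" for t using w(1) zH subspace_perp by (intro vec.subspace_add vec.subspace_scale)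
      let ?k = "polar_form G z w"
      have G_t: "G (w + t *s z) = G w + t * ?k" for t
      proof -
        have "G (w + t *s z) = G w + G (t *s z) + polar_form G (t *s z) w"
          unfolding polar_form_def add.commute[of "t *s z" w] by simp
        moreover have "G (t *s z) = 0" using g(4)[of t z] \<open>G z = 0\<close> by simp
        moreover have "polar_form G (t *s z) w = t * ?k" unfolding g(1) by simp
        ultimately show ?thesis by simp
      qed
      have dual_t: "dual_form (w + t *s z) = dual_form w" for t
      proof -
        have "dual_form z = 0" using same[OF zH] \<open>G z = 0\<close> by blast
        then have "dual_form (t *s z) = 0" by (simp only: dual.F_scale mult_zero_right)
        moreover have "dot (inv f (t *s z)) w = 0"
          using w(1) by (simp add: inv_f_scale z_def in_hyperplane_iff)
        ultimately show ?thesis using dual.F_add[of w "t *s z"] by simp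
      qed
      have "G (w + (- G w / ?k) *s z) = 0" unfolding G_t using w(2) by simp
      then have "dual_form (w + (- G w / ?k) *s z) = 0" by (simp only: same[OF wt])
      then have "dual_form w = 0" by (simp only: dual_t)
      then have "G w = 0" "G (w + 1 *s z) = 0" using same[OF wt[of 1]] same[OF w(1)] dual_t[of 1] by simp_all
      then show False using G_t[of 1] w(2) by simp
    qed
  next
    assume Fh: "F h \<noteq> 0"
    have "nonsingular_on ?H dual_form"
      unfolding nonsingular_on_def
    proof (intro ballI impI)
      fix v assume v: "v \<in> ?H" "dual_form v = 0 \<and> (\<forall>w\<in>?H. polar_form dual_form v w = 0)"
      then have "dot (inv f v) w = 0" if "w \<in> ?H" for w
        using that dual.polar[of w v] by (simp add: polar_form_commute[of dual_form w v])
      then have "inv f v \<in> perp ?H" by (simp add: perp_def)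
      then obtain c where c: "inv f v = c *s h" unfolding perp_perp_span in_span_singleton by blast
      have "c\<^sup>2 * F h = 0" using v(2) c F_scale[of c h] by (simp add: dual_form_def)
      then have "inv f v = 0" using c Fh by simp
      then show "v = 0" by (rule dual.f_zero_imp)
    qed
    then show "nonsingular_quadric ?H (quadric_of dual_form \<inter> points_of ?H)"
      unfolding nonsingular_quadric_def sect using quadratic_form_dual by blast
  qed
qed

end

text \<open>
  A radical vector \<open>z\<close> of the polar form with \<open>F z \<noteq> 0\<close> would require characteristic 2. Then each coset of the
  line of \<open>z\<close> contains exactly one zero, because squaring is bijective, but \<open>N\<close> does not have this size.
\<close>

lemma (in quadratic_cone) polar_nondegenerate:
  assumes F: "quadratic_form F" "N = {v. F v = 0}" and rad: "\<And>x. polar_form F x z = 0"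
  shows "z = 0"
proof (rule ccontr)
  assume z0: "z \<noteq> 0"
  obtain f where f: "\<And>x y. polar_form F x y = dot (f y) x" "\<And>x y. f (x + y) = f x + f y"
    "\<And>c x. f (c *s x) = c *s f x" "\<And>c x. F (c *s x) = c\<^sup>2 * F x"
    by (rule quadratic_form_polar[OF F(1)]) (rule that)
  have Ft: "F (x + t *s z) = F x + t\<^sup>2 * F z" for x t
  proof -
    have "polar_form F x (t *s z) = 0" using rad[of x] by (simp add: f(1,3))
    then show ?thesis unfolding polar_form_def by (simp add: f(4) diff_eq_eq add.commute)
  qed
  show False
  proof (cases "F z = 0")
    case True
    then have zN: "z \<in> N" by (simp add: F(2))
    obtain r where r: "r \<in> N" "r \<notin> tangent z" using exists_secant[OF zN z0] by blast
    have "r + t *s z \<in> N" for t using r(1) Ft True by (simp add: F(2))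
    then have "hits z r = q" by (simp add: hits_eq_q_iff)
    then show False using r(2) q_ge_2 by (simp add: tangent_def)
  next
    case False
    have "F (z + 1 *s z) = F ((2::'a) *s z)" by (simp add: vec.scale_left_distrib[of 1 1, simplified])
    then have "F z + F z = 4 * F z" unfolding Ft f(4) by simp
    then have "2 * F z = 0" by algebra
    then have two: "(2::'a) = 0" using False by simp
    have "inj (\<lambda>t::'a. t\<^sup>2)"
    proof (rule injI)
      fix s t :: 'a assume st: "s\<^sup>2 = t\<^sup>2"
      have "(s - t)\<^sup>2 = s\<^sup>2 + t\<^sup>2 - 2 * s * t" by (rule power2_diff)
      also have "\<dots> = 2 * t\<^sup>2 - 2 * s * t" using st by simp
      also have "\<dots> = 0" using two by simp
      finally show "s = t" by simp
    qed
    then have "bij (\<lambda>t::'a. t\<^sup>2)" by (simp add: bij_def finite_UNIV_inj_surj)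
    then have sq: "\<exists>!t::'a. t\<^sup>2 = c" for c unfolding bij_iff by blast
    have "hits z x = 1" for x
    proof -
      have "x + t *s z \<in> N \<longleftrightarrow> t\<^sup>2 = - F x / F z" for t
        unfolding nonzero_eq_divide_eq[OF False] eq_neg_iff_add_eq_0 F(2) mem_Collect_eq Ft
        by (simp only: add.commute)
      then show ?thesis unfolding hits_eq_1_iff using sq by simp
    qed
    then have "q * icard N = icard (UNIV :: ('a ^ 'm) set)"
      using sum_hits[OF vec.subspace_UNIV, of z] by (simp del: CARD_vec)
    then have "q * (e * (q - 1) * Q) = 0"
      unfolding size_N size_UNIV by (simp add: algebra_simps power2_eq_square)
    then show False using q_ge_2 Q_ge_q sign by auto
  qed
qed

section \<open>Families of hyperplanes and cones in the dual space\<close>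

definition point_set :: "('a::field ^ 'm::finite) set \<Rightarrow> ('a ^ 'm) set set" where
  "point_set D = (\<lambda>v. vec.span {v}) ` (D - {0})"

lemma points_of_eq: "points_of S = point_set S" if "vec.subspace S" for S :: "('a::{field,finite} ^ 'm::finite) set"
proof (intro equalityI subsetI)
  fix p assume p: "p \<in> points_of S"
  then obtain v where v: "v \<noteq> 0" "p = vec.span {v}" by (auto simp: points_of_def proj_point_iff)
  then have "v \<in> S" using p span_in_points_of[OF v(1) that] by simp
  then show "p \<in> point_set S" using v by (auto simp: point_set_def)
next
  fix p assume "p \<in> point_set S"
  then obtain v where v: "v \<noteq> 0" "v \<in> S" "p = vec.span {v}" by (auto simp: point_set_def)
  then show "p \<in> points_of S" using span_in_points_of[OF v(1) that] by simp
qed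

lemma point_set_Int_points:
  fixes S D :: "('a::{field,finite} ^ 'm::finite) set"
  assumes S: "vec.subspace S"
  shows "point_set D \<inter> points_of S = point_set (D \<inter> S)"
proof (intro equalityI subsetI)
  fix p assume p: "p \<in> point_set D \<inter> points_of S"
  then obtain v where v: "v \<in> D" "v \<noteq> 0" "p = vec.span {v}" by (auto simp: point_set_def)
  then have "v \<in> S" using p span_in_points_of[OF v(2) S] by simp
  then show "p \<in> point_set (D \<inter> S)" using v by (auto simp: point_set_def)
next
  fix p assume "p \<in> point_set (D \<inter> S)"
  then obtain v where v: "v \<in> D" "v \<in> S" "v \<noteq> 0" "p = vec.span {v}" by (auto simp: point_set_def)
  then have "p \<in> points_of S" using span_in_points_of[OF v(3) S] by simp
  then show "p \<in> point_set D \<inter> points_of S" using v by (auto simp: point_set_def)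
qed

lemma card_point_set:
  fixes D :: "('a::{field,finite} ^ 'm::finite) set"
  assumes "0 \<in> D" "\<And>x c. x \<in> D \<Longrightarrow> c *s x \<in> D"
  shows "card D = 1 + (CARD('a) - 1) * card (point_set D)"
proof -
  have "card (D - {0}) = (CARD('a) - 1) * card (point_set D)"
    unfolding point_set_def by (rule card_union_of_lines) (auto simp: assms(2))
  moreover have "card D = 1 + card (D - {0})" using card_Suc_Diff1[OF finite assms(1)] by simp
  ultimately show ?thesis by (simp only:)
qed

lemma hyperplane_scale: "c \<noteq> 0 \<Longrightarrow> hyperplane (c *s f) = hyperplane f"
  by (simp add: hyperplane_eq)

lemma card_normals:
  fixes T :: "('a::{field,finite} ^ 'm::finite) set set"
  assumes "\<And>H. H \<in> T \<Longrightarrow> \<exists>f. f \<noteq> 0 \<and> H = hyperplane f"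
  shows "card {f. f \<noteq> 0 \<and> hyperplane f \<in> T} = (CARD('a) - 1) * card T"
proof -
  let ?S = "{f. f \<noteq> 0 \<and> hyperplane f \<in> T}"
  have "card ?S = (CARD('a) - 1) * card ((\<lambda>f. vec.span {f}) ` ?S)"
    by (rule card_union_of_lines) (auto simp: hyperplane_scale)
  moreover have "perp ` (\<lambda>f. vec.span {f}) ` ?S = T"
  proof -
    have "perp ` (\<lambda>f. vec.span {f}) ` ?S = hyperplane ` ?S" by (simp add: image_image perp_span)
    also have "\<dots> = T" using assms by blast
    finally show ?thesis .
  qed
  moreover have "inj_on perp ((\<lambda>f. vec.span {f}) ` ?S)"
  proof (rule inj_onI)
    fix A B assume "A \<in> (\<lambda>f. vec.span {f}) ` ?S" "B \<in> (\<lambda>f. vec.span {f}) ` ?S" and eq: "perp A = perp B"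
    then obtain f g where fg: "A = vec.span {f}" "B = vec.span {g}" by blast
    then have "hyperplane f = hyperplane g" using eq by (simp only: perp_span)
    then show "A = B" unfolding fg hyperplane_eq_iff .
  qed
  ultimately show ?thesis using card_image by fastforce
qed

lemma single_point_iff:
  fixes S :: "('a::{field,finite} ^ 'm::finite) set"
  assumes S: "vec.subspace S"
  shows "(\<exists>!p. p \<in> points_of S) \<longleftrightarrow> card S = CARD('a)"
proof -
  have "card S = 1 + (CARD('a) - 1) * card (points_of S)"
    unfolding points_of_eq[OF S] using S by (intro card_point_set vec.subspace_0 vec.subspace_scale)
  moreover have "1 + (CARD('a) - 1) * k = CARD('a) \<longleftrightarrow> k = 1" for k
  proof -
    have "1 + (CARD('a) - 1) * k = CARD('a) \<longleftrightarrow> (CARD('a) - 1) * k = (CARD('a) - 1) * 1"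
      using field_card_ge_2[where 'a='a] by linarith
    then show ?thesis unfolding mult_cancel1 using field_card_ge_2[where 'a='a] by auto
  qed
  moreover have "(\<exists>!p. p \<in> points_of S) \<longleftrightarrow> card (points_of S) = 1"
  proof -
    have "(\<exists>!p. p \<in> points_of S) \<longleftrightarrow> (\<exists>p. points_of S = {p})" by blast
    then show ?thesis unfolding One_nat_def card_1_singleton_iff .
  qed
  ultimately show ?thesis by simp
qed

lemma no_three_collinear_subset:
  assumes "no_three_collinear X" "Y \<subseteq> X"
  shows "no_three_collinear Y"
  unfolding no_three_collinear_def
proof
  assume "\<exists>L p1 p2 p3. proj_subspace 1 L \<and> {p1, p2, p3} \<subseteq> Y \<inter> points_of L \<and>
    p1 \<noteq> p2 \<and> p1 \<noteq> p3 \<and> p2 \<noteq> p3"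
  then obtain L p1 p2 p3 where "proj_subspace 1 L" "{p1, p2, p3} \<subseteq> Y \<inter> points_of L"
    "p1 \<noteq> p2" "p1 \<noteq> p3" "p2 \<noteq> p3" by (elim exE conjE) (rule that)
  moreover have "{p1, p2, p3} \<subseteq> X \<inter> points_of L"
    by (rule subset_trans[OF calculation(2) Int_mono[OF assms(2) order_refl]])
  ultimately have "\<exists>L p1 p2 p3. proj_subspace 1 L \<and> {p1, p2, p3} \<subseteq> X \<inter> points_of L \<and>
    p1 \<noteq> p2 \<and> p1 \<noteq> p3 \<and> p2 \<noteq> p3" by (intro exI conjI)
  then show False by (rule assms(1)[unfolded no_three_collinear_def, THEN notE])
qed

fun sign_of :: "quadric_sign \<Rightarrow> int" where
  "sign_of Upper = 1" | "sign_of Lower = -1"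

lemma signed_count_eq: "q \<ge> 1 \<Longrightarrow> int (signed_count s q n) = int q ^ n * (int q ^ n - sign_of s)"
  by (cases s) (simp_all add: of_nat_diff algebra_simps)

locale hyperplane_family =
  fixes n q :: nat and s :: quadric_sign and \<Sigma> :: "('a::{field,finite} ^ 'm::finite) set set"
  assumes n: "n \<ge> 1" and q: "q = CARD('a)" and dim: "CARD('m) = 2 * n + 2"
    and hyperplanes: "\<And>H. H \<in> \<Sigma> \<Longrightarrow> proj_subspace (2 * n) H"
    and P1: "\<And>p. proj_subspace 0 p \<Longrightarrow>
      card {H \<in> \<Sigma>. p \<subseteq> H} = signed_count s q n \<or> card {H \<in> \<Sigma>. p \<subseteq> H} = q ^ (2 * n)"
    and P2: "\<And>W. proj_subspace (2 * n - 1) W \<Longrightarrow> (\<exists>H\<in>\<Sigma>. W \<subseteq> H) \<Longrightarrow>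
      card {H \<in> \<Sigma>. W \<subseteq> H} \<ge> q - 1"
begin

text \<open>The complement of \<open>\<Sigma>\<close> in the dual space. In the quadric case, it consists of the tangent hyperplanes.\<close>

definition N :: "('a ^ 'm) set" where
  "N = {f. f = 0 \<or> hyperplane f \<notin> \<Sigma>}"

lemma q_ge_2: "q \<ge> 2"
  using field_card_ge_2[where 'a='a] q by simp

lemma proj_hyperplane_iff: "proj_subspace (2 * n) H \<longleftrightarrow> (\<exists>f. f \<noteq> 0 \<and> H = hyperplane f)"
  for H :: "('a ^ 'm) set"
proof
  assume "proj_subspace (2 * n) H"
  then have sub: "vec.subspace H" and d: "vec.dim H = 2 * n + 1" by (auto simp: proj_subspace_def)
  then have "CARD('a) * card H = CARD('a) ^ CARD('m)" using card_subspace[OF sub] by (simp add: dim)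
  then show "\<exists>f. f \<noteq> 0 \<and> H = hyperplane f" using exists_normal[OF sub] by metis
next
  assume "\<exists>f. f \<noteq> 0 \<and> H = hyperplane f"
  then obtain f where f: "f \<noteq> 0" "H = hyperplane f" by blast
  have "CARD('a) * card H = CARD('a) * CARD('a) ^ (2 * n + 1)"
    using card_hyperplane[OF f(1)] by (simp add: f(2) dim)
  then have "card H = CARD('a) ^ (2 * n + 1)" using q_ge_2 q by simp
  then show "proj_subspace (2 * n) H"
    using dim_eq_iff_card[of H "2 * n + 1"] by (simp add: proj_subspace_def f(2) subspace_perp)
qed

lemma proj_UNIV: "proj_subspace (2 * n + 1) (UNIV :: ('a ^ 'm) set)"
proof -
  have "vec.dim (UNIV :: ('a ^ 'm) set) = 2 * n + 2"
    using dim_eq_iff_card[OF vec.subspace_UNIV] card_vectors[where 'a='a and 'm='m] dim by metis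
  then show ?thesis by (simp add: proj_subspace_def)
qed

lemma family_eq: "\<Sigma> = {H. proj_subspace (2 * n) H \<and> R H}"
  if "\<And>f. f \<noteq> 0 \<Longrightarrow> f \<notin> N \<longleftrightarrow> R (hyperplane f)"
proof -
  have "H \<in> \<Sigma> \<longleftrightarrow> proj_subspace (2 * n) H \<and> R H" for H
  proof (cases "proj_subspace (2 * n) H")
    case True
    then obtain f where f: "f \<noteq> 0" "H = hyperplane f" unfolding proj_hyperplane_iff by blast
    then show ?thesis using that[OF f(1)] True by (simp add: N_def)
  qed (use hyperplanes in blast)
  then show ?thesis by blast
qed

lemma card_normals_family:
  assumes "T \<subseteq> \<Sigma>"
  shows "card {f. f \<noteq> 0 \<and> hyperplane f \<in> T} = (q - 1) * card T"
  unfolding q using assms hyperplanes proj_hyperplane_iff by (intro card_normals) blast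

lemma N_scale: "f \<in> N \<Longrightarrow> c *s f \<in> N"
  by (cases "c = 0") (auto simp: N_def hyperplane_scale)

text \<open>The hyperplanes of \<open>\<Sigma>\<close> on the point \<open>v\<close> are the points of the dual hyperplane \<open>v\<^sup>\<bottom>\<close> outside \<open>N\<close>.\<close>

lemma section_size:
  assumes v: "v \<noteq> 0"
  shows "icard (N \<inter> hyperplane v) = (int q ^ n)\<^sup>2 \<or>
    icard (N \<inter> hyperplane v) = (int q ^ n)\<^sup>2 + sign_of s * (int q - 1) * int q ^ n"
proof -
  let ?T = "{H \<in> \<Sigma>. vec.span {v} \<subseteq> H}" and ?Q = "int q ^ n"
  have sub: "vec.span {v} \<subseteq> hyperplane f \<longleftrightarrow> f \<in> hyperplane v" for f
  proof -
    have "vec.span {v} \<subseteq> hyperplane f \<longleftrightarrow> v \<in> hyperplane f"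
      using vec.span_minimal[OF _ subspace_perp, of "{v}" "{f}"] vec.span_base[of v "{v}"] by blast
    then show ?thesis by (simp add: in_hyperplane_iff dot_commute[of v])
  qed
  have "hyperplane v - N = {f. f \<noteq> 0 \<and> hyperplane f \<in> ?T}" by (auto simp: N_def sub)
  then have "card (hyperplane v - N) = (q - 1) * card ?T" using card_normals_family[of ?T] by simp
  moreover have "card (hyperplane v) = card (N \<inter> hyperplane v) + card (hyperplane v - N)"
    using card_Int_Diff[of "hyperplane v" N] by (simp only: finite Int_commute)
  ultimately have "icard (hyperplane v) = icard (N \<inter> hyperplane v) + (int q - 1) * icard ?T"
    using q_ge_2 by (simp add: of_nat_diff)
  moreover have "icard (hyperplane v) = int q * ?Q\<^sup>2"
  proof -
    have "q * card (hyperplane v) = q * (q * (q ^ n)\<^sup>2)"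
      using card_hyperplane[OF v] by (simp add: dim q power_add power_mult power2_eq_square flip: power_mult_distrib)
    then have "card (hyperplane v) = q * (q ^ n)\<^sup>2" using q_ge_2 by simp
    then show ?thesis by simp
  qed
  moreover have "icard ?T = ?Q * (?Q - sign_of s) \<or> icard ?T = ?Q\<^sup>2"
  proof -
    have "proj_subspace 0 (vec.span {v})" using v by (auto simp: proj_point_iff)
    then have "card ?T = signed_count s q n \<or> card ?T = q ^ (2 * n)" by (rule P1)
    then show ?thesis using signed_count_eq[of q s n] q_ge_2
      by (auto simp: power_mult power2_eq_square mult.commute simp flip: power_mult_distrib)
  qed
  ultimately have eq: "icard (N \<inter> hyperplane v) = int q * ?Q\<^sup>2 - (int q - 1) * icard ?T"
    and T: "icard ?T = ?Q * (?Q - sign_of s) \<or> icard ?T = ?Q\<^sup>2" by simp_all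
  from T show ?thesis
  proof
    assume T: "icard ?T = ?Q * (?Q - sign_of s)"
    show ?thesis unfolding eq T by (rule disjI2) (simp add: algebra_simps power2_eq_square)
  next
    assume T: "icard ?T = ?Q\<^sup>2"
    show ?thesis unfolding eq T by (rule disjI1) (simp add: algebra_simps power2_eq_square)
  qed
qed

text \<open>
  By (P2), a line of the dual space with at least one point outside \<open>N\<close> has at most two points in \<open>N\<close>.
\<close>

lemma N_line:
  assumes x: "x \<in> N" and y: "y \<in> N" and xy: "x + y \<in> N"
  shows "c *s x + d *s y \<in> N"
proof (rule ccontr)
  define z where "z = c *s x + d *s y"
  assume "c *s x + d *s y \<notin> N"
  then have z: "z \<notin> N" by (simp add: z_def)
  have x0: "x \<noteq> 0" using z N_scale[OF y] by (auto simp: z_def)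
  have yx: "y \<notin> vec.span {x}"
  proof
    assume "y \<in> vec.span {x}"
    then obtain k where "y = k *s x" by (auto simp: in_span_singleton)
    then have "z = (c + d * k) *s x" by (simp add: z_def vec.scale_left_distrib)
    then show False using z N_scale[OF x] by simp
  qed
  let ?D = "vec.span {x, y}" and ?W = "perp {x, y}"
  have cD: "card ?D = q\<^sup>2" using card_span_pair[OF x0 yx] q by simp
  have "q\<^sup>2 * card ?W = q\<^sup>2 * q ^ (2 * n)"
    using card_perp[OF vec.subspace_span, of "{x, y}"] cD
    by (simp only: perp_span dim q power_add mult.commute)
  then have "card ?W = CARD('a) ^ (2 * n)" using q_ge_2 q by simp
  then have W: "proj_subspace (2 * n - 1) ?W"
    using dim_eq_iff_card[OF subspace_perp, of "{x, y}" "2 * n"] n by (simp add: proj_subspace_def subspace_perp)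
  have sub: "?W \<subseteq> hyperplane f \<longleftrightarrow> f \<in> ?D" for f
    unfolding perp_perp_span[symmetric] using perp_subset_iff[of "{f}" ?W] perp_subset_iff[of ?W "{f}"] by simp
  have "z \<in> ?D" unfolding in_span_pair z_def by blast
  then have "\<exists>H\<in>\<Sigma>. ?W \<subseteq> H" using z sub[of z] by (auto simp: N_def)
  then have ge: "card {H \<in> \<Sigma>. ?W \<subseteq> H} \<ge> q - 1" by (rule P2[OF W])
  have "?D - N = {f. f \<noteq> 0 \<and> hyperplane f \<in> {H \<in> \<Sigma>. ?W \<subseteq> H}}"
    unfolding mem_Collect_eq sub by (auto simp: N_def simp del: vec.span_insert)
  then have "card (?D - N) = (q - 1) * card {H \<in> \<Sigma>. ?W \<subseteq> H}"
    using card_normals_family[of "{H \<in> \<Sigma>. ?W \<subseteq> H}"] by simp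
  then have out: "card (?D - N) \<ge> (q - 1) * (q - 1)" using ge by simp
  have "card (N \<inter> ?D) = 1 + (q - 1) * card (point_set (N \<inter> ?D))"
    unfolding q
  proof (rule card_point_set)
    show "0 \<in> N \<inter> ?D" using vec.span_zero by (auto simp: N_def simp del: vec.span_insert)
    show "c *s f \<in> N \<inter> ?D" if "f \<in> N \<inter> ?D" for f c
      using that N_scale vec.span_scale[of f "{x, y}" c] by blast
  qed
  moreover have "card (point_set (N \<inter> ?D)) \<ge> 3"
  proof -
    have memD: "x \<in> ?D" "y \<in> ?D" by (rule vec.span_base, simp)+
    then have "x + y \<in> ?D" by (rule vec.span_add)
    note memD = memD this
    have y0: "y \<noteq> 0" using yx vec.span_zero by blast
    have xy0: "x + y \<noteq> 0"
    proof
      assume "x + y = 0"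
      then have "y = (-1) *s x" by (simp add: eq_neg_iff_add_eq_0 add.commute)
      then show False using yx unfolding in_span_singleton by blast
    qed
    have d1: "vec.span {x} \<noteq> vec.span {y}" using yx vec.span_base[of y "{y}"] by auto
    have d2: "vec.span {x} \<noteq> vec.span {x + y}"
    proof
      assume "vec.span {x} = vec.span {x + y}"
      then have "x + y \<in> vec.span {x}" using vec.span_base[of "x + y" "{x + y}"] by auto
      then have "x + y - x \<in> vec.span {x}" by (rule vec.span_diff) (rule vec.span_base, simp)
      then show False using yx by simp
    qed
    have d3: "vec.span {y} \<noteq> vec.span {x + y}"
    proof
      assume "vec.span {y} = vec.span {x + y}"
      then have "x + y \<in> vec.span {y}" using vec.span_base[of "x + y" "{x + y}"] by auto
      then have "x + y - y \<in> vec.span {y}" by (rule vec.span_diff) (rule vec.span_base, simp)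
      then have "x \<in> vec.span {y}" by simp
      then obtain k where k: "x = k *s y" by (auto simp: in_span_singleton)
      then have "k \<noteq> 0" using x0 by auto
      then have "y = inverse k *s x" using k by simp
      then show False using yx unfolding in_span_singleton by blast
    qed
    have "{vec.span {x}, vec.span {y}, vec.span {x + y}} \<subseteq> point_set (N \<inter> ?D)"
      using memD x y xy x0 y0 xy0 by (auto simp: point_set_def simp del: vec.span_insert)
    from card_mono[OF _ this] d1 d2 d3 show ?thesis by simp
  qed
  ultimately have ins: "card (N \<inter> ?D) \<ge> 1 + (q - 1) * 3" by simp
  have "card ?D = card (N \<inter> ?D) + card (?D - N)"
    using card_Int_Diff[of ?D N] by (simp only: finite Int_commute)
  then have "q\<^sup>2 \<ge> 1 + (q - 1) * 3 + (q - 1) * (q - 1)" using cD out ins by linarith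
  moreover obtain k where "q = k + 2" using q_ge_2 by (metis add.commute le_Suc_ex)
  ultimately show False by (simp add: power2_eq_square)
qed

sublocale cone: two_character_cone N n "int q" "int q ^ n" "sign_of s"
proof
  show "sign_of s = 1 \<or> sign_of s = -1" by (cases s) auto
  show "int q = int CARD('a)" using q by simp
  show "0 \<in> N" by (simp add: N_def)
qed (use n dim N_scale section_size in auto)

text \<open>The hyperplanes in \<open>\<Sigma>\<close> are those with \<open>F h \<noteq> 0\<close>, the polars of the points off the dual quadric.\<close>

lemma quadric_of_hyperplanes:
  assumes "n \<ge> 2 \<and> q > 2 \<or> n = 1 \<and> s = Upper"
  shows "\<exists>X. signed_quadric s n X \<and>
    \<Sigma> = {H. proj_subspace (2 * n) H \<and> parabolic_quadric n H (X \<inter> points_of H)}"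
proof -
  have size: "icard N = int q * (int q ^ n)\<^sup>2 + sign_of s * (int q - 1) * int q ^ n"
    using cone.size_cases assms by auto
  interpret tallini_cone N n "int q" "int q ^ n" "sign_of s"
    by unfold_locales (use N_line size in auto)
  interpret quadratic_cone N n "int q" "int q ^ n" "sign_of s"
  proof
    show "vec.subspace (tangent p)" if "p \<in> N" "p \<noteq> 0" for p
      using assms tangent_subspace_general[OF that] tangent_subspace_hyperbolic_solid[OF that] by auto
  qed (use assms in auto)
  obtain F where F: "quadratic_form F" "N = {v. F v = 0}" using quadratic_equation by blast
  obtain f where f: "\<And>x y. polar_form F x y = dot (f y) x" "\<And>x y. f (x + y) = f x + f y"
    "\<And>c x. f (c *s x) = c *s f x" "\<And>c x. F (c *s x) = c\<^sup>2 * F x"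
    by (rule quadratic_form_polar[OF F(1)]) (rule that)
  interpret nondegenerate_form F f
  proof
    show "x = 0" if "f x = 0" for x
      by (rule polar_nondegenerate[OF F]) (simp add: f(1) that)
  qed (use f in auto)
  let ?X = "quadric_of dual_form"
  have zeros: "icard {x. F x = 0} = int q * (int q ^ n)\<^sup>2 + sign_of s * (int q - 1) * int q ^ n"
    using size F(2) by simp
  have "has_proj_index ?X (if sign_of s = 1 then n else n - 1)"
    by (rule dual_proj_index[OF dim n _ _ refl zeros]) (cases s, use q in auto)
  moreover have "proj_subspace (2 * n + 1) (UNIV :: ('a ^ 'm) set)" by (rule proj_UNIV)
  ultimately have "signed_quadric s n ?X"
    using nonsingular_dual by (cases s) (simp_all add: hyperbolic_quadric_def elliptic_quadric_def)
  moreover have "\<Sigma> = {H. proj_subspace (2 * n) H \<and> parabolic_quadric n H (?X \<inter> points_of H)}"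
  proof (rule family_eq)
    fix h :: "'a ^ 'm" assume h: "h \<noteq> 0"
    then have "proj_subspace (2 * n) (hyperplane h)" using proj_hyperplane_iff by blast
    then show "h \<notin> N \<longleftrightarrow> parabolic_quadric n (hyperplane h) (?X \<inter> points_of (hyperplane h))"
      using nonsingular_section_iff[OF h] F(2) by (simp add: parabolic_quadric_def)
  qed
  ultimately show ?thesis by blast
qed

text \<open>
  The two sizes of \<open>N\<close> lead to the two families. For a plane with normal vector \<open>f\<close>, the section of the dual
  ovoid has \<open>q + 1\<close> points iff \<open>f \<notin> N\<close>. If \<open>N\<close> is a line of the dual space, its planes are those containing
  a fixed line \<open>L\<close> of the original space.
\<close>

lemma elliptic_solid:
  assumes n1: "n = 1" and s: "s = Lower"
  shows "(\<exists>X. ovoid X \<and> \<Sigma> = {H. proj_subspace 2 H \<and> oval_in H (X \<inter> points_of H)}) \<or>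
    (\<exists>L. proj_subspace 1 L \<and> \<Sigma> = {H. proj_subspace 2 H \<and> (\<exists>!p. p \<in> points_of L \<inter> points_of H)})"
proof -
  have two_n: "2 * n = 2" using n1 by simp
  interpret elliptic_solid_cone N n "int q" "int q ^ n" "sign_of s"
    by unfold_locales (use n1 s in auto)
  from cone.size_cases show ?thesis
  proof
    assume M: "icard N = int q * (int q ^ n)\<^sup>2 + sign_of s * (int q - 1) * int q ^ n"
    have dual_scale: "c *s v \<in> cone.dual" if "v \<in> cone.dual" for v c
      using that by (cases "c = 0") (auto simp: cone.dual_def hyperplane_scale)
    let ?X = "point_set cone.dual"
    have card_X: "icard (cone.dual \<inter> S) = 1 + (int q - 1) * icard (?X \<inter> points_of S)"
      if S: "vec.subspace S" for S
    proof -
      have "card (cone.dual \<inter> S) = 1 + (CARD('a) - 1) * card (point_set (cone.dual \<inter> S))"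
        using vec.subspace_0[OF S] vec.subspace_scale[OF S] dual_scale
        by (intro card_point_set) (auto simp: cone.dual_def)
      then show ?thesis using q_ge_2 by (simp add: point_set_Int_points[OF S] q[symmetric] of_nat_diff)
    qed
    have X_UNIV: "?X \<subseteq> points_of UNIV"
      unfolding points_of_eq[OF vec.subspace_UNIV] point_set_def by (rule image_mono) auto
    have "1 + (int q - 1) * icard ?X = int q ^ 3 - (int q)\<^sup>2 + int q"
      using card_X[OF vec.subspace_UNIV] dual_size[OF M] unfolding Int_absorb2[OF X_UNIV] by simp
    then have "(int q - 1) * icard ?X = (int q - 1) * ((int q)\<^sup>2 + 1)"
      by (simp add: algebra_simps power2_eq_square power3_eq_cube)
    then have "icard ?X = (int q)\<^sup>2 + 1" using q_ge_2 by simp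
    then have "icard ?X = int (q\<^sup>2 + 1)" by simp
    then have cX: "card ?X = CARD('a) ^ 2 + 1" unfolding of_nat_eq_iff q .
    have plane: "card (?X \<inter> points_of (hyperplane f)) = (if f \<in> N then 1 else q + 1)" if f: "f \<noteq> 0" for f
    proof -
      have "(int q - 1) * icard (?X \<inter> points_of (hyperplane f)) = (int q - 1) * (if f \<in> N then 1 else int q + 1)"
        using card_X[OF subspace_perp, of "{f}"] dual_plane[OF M f]
        by (cases "f \<in> N") (simp_all add: algebra_simps power2_eq_square)
      then have "icard (?X \<inter> points_of (hyperplane f)) = (if f \<in> N then 1 else int q + 1)"
        using q_ge_2 by simp
      then show ?thesis by (auto split: if_splits)
    qed
    have cap: "no_three_collinear ?X"
      unfolding no_three_collinear_def
    proof
      assume "\<exists>L p1 p2 p3. proj_subspace 1 L \<and> {p1, p2, p3} \<subseteq> ?X \<inter> points_of L \<and> p1 \<noteq> p2 \<and> p1 \<noteq> p3 \<and> p2 \<noteq> p3"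
      then obtain L p1 p2 p3 where L: "proj_subspace 1 L" and p: "{p1, p2, p3} \<subseteq> ?X \<inter> points_of L"
        "p1 \<noteq> p2" "p1 \<noteq> p3" "p2 \<noteq> p3" by (elim exE conjE) (rule that)
      have sub: "vec.subspace L" and "card L = CARD('a) ^ 2"
        using L card_subspace[of L] by (auto simp: proj_subspace_def power2_eq_square)
      then have le: "icard (cone.dual \<inter> L) \<le> 2 * int q - 1" using dual_line[OF M sub] q by simp
      have "card {p1, p2, p3} \<le> card (?X \<inter> points_of L)" by (rule card_mono[OF _ p(1)]) simp
      then have "3 \<le> icard (?X \<inter> points_of L)" using p(2-4) by simp
      then have "(int q - 1) * 3 \<le> (int q - 1) * icard (?X \<inter> points_of L)"
        using q_ge_2 by (intro mult_left_mono) auto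
      then have "1 + (int q - 1) * 3 \<le> 2 * int q - 1" using le card_X[OF sub] by linarith
      then show False using q_ge_2 by simp
    qed
    have "ovoid ?X"
      unfolding ovoid_def
    proof (intro conjI allI impI)
      show "proj_subspace 3 (UNIV :: ('a ^ 'm) set)" using proj_UNIV n1 by (simp add: numeral_eq_Suc)
      fix P :: "('a ^ 'm) set" assume "proj_subspace 2 P"
      then obtain f where f: "f \<noteq> 0" "P = hyperplane f" unfolding proj_hyperplane_iff[unfolded two_n] by blast
      then show "card (?X \<inter> points_of P) \<in> {1, CARD('a) + 1}" using plane[OF f(1)] q by simp
    qed (use X_UNIV cX cap in auto)
    moreover have "\<Sigma> = {H. proj_subspace 2 H \<and> oval_in H (?X \<inter> points_of H)}"
    proof (rule family_eq[unfolded two_n])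
      fix f :: "'a ^ 'm" assume f: "f \<noteq> 0"
      then have "proj_subspace 2 (hyperplane f)" unfolding proj_hyperplane_iff[unfolded two_n] by blast
      moreover have "no_three_collinear (?X \<inter> points_of (hyperplane f))"
        by (rule no_three_collinear_subset[OF cap]) simp
      ultimately show "f \<notin> N \<longleftrightarrow> oval_in (hyperplane f) (?X \<inter> points_of (hyperplane f))"
        using plane[OF f] q q_ge_2 by (simp add: oval_in_def)
    qed
    ultimately show ?thesis by blast
  next
    assume "n = 1 \<and> sign_of s = -1 \<and> icard N = (int q)\<^sup>2"
    then have M: "icard N = (int q)\<^sup>2" by simp
    have N: "vec.subspace N" by (rule size_of_line_imp_subspace[OF M])
    define L where "L = perp N"
    have L: "vec.subspace L" by (simp add: L_def subspace_perp)
    have NL: "N = perp L" unfolding L_def by (rule perp_perp[OF N, symmetric])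
    have "(int q)\<^sup>2 * icard L = (int q)\<^sup>2 * (int q)\<^sup>2"
      using cone.size_perp[OF N] M n1 by (simp add: L_def)
    then have "icard L = (int q)\<^sup>2" unfolding mult_cancel_left using q_ge_2 by auto
    then have "icard L = int (q\<^sup>2)" by simp
    then have cL: "card L = CARD('a) ^ 2" unfolding of_nat_eq_iff q .
    then have "proj_subspace 1 L" using dim_eq_iff_card[OF L, of 2] L by (simp add: proj_subspace_def)
    moreover have "\<Sigma> = {H. proj_subspace 2 H \<and> (\<exists>!p. p \<in> points_of L \<inter> points_of H)}"
    proof (rule family_eq[unfolded two_n])
      fix f :: "'a ^ 'm"
      let ?H = "hyperplane f"
      have LH: "vec.subspace (L \<inter> ?H)" by (rule vec.subspace_inter[OF L subspace_perp])
      have "points_of L \<inter> points_of ?H = points_of (L \<inter> ?H)" by (auto simp: points_of_def)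
      then have "(\<exists>!p. p \<in> points_of L \<inter> points_of ?H) \<longleftrightarrow> card (L \<inter> ?H) = CARD('a)"
        using single_point_iff[OF LH] by simp
      also have "\<dots> \<longleftrightarrow> CARD('a) * card (L \<inter> ?H) = CARD('a) ^ 2" by (simp add: power2_eq_square)
      also have "\<dots> \<longleftrightarrow> f \<notin> N"
        using card_subspace_Int_hyperplane_cases[OF L, of f] cL q_ge_2 q NL by (auto simp: power2_eq_square)
      finally show "f \<notin> N \<longleftrightarrow> (\<exists>!p. p \<in> points_of L \<inter> points_of ?H)" by simp
    qed
    ultimately show ?thesis by blast
  qed
qed

end

theorem theorem1p2:
  fixes n q :: nat
    and s :: quadric_sign
    and \<Sigma> :: "('a::{field,finite} ^ 'm::finite) set set"
  assumes n: "n \<ge> 1"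
    and q: "q = CARD('a)"
    and dim: "CARD('m) = 2 * n + 2"
    and hyperplanes: "\<And>H. H \<in> \<Sigma> \<Longrightarrow> proj_subspace (2 * n) H"
    and nonempty: "\<Sigma> \<noteq> {}"
    and P1: "\<And>p. proj_subspace 0 p \<Longrightarrow>
               card {H \<in> \<Sigma>. p \<subseteq> H} = signed_count s q n \<or> card {H \<in> \<Sigma>. p \<subseteq> H} = q ^ (2 * n)"
    and P2: "\<And>W. proj_subspace (2 * n - 1) W \<Longrightarrow> (\<exists>H\<in>\<Sigma>. W \<subseteq> H) \<Longrightarrow>
               card {H \<in> \<Sigma>. W \<subseteq> H} \<ge> q - 1"
  shows "(n \<ge> 2 \<and> q > 2 \<longrightarrow>
            (\<exists>X. signed_quadric s n X \<and>
              \<Sigma> = {H. proj_subspace (2 * n) H \<and> parabolic_quadric n H (X \<inter> points_of H)})) \<and>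
         (n = 1 \<and> s = Upper \<longrightarrow>
            (\<exists>X. hyperbolic_quadric 1 X \<and>
              \<Sigma> = {H. proj_subspace 2 H \<and> parabolic_quadric 1 H (X \<inter> points_of H)})) \<and>
         (n = 1 \<and> s = Lower \<longrightarrow>
            ((\<exists>X. ovoid X \<and>
              \<Sigma> = {H. proj_subspace 2 H \<and> oval_in H (X \<inter> points_of H)}) \<or>
            (\<exists>L. proj_subspace 1 L \<and>
              \<Sigma> = {H. proj_subspace 2 H \<and> (\<exists>!p. p \<in> points_of L \<inter> points_of H)})))"
proof -
  interpret hyperplane_family n q s \<Sigma>
    by unfold_locales (fact n q dim hyperplanes P1 P2)+
  show ?thesis
  proof (intro conjI impI)
    assume "n \<ge> 2 \<and> q > 2"
    then show "\<exists>X. signed_quadric s n X \<and>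
        \<Sigma> = {H. proj_subspace (2 * n) H \<and> parabolic_quadric n H (X \<inter> points_of H)}"
      by (intro quadric_of_hyperplanes disjI1)
  next
    assume a: "n = 1 \<and> s = Upper"
    then show "\<exists>X. hyperbolic_quadric 1 X \<and>
        \<Sigma> = {H. proj_subspace 2 H \<and> parabolic_quadric 1 H (X \<inter> points_of H)}"
      using quadric_of_hyperplanes by auto
  next
    assume "n = 1 \<and> s = Lower"
    then show "(\<exists>X. ovoid X \<and> \<Sigma> = {H. proj_subspace 2 H \<and> oval_in H (X \<inter> points_of H)}) \<or>
        (\<exists>L. proj_subspace 1 L \<and> \<Sigma> = {H. proj_subspace 2 H \<and> (\<exists>!p. p \<in> points_of L \<inter> points_of H)})"
      using elliptic_solid by blast
  qed
qed

end
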